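(* Let $(\mu_n)_{n\in\mathbb N\cup\{\infty\}}\subset\mathscr K(X)$ be such that $\mu_n\to\mu_\infty$ vaguely and $G^{\mu_n}1\to G^{\mu_\infty}1$ uniformly on $X$. Let $(v_n)_{n\in\mathbb N\cup\{\infty\}}\subset C_0(X)$, so that $t\mapsto\check{\bf S}^n_tv_n$ is the unique classical solution of the evolution equation $$-\frac{\partial u_n(t)}{\partial t}\in\check L^n_{\rm rel}u_n(t)-v_n,\qquad u_n(0)=0.$$ Assume that $\lim_{n\to\infty}\|v_n-v_\infty\|_\infty=0$. Then $\lim_{n\to\infty}\|\check{\bf S}^n_tv_n-\check{\bf S}^\infty_tv_\infty\|_\infty=0$ locally uniformly in $t\in[0,\infty)$.
   Context: $X$ is a locally compact separable metric space, $m$ a positive Radon measure on the Borel sets of $X$ with full support, $X_\partial=X\cup\{\partial\}$ the one-point compactification; every function $u$ on $X$ is extended by $u(\partial)=0$. $\mathscr B_b(X)$ denotes the bounded Borel functions on $X$ with the sup norm $\|\cdot\|_\infty$, and $C_0(X)$ the continuous functions vanishing at infinity. $\mathbb X=(\Omega,\mathscr M,\mathscr M_t,(\mathbb P_x)_{x\in X_\partial},(\mathbb X_t)_{0\le t\le\infty},(\theta_t),\zeta)$ is a standard process in the sense of Blumenthal–Getoor (not necessarily symmetric) with state space $X$ and cemetery $\partial$ (with $\mathbb X_\infty=\partial$). It is transient and has a dual standard process $\hat{\mathbb X}$ (duality with respect to $m$) with the same properties. Its transition semigroup ${\bf P}_tu(x)=\mathbb E_x[u(\mathbb X_t)]$ has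 a jointly measurable density $p_t(x,y)$ with respect to $m$, with $p_t(x,y)>0$ for all $t>0$, $x,y\in X$. For $\alpha\ge0$, $G_\alpha(x,y)=\int_0^\infty e^{-\alpha t}p_t(x,y)\,dt$, $G:=G_0\not\equiv\infty$, and $G:X\times X\to(0,\infty]$ is lower semicontinuous. For a positive Radon measure $\mu$ on $X$, $G^\mu u(x)=\int_XG(x,y)u(y)\,d\mu(y)$; $\mu$ is $G$-Kato if $G^\mu1\in C_0(X)$, and $\mathscr K(X)$ is the set of $G$-Kato measures. Each $\mu\in\mathscr K(X)$ has a unique (up to equivalence) positive continuous additive functional (PCAF) ${\bf A}$ of $\mathbb X$ with Revuz measure $\mu$; it satisfies $\mathbb E_x[\int_0^\infty e^{-\alpha t}u(\mathbb X_t)\,d{\bf A}_t]=\int_XG_\alpha(x,y)u(y)\,d\mu(y)$ for $u\in\mathscr B_b(X)$, $\alpha\ge0$, $x\in X$. For $n\in\mathbb N\cup\{\infty\}$ let ${\bf A}^n$ be the PCAF of $\mu_n$, $\tau^n_t=\inf\{s\ge0:{\bf A}^n_s>t\}$, and $\check R^n_\alpha u(x)=\mathbb E_x[\int_0^\infty e^{-\alpha t}u(\mathbb X_{\tau^n_t})\,dt]$, which maps $C_0(X)$ into $C_0(X)$. The integrated semigroup $(\check{\bf S}^n_t)_{t\ge0}$ is the strongly continuous family of bounded linear operators on $C_0(X)$ determined by $\check R^n_\alpha=\alpha\int_0^\infty e^{-\alpha t}\check{\bf S}^n_t\,dt$ for all $\alpha>0$. Vague convergence means convergence of integrals of continuous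 functions with compact support. $\check L^n_{\rm rel}=\{(u,w)\in C_0(X)\times C_0(X):\check R^n_\alpha(w+\alpha u)=u\}$ (independent of $\alpha>0$) is a linear relation with $(\check L^n_{\rm rel}+\alpha)^{-1}=\check R^n_\alpha$, and $\check L^n_{\rm rel}-v_n=\{(x_1,x_2-v_n):(x_1,x_2)\in\check L^n_{\rm rel}\}$. A classical solution $u_n$ of the evolution equation is a function $u_n\in C^1((0,\infty),C_0(X))\cap C([0,\infty),C_0(X))$ satisfying it. Existence, uniqueness and the formula $\check{\bf S}^n_tv_n$ for the solution are known results cited by the paper. *)

theory Defs
  imports "HOL-Probability.Probability"
begin

section \<open>Function spaces and measures on the state space\<close>

definition vanishing_at_infinity :: "('a::topological_space \<Rightarrow> real) \<Rightarrow> bool" where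
  "vanishing_at_infinity f \<longleftrightarrow> (\<forall>e>0. \<exists>K. compact K \<and> (\<forall>x. x \<notin> K \<longrightarrow> \<bar>f x\<bar> < e))"

text \<open>The space \<open>C\<^sub>0(X)\<close> as a subset of the Banach space of bounded continuous functions, whose
  norm is the sup norm.\<close>

definition C0 :: "('a::topological_space \<Rightarrow>\<^sub>C real) set" where
  "C0 = {u. vanishing_at_infinity (apply_bcontfun u)}"

text \<open>On a locally compact separable metric space every locally finite Borel measure is regular,
  so local finiteness is all that has to be required of a Radon measure.\<close>

definition radon :: "'a::topological_space measure \<Rightarrow> bool" where
  "radon \<mu> \<longleftrightarrow> sets \<mu> = sets borel \<and> (\<forall>K. compact K \<longrightarrow> emeasure \<mu> K < \<infinity>)"

definition full_support :: "'a::topological_space measure \<Rightarrow> bool" where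
  "full_support \<mu> \<longleftrightarrow> (\<forall>U. open U \<and> U \<noteq> {} \<longrightarrow> emeasure \<mu> U > 0)"

definition vague_limit :: "(nat \<Rightarrow> 'a::topological_space measure) \<Rightarrow> 'a measure \<Rightarrow> bool" where
  "vague_limit M N \<longleftrightarrow>
    (\<forall>f::'a \<Rightarrow> real. continuous_on UNIV f \<and> (\<exists>K. compact K \<and> (\<forall>x. x \<notin> K \<longrightarrow> f x = 0)) \<longrightarrow>
       (\<lambda>n. \<integral>x. f x \<partial>M n) \<longlonglongrightarrow> (\<integral>x. f x \<partial>N))"

definition lower_semicontinuous :: "('a::topological_space \<Rightarrow> ennreal) \<Rightarrow> bool" where
  "lower_semicontinuous f \<longleftrightarrow> (\<forall>c. open {x. c < f x})"


section \<open>Standard processes\<close>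

text \<open>The one-point compactification of the state space; the cemetery is \<^term>\<open>None\<close>. It is an
  isolated point if the state space is compact.\<close>

definition opc :: "'a::topological_space option topology" where
  "opc = Alexandroff_compactification euclidean"

definition borel_opc :: "'a::topological_space option measure" where
  "borel_opc = sigma UNIV {U. openin opc U}"

abbreviation ext0 :: "('a \<Rightarrow> 'b::zero) \<Rightarrow> 'a option \<Rightarrow> 'b" where
  "ext0 u \<equiv> case_option 0 u"

text \<open>The time set \<open>[0,\<infinity>]\<close> is \<^typ>\<open>ennreal\<close>. The fields are \<open>(\<Omega>,\<M>)\<close> (the emeasure part of
  \<open>events\<close> is irrelevant), the \<open>\<sigma>\<close>-algebras \<open>\<M>\<^sub>t\<close>, the probabilities \<open>P\<^sub>x\<close> on \<open>\<M>\<close>, the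
  path coordinates \<open>X\<^sub>t\<close> and the translation operators \<open>\<theta>\<^sub>t\<close>.\<close>

record ('w, 'a) process =
  events :: "'w measure"
  hist :: "ennreal \<Rightarrow> 'w measure"
  law :: "'a option \<Rightarrow> 'w measure"
  pos :: "ennreal \<Rightarrow> 'w \<Rightarrow> 'a option"
  shift :: "ennreal \<Rightarrow> 'w \<Rightarrow> 'w"

definition lifetime :: "('w, 'a) process \<Rightarrow> 'w \<Rightarrow> ennreal" where
  "lifetime Y \<omega> = Inf {t. pos Y t \<omega> = None}"

definition init_laws :: "'a::topological_space option measure set" where
  "init_laws = {\<nu>. prob_space \<nu> \<and> sets \<nu> = sets borel_opc}"

text \<open>\<open>P\<^sub>\<nu>(\<Lambda>) = \<integral> P\<^sub>x(\<Lambda>) d\<nu>(x)\<close>; the integrand is in general only universally measurable.\<close>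

definition init_prob :: "('w, 'a) process \<Rightarrow> 'a option measure \<Rightarrow> 'w set \<Rightarrow> ennreal" where
  "init_prob Y \<nu> \<Lambda> = (\<integral>\<^sup>+x. emeasure (law Y x) \<Lambda> \<partial>completion \<nu>)"

text \<open>Completion of the \<open>\<sigma>\<close>-algebra \<open>\<G>\<close> in \<open>\<N> \<supseteq> \<G>\<close> with respect to the family of all
  \<open>P\<^sub>\<nu>\<close>: the sets that, for every initial law \<open>\<nu>\<close>, differ from a member of \<open>\<G>\<close> by a subset of a
  \<open>P\<^sub>\<nu>\<close>-null set of \<open>\<N>\<close>.\<close>

definition completion_in ::
  "('w, 'a::topological_space) process \<Rightarrow> 'w set set \<Rightarrow> 'w set set \<Rightarrow> 'w set set" where
  "completion_in Y \<N> \<G> = {\<Gamma>. \<Gamma> \<subseteq> space (events Y) \<and>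
     (\<forall>\<nu>\<in>init_laws. \<exists>\<Lambda>\<in>\<G>. \<exists>N\<in>\<N>. sym_diff \<Gamma> \<Lambda> \<subseteq> N \<and> init_prob Y \<nu> N = 0)}"

text \<open>\<open>\<F>\<^sup>0\<^sub>t = \<sigma>(X\<^sub>s; s \<le> t)\<close> and its completion \<open>\<F>\<^sub>t\<close> in \<open>\<F>\<^sup>0 = \<F>\<^sup>0\<^sub>\<infinity>\<close>.\<close>

definition nat_hist0 :: "('w, 'a::topological_space) process \<Rightarrow> ennreal \<Rightarrow> 'w set set" where
  "nat_hist0 Y t = sigma_sets (space (events Y))
     {pos Y s -` B \<inter> space (events Y) | s B. s \<le> t \<and> B \<in> sets borel_opc}"

definition nat_hist :: "('w, 'a::topological_space) process \<Rightarrow> ennreal \<Rightarrow> 'w measure" where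
  "nat_hist Y t =
     sigma (space (events Y)) (completion_in Y (nat_hist0 Y \<infinity>) (nat_hist0 Y t))"

text \<open>Markov processes in the sense of Blumenthal and Getoor, including normality.\<close>

definition markov_process :: "('w, 'a::topological_space) process \<Rightarrow> bool" where
  "markov_process Y \<longleftrightarrow>
    (let \<Omega> = space (events Y) in
     filtration \<Omega> (hist Y) \<and> (\<forall>t. sets (hist Y t) \<subseteq> sets (events Y)) \<and>
     (\<forall>x. prob_space (law Y x) \<and> sets (law Y x) = sets (events Y)) \<and>
     (\<forall>t. pos Y t \<in> hist Y t \<rightarrow>\<^sub>M borel_opc) \<and>
     (\<forall>\<omega>\<in>\<Omega>. pos Y \<infinity> \<omega> = None \<and> (\<forall>s t. s \<le> t \<and> pos Y s \<omega> = None \<longrightarrow> pos Y t \<omega> = None)) \<and>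
     (\<forall>t. shift Y t \<in> \<Omega> \<rightarrow> \<Omega>) \<and>
     (\<exists>\<omega>0\<in>\<Omega>. (\<forall>t. pos Y t \<omega>0 = None) \<and> (\<forall>\<omega>\<in>\<Omega>. shift Y \<infinity> \<omega> = \<omega>0)) \<and>
     (\<forall>\<omega>\<in>\<Omega>. \<forall>s t. pos Y t (shift Y s \<omega>) = pos Y (t + s) \<omega>) \<and>
     (\<forall>t. \<forall>B\<in>sets borel_opc.
        (\<lambda>x. emeasure (law Y x) {\<omega>\<in>\<Omega>. pos Y t \<omega> \<in> B}) \<in> borel_measurable borel_opc) \<and>
     (\<forall>\<Lambda>\<in>sets (events Y). \<forall>\<nu>\<in>init_laws.
        (\<lambda>x. emeasure (law Y x) \<Lambda>) \<in> borel_measurable (completion \<nu>)) \<and>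
     (\<forall>x. AE \<omega> in law Y x. pos Y 0 \<omega> = x) \<and>
     (\<forall>x s t. \<forall>B\<in>sets borel_opc. \<forall>\<Lambda>\<in>sets (hist Y t).
        emeasure (law Y x) {\<omega>\<in>\<Lambda>. pos Y (t + s) \<omega> \<in> B} =
        (\<integral>\<^sup>+\<omega>\<in>\<Lambda>. emeasure (law Y (pos Y t \<omega>)) {\<omega>'\<in>\<Omega>. pos Y s \<omega>' \<in> B} \<partial>law Y x)))"

definition strong_markov :: "('w, 'a::topological_space) process \<Rightarrow> bool" where
  "strong_markov Y \<longleftrightarrow>
    (let \<Omega> = space (events Y) in
     \<forall>T. stopping_time (hist Y) T \<longrightarrow>
       (\<lambda>\<omega>. pos Y (T \<omega>) \<omega>) \<in> filtration.pre_sigma \<Omega> (hist Y) T \<rightarrow>\<^sub>M borel_opc \<and>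
       (\<forall>x s. \<forall>B\<in>sets borel_opc. \<forall>\<Lambda>\<in>sets (filtration.pre_sigma \<Omega> (hist Y) T).
          emeasure (law Y x) {\<omega>\<in>\<Lambda>. pos Y (T \<omega> + s) \<omega> \<in> B} =
          (\<integral>\<^sup>+\<omega>\<in>\<Lambda>. emeasure (law Y (pos Y (T \<omega>) \<omega>)) {\<omega>'\<in>\<Omega>. pos Y s \<omega>' \<in> B} \<partial>law Y x)))"

text \<open>Quasi-left-continuity on \<open>[0,\<zeta>)\<close>.\<close>

definition quasi_left_continuous :: "('w, 'a::topological_space) process \<Rightarrow> bool" where
  "quasi_left_continuous Y \<longleftrightarrow>
    (\<forall>T::nat \<Rightarrow> 'w \<Rightarrow> ennreal.
       (\<forall>n. stopping_time (hist Y) (T n)) \<and> (\<forall>\<omega>\<in>space (events Y). incseq (\<lambda>n. T n \<omega>)) \<longrightarrow>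
       (\<forall>x. AE \<omega> in law Y x. (SUP n. T n \<omega>) < lifetime Y \<omega> \<longrightarrow>
          limitin opc (\<lambda>n. pos Y (T n \<omega>) \<omega>) (pos Y (SUP n. T n \<omega>) \<omega>) sequentially))"

text \<open>\<open>\<M>\<close> and \<open>\<M>\<^sub>t\<close> are complete for the family \<open>P\<^sub>\<nu>\<close> and \<open>\<M>\<^sub>t\<close> is right-continuous. Almost sure
  regularity of the paths means that a single set, null for all \<open>P\<^sub>x\<close>, contains the bad paths.\<close>

definition standard_process :: "('w, 'a::topological_space) process \<Rightarrow> bool" where
  "standard_process Y \<longleftrightarrow>
     markov_process Y \<and>
     sets (events Y) = completion_in Y (sets (events Y)) (sets (events Y)) \<and>
     (\<forall>t. sets (hist Y t) = completion_in Y (sets (events Y)) (sets (hist Y t))) \<and>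
     (\<forall>t<\<infinity>. sets (hist Y t) = (\<Inter>s\<in>{t<..}. sets (hist Y s))) \<and>
     (\<exists>N\<in>sets (events Y). (\<forall>x. emeasure (law Y x) N = 0) \<and>
        (\<forall>\<omega>\<in>space (events Y) - N.
          (\<forall>t<\<infinity>. limitin opc (\<lambda>s. pos Y s \<omega>) (pos Y t \<omega>) (at_right t)) \<and>
          (\<forall>t. 0 < t \<and> t < lifetime Y \<omega> \<longrightarrow> (\<exists>y. limitin opc (\<lambda>s. pos Y s \<omega>) y (at_left t))))) \<and>
     strong_markov Y \<and>
     quasi_left_continuous Y"

text \<open>The transition semigroup \<open>P\<^sub>t\<close> on \<open>[0,\<infinity>]\<close>-valued Borel functions.\<close>

definition semigroup :: "('w, 'a) process \<Rightarrow> real \<Rightarrow> ('a \<Rightarrow> ennreal) \<Rightarrow> 'a \<Rightarrow> ennreal" where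
  "semigroup Y t u x = (\<integral>\<^sup>+\<omega>. ext0 u (pos Y (ennreal t) \<omega>) \<partial>law Y (Some x))"

text \<open>Transience in the sense of Getoor: some strictly positive Borel function has a finite
  potential.\<close>

definition transient :: "('w, 'a::topological_space) process \<Rightarrow> bool" where
  "transient Y \<longleftrightarrow> (\<exists>h::'a \<Rightarrow> ennreal. h \<in> borel_measurable borel \<and> (\<forall>x. h x > 0) \<and>
     (\<forall>x. (\<integral>\<^sup>+\<omega>. (\<integral>\<^sup>+t\<in>{0..}. ext0 h (pos Y (ennreal t) \<omega>) \<partial>lborel) \<partial>law Y (Some x)) < \<infinity>))"

definition in_duality ::
  "'a::topological_space measure \<Rightarrow> ('w, 'a) process \<Rightarrow> ('v, 'a) process \<Rightarrow> bool" where
  "in_duality m Y Z \<longleftrightarrow>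
     (\<forall>t\<ge>0. \<forall>f\<in>borel_measurable borel. \<forall>g\<in>borel_measurable borel.
        (\<integral>\<^sup>+x. f x * semigroup Y t g x \<partial>m) = (\<integral>\<^sup>+x. semigroup Z t f x * g x \<partial>m))"

definition transition_density ::
  "'a::topological_space measure \<Rightarrow> ('w, 'a) process \<Rightarrow> (real \<Rightarrow> 'a \<Rightarrow> 'a \<Rightarrow> ennreal) \<Rightarrow> bool" where
  "transition_density m Y p \<longleftrightarrow>
     (\<lambda>(t, x, y). p t x y) \<in> borel_measurable (restrict_space borel ({0<..} \<times> UNIV)) \<and>
     (\<forall>t>0. \<forall>x. \<forall>u\<in>borel_measurable borel.
        semigroup Y t u x = (\<integral>\<^sup>+y. p t x y * u y \<partial>m))"

definition green :: "(real \<Rightarrow> 'a \<Rightarrow> 'a \<Rightarrow> ennreal) \<Rightarrow> real \<Rightarrow> 'a \<Rightarrow> 'a \<Rightarrow> ennreal" where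
  "green p \<alpha> x y = (\<integral>\<^sup>+t\<in>{0<..}. ennreal (exp (- \<alpha> * t)) * p t x y \<partial>lborel)"

definition potential1 :: "('a \<Rightarrow> 'a \<Rightarrow> ennreal) \<Rightarrow> 'a measure \<Rightarrow> 'a \<Rightarrow> ennreal" where
  "potential1 G \<mu> x = (\<integral>\<^sup>+y. G x y \<partial>\<mu>)"

definition kato :: "('a::topological_space \<Rightarrow> 'a \<Rightarrow> ennreal) \<Rightarrow> 'a measure \<Rightarrow> bool" where
  "kato G \<mu> \<longleftrightarrow> radon \<mu> \<and> (\<forall>x. potential1 G \<mu> x < \<infinity>) \<and>
     continuous_on UNIV (\<lambda>x. enn2real (potential1 G \<mu> x)) \<and>
     vanishing_at_infinity (\<lambda>x. enn2real (potential1 G \<mu> x))"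


section \<open>Positive continuous additive functionals\<close>

text \<open>The functional may become infinite at the lifetime. The defining set has full measure for
  every starting point, i.e. there is no exceptional set. Monotonicity of \<open>t \<mapsto> A\<^sub>t\<close> follows from
  additivity.\<close>

definition pcaf ::
  "('w, 'a::topological_space) process \<Rightarrow> (real \<Rightarrow> 'w \<Rightarrow> ennreal) \<Rightarrow> bool" where
  "pcaf Y A \<longleftrightarrow>
     (\<forall>t\<ge>0. A t \<in> borel_measurable (nat_hist Y (ennreal t))) \<and>
     (\<exists>\<Lambda>\<in>sets (nat_hist Y \<infinity>).
        (\<forall>x. emeasure (law Y (Some x)) \<Lambda> = 1) \<and>
        (\<forall>t<\<infinity>. shift Y t ` \<Lambda> \<subseteq> \<Lambda>) \<and>
        (\<forall>\<omega>\<in>\<Lambda>.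
           A 0 \<omega> = 0 \<and>
           continuous_on {0..} (\<lambda>t. A t \<omega>) \<and>
           (\<forall>t\<ge>0. ennreal t < lifetime Y \<omega> \<longrightarrow> A t \<omega> < \<infinity>) \<and>
           (\<forall>t\<ge>0. lifetime Y \<omega> \<le> ennreal t \<longrightarrow> A t \<omega> = A (enn2real (lifetime Y \<omega>)) \<omega>) \<and>
           (\<forall>s\<ge>0. \<forall>t\<ge>0. A (s + t) \<omega> = A s \<omega> + A t (shift Y (ennreal s) \<omega>))))"

text \<open>The Lebesgue-Stieltjes measure \<open>da\<^sub>t\<close> of a continuous nondecreasing
  \<open>a : [0,\<infinity>) \<rightarrow> [0,\<infinity>]\<close> with \<open>a\<^sub>0 = 0\<close>, carried by \<open>{t. a\<^sub>t < \<infinity>}\<close>: the increasing limit of the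
  Stieltjes measures of the finite functions \<open>min a k\<close>.\<close>

definition stieltjes :: "(real \<Rightarrow> ennreal) \<Rightarrow> real measure" where
  "stieltjes a = measure_of UNIV (sets borel)
     (\<lambda>B. SUP k::nat. emeasure (interval_measure (\<lambda>t. enn2real (min (a (max 0 t)) (of_nat k)))) B)"

definition revuz_measure ::
  "'a::topological_space measure \<Rightarrow> ('w, 'a) process \<Rightarrow> (real \<Rightarrow> 'w \<Rightarrow> ennreal) \<Rightarrow> 'a measure \<Rightarrow> bool"
where
  "revuz_measure m Y A \<mu> \<longleftrightarrow>
     (\<forall>f\<in>borel_measurable borel.
        ((\<lambda>t::real. ennreal (1 / t) *
            (\<integral>\<^sup>+x. (\<integral>\<^sup>+\<omega>. (\<integral>\<^sup>+s\<in>{0..t}. ext0 f (pos Y (ennreal s) \<omega>) \<partial>stieltjes (\<lambda>r. A r \<omega>))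
               \<partial>law Y (Some x)) \<partial>completion m))
          \<longlongrightarrow> (\<integral>\<^sup>+x. f x \<partial>\<mu>)) (at_right 0))"

text \<open>The identity satisfied by the functional with Revuz measure \<open>\<mu>\<close> when \<open>\<mu>\<close> is Kato:
  \<open>E\<^sub>x[\<integral>\<^sub>0\<^sup>\<infinity> e\<^sup>-\<^sup>\<alpha>\<^sup>t u(X\<^sub>t) dA\<^sub>t] = \<integral> G\<^sub>\<alpha>(x,y) u(y) d\<mu>(y)\<close>. For bounded signed \<open>u\<close> and such a
  \<open>\<mu>\<close> it follows by taking differences of bounded nonnegative functions.\<close>

definition potential_formula ::
  "('w, 'a::topological_space) process \<Rightarrow> (real \<Rightarrow> 'a \<Rightarrow> 'a \<Rightarrow> ennreal) \<Rightarrow> (real \<Rightarrow> 'w \<Rightarrow> ennreal) \<Rightarrow>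
    'a measure \<Rightarrow> bool" where
  "potential_formula Y p A \<mu> \<longleftrightarrow>
     (\<forall>\<alpha>\<ge>0. \<forall>x. \<forall>u\<in>borel_measurable borel.
        (\<integral>\<^sup>+\<omega>. (\<integral>\<^sup>+t\<in>{0..}. ennreal (exp (- \<alpha> * t)) * ext0 u (pos Y (ennreal t) \<omega>)
            \<partial>stieltjes (\<lambda>r. A r \<omega>)) \<partial>law Y (Some x)) =
        (\<integral>\<^sup>+y. green p \<alpha> x y * u y \<partial>\<mu>))"

definition right_inverse :: "(real \<Rightarrow> 'w \<Rightarrow> ennreal) \<Rightarrow> real \<Rightarrow> 'w \<Rightarrow> ennreal" where
  "right_inverse A t \<omega> = Inf {ennreal s | s. 0 \<le> s \<and> A s \<omega> > ennreal t}"

definition tc_resolvent ::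
  "('w, 'a) process \<Rightarrow> (real \<Rightarrow> 'w \<Rightarrow> ennreal) \<Rightarrow> real \<Rightarrow> ('a \<Rightarrow> real) \<Rightarrow> 'a \<Rightarrow> real" where
  "tc_resolvent Y A \<alpha> u x =
     (\<integral>\<omega>. (LBINT t:{0..}. exp (- \<alpha> * t) * ext0 u (pos Y (right_inverse A t \<omega>) \<omega>))
        \<partial>law Y (Some x))"


section \<open>Integrated semigroups and the evolution equation\<close>

text \<open>\<open>S\<close> is a strongly continuous family of bounded operators on \<open>C\<^sub>0(X)\<close> with
  \<open>R\<^sub>\<alpha> = \<alpha> \<integral>\<^sub>0\<^sup>\<infinity> e\<^sup>-\<^sup>\<alpha>\<^sup>t S\<^sub>t dt\<close> for all \<open>\<alpha> > 0\<close>. The integral is an improper integral with values in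
  the Banach space of bounded continuous functions. Values of \<open>S\<close> for negative times or outside
  \<open>C\<^sub>0(X)\<close> are irrelevant.\<close>

definition integrated_semigroup ::
  "(real \<Rightarrow> ('a::topological_space \<Rightarrow> real) \<Rightarrow> 'a \<Rightarrow> real) \<Rightarrow>
   (real \<Rightarrow> ('a \<Rightarrow>\<^sub>C real) \<Rightarrow> ('a \<Rightarrow>\<^sub>C real)) \<Rightarrow> bool" where
  "integrated_semigroup R S \<longleftrightarrow>
     (\<forall>t\<ge>0. S t \<in> C0 \<rightarrow> C0 \<and>
        (\<forall>u\<in>C0. \<forall>w\<in>C0. S t (u + w) = S t u + S t w) \<and>
        (\<forall>c. \<forall>u\<in>C0. S t (c *\<^sub>R u) = c *\<^sub>R S t u) \<and>
        (\<exists>K. \<forall>u\<in>C0. norm (S t u) \<le> K * norm u)) \<and>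
     (\<forall>u\<in>C0. continuous_on {0..} (\<lambda>t. S t u)) \<and>
     (\<forall>\<alpha>>0. \<forall>u\<in>C0. \<exists>w. ((\<lambda>t. exp (- \<alpha> * t) *\<^sub>R S t u) has_integral w) {0..} \<and>
        R \<alpha> (apply_bcontfun u) = apply_bcontfun (\<alpha> *\<^sub>R w))"

text \<open>By the resolvent equation the condition does not depend on \<open>\<alpha>\<close>.\<close>

definition lin_rel ::
  "(real \<Rightarrow> ('a::topological_space \<Rightarrow> real) \<Rightarrow> 'a \<Rightarrow> real) \<Rightarrow> (('a \<Rightarrow>\<^sub>C real) \<times> ('a \<Rightarrow>\<^sub>C real)) set"
where
  "lin_rel R = {(u, w). u \<in> C0 \<and> w \<in> C0 \<and>
     (\<forall>\<alpha>>0. R \<alpha> (apply_bcontfun (w + \<alpha> *\<^sub>R u)) = apply_bcontfun u)}"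

definition rel_minus :: "('b \<times> 'b::minus) set \<Rightarrow> 'b \<Rightarrow> ('b \<times> 'b) set" where
  "rel_minus L v = {(x1, x2 - v) | x1 x2. (x1, x2) \<in> L}"

text \<open>\<open>-u'(t) \<in> L u(t) - v\<close> for \<open>t > 0\<close>, \<open>u(0) = 0\<close>, with
  \<open>u \<in> C\<^sup>1((0,\<infinity>),C\<^sub>0(X)) \<inter> C([0,\<infinity>),C\<^sub>0(X))\<close>; values of \<open>u\<close> at negative times are irrelevant.\<close>

definition classical_solution ::
  "(('a::topological_space \<Rightarrow>\<^sub>C real) \<times> ('a \<Rightarrow>\<^sub>C real)) set \<Rightarrow> ('a \<Rightarrow>\<^sub>C real) \<Rightarrow>
   (real \<Rightarrow> ('a \<Rightarrow>\<^sub>C real)) \<Rightarrow> bool" where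
  "classical_solution L v u \<longleftrightarrow>
     (\<forall>t\<ge>0. u t \<in> C0) \<and> continuous_on {0..} u \<and> u 0 = 0 \<and>
     (\<exists>u'. continuous_on {0<..} u' \<and>
        (\<forall>t>0. u' t \<in> C0 \<and> (u has_vector_derivative u' t) (at t) \<and> (u t, - u' t) \<in> rel_minus L v))"

end

theory Submission
  imports Defs
begin

text \<open>
  The time-changed process \<open>X\<^bsub>\<tau>(t)\<^esub>\<close> has a semigroup \<open>T\<^sub>t u(x) = E\<^sub>x[u(X\<^bsub>\<tau>(t)\<^esub>)]\<close> of contractions, with
  \<open>R\<^sub>\<alpha> u = \<integral>\<^sub>0\<^sup>\<infinity> e\<^sup>-\<^sup>\<alpha>\<^sup>t T\<^sub>t u dt\<close> and, by uniqueness of Laplace transforms, \<open>S\<^sub>t u = \<integral>\<^sub>0\<^sup>t T\<^sub>s u ds\<close>. The Markov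
  property at \<open>\<tau>(r)\<close> yields the resolvent equation, so \<open>R\<^sub>\<beta>\<close> tends to the potential operator \<open>G\<^sup>\<mu>\<close> as \<open>\<beta> \<rightarrow> 0\<close>,
  at a rate depending only on a bound for \<open>G\<^sup>\<mu> 1\<close>. The potentials \<open>G\<^bsup>\<mu>(n)\<^esup> u\<close> converge uniformly, because
  \<open>G\<close> is lower semicontinuous and \<open>G\<^bsup>\<mu>(n)\<^esup> 1\<close> converges uniformly. Hence \<open>R\<^sup>n\<^sub>\<beta>\<close> converges strongly up to an error
  of order \<open>\<beta>\<close>, and the resolvent equation transfers this to every \<open>R\<^sup>n\<^sub>\<alpha>\<close> without error. Approximating the
  indicator of \<open>[0,t]\<close> in \<open>L\<^sup>1\<close> by combinations of the functions \<open>e\<^sup>-\<^sup>k\<^sup>s\<close> gives the convergence of \<open>S\<^sup>n\<^sub>t\<close>.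
\<close>


section \<open>Laplace transforms on the half line\<close>

text \<open>Convergence of resolvents is usually passed on to semigroups by a Trotter-Kato argument.
  Here the time-changed semigroup need not be strongly continuous at time 0: the inverse clock may
  start with a jump, so T_0 u can differ from u, and the generator is only a relation. The
  convergence proof therefore works with Laplace transforms, using only that s maps to a measurable
  T_s u bounded by the norm of u. Identifying S_t u with the integral of T_s u also supplies what
  the definition of S does not: Lipschitz continuity in time with a constant independent of n, which
  makes the limit locally uniform in time.

  No continuity of the potential of u is established, so the resolvent equation is used for positive
  parameters only; parameter 0 is approached as a limit with an explicit error.

  On the probabilistic side, the additive functional is measurable for completed histories only, and
  its regularity is almost sure and only for starting points in the state space. Most of the measure
  theory serves to reconcile this with the Markov property at the inverse clock.\<close>

lemma polynomial_approx_unit: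
  fixes k :: "real \<Rightarrow> real"
  assumes "continuous_on {0..1} k" "0 < e"
  obtains a :: "nat \<Rightarrow> real" and n where "\<And>z. z \<in> {0..1} \<Longrightarrow> \<bar>k z - (\<Sum>i\<le>n. a i * z ^ i)\<bar> < e"
proof -
  obtain g where g: "real_polynomial_function g" "\<And>x. x \<in> {0..1} \<Longrightarrow> \<bar>k x - g x\<bar> < e"
    using Stone_Weierstrass_real_polynomial_function[OF compact_Icc assms] by metis
  obtain a n where "g = (\<lambda>x. \<Sum>i\<le>n. a i * x ^ i)"
    using g(1) by (auto simp: real_polynomial_function_iff_sum)
  with g(2) that show thesis by blast
qed

text \<open>A gauge integral over an unbounded set is controlled on all boxes containing a large
  ball. The box from \<open>-N\<close> to \<open>N\<close> meets the half line in
  \<open>{0..N}\<close>, which turns the integral into an improper one.\<close>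

lemma has_integral_half_line_tendsto:
  fixes f :: "real \<Rightarrow> 'b::banach"
  assumes "(f has_integral y) {0..}"
  shows "((\<lambda>N. integral {0..N} f) \<longlongrightarrow> y) at_top"
proof (rule tendstoI)
  fix e :: real assume "0 < e"
  have "\<exists>B>0. \<forall>a b. ball 0 B \<subseteq> cbox a b \<longrightarrow>
       (\<exists>z. ((\<lambda>x. if x \<in> {0..} then f x else 0) has_integral z) (cbox a b) \<and> norm (z - y) < e)"
    by (rule has_integral'[THEN iffD1, OF assms, rule_format, OF \<open>0 < e\<close>])
  then obtain B where B: "B > 0" "\<forall>a b. ball 0 B \<subseteq> cbox a b \<longrightarrow>
       (\<exists>z. ((\<lambda>x. if x \<in> {0..} then f x else 0) has_integral z) (cbox a b) \<and> norm (z - y) < e)"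
    by (elim exE conjE)
  show "\<forall>\<^sub>F N in at_top. dist (integral {0..N} f) y < e"
  proof (rule eventually_mono[OF eventually_ge_at_top[of B]])
    fix N assume N: "B \<le> N"
    have "ball 0 B \<subseteq> cbox (-N) N" using N by (auto simp: dist_real_def)
    then obtain z where z: "((\<lambda>x. if x \<in> {0..} then f x else 0) has_integral z) (cbox (-N) N)" "norm (z - y) < e"
      using B(2) by blast
    have "{0..N} \<subseteq> cbox (-N) N" "{0..} \<inter> cbox (-N) N = {0..N}" using N B(1) by auto
    then have "(f has_integral z) {0..N}"
      using z(1) has_integral_restrict_Int[of "{0..}" f z "cbox (-N) N"] by metis
    then show "dist (integral {0..N} f) y < e"
      using z(2) by (simp add: integral_unique dist_norm)
  qed
qed

text \<open>Riemann sums of \<open>f\<close> stay in the subspace, and closedness passes this to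
  their limit. Applied to \<open>C0\<close>, it places the Banach-valued Laplace integral of
  \<open>S t u\<close>, hence the resolvent, in \<open>C0\<close>.\<close>

lemma has_integral_in_closed_subspace:
  fixes f :: "real \<Rightarrow> 'b::banach"
  assumes V: "subspace V" "closed V" and f: "(f has_integral y) S" and fV: "\<And>x. x \<in> S \<Longrightarrow> f x \<in> V"
  shows "y \<in> V"
proof -
  have *: "z \<in> V" if z: "(g has_integral z) (cbox a b)" and gV: "\<And>x. g x \<in> V" for g z and a b :: real
  proof -
    have "\<exists>w\<in>V. dist w z < e" if e: "e > 0" for e :: real
    proof -
      have "\<exists>\<gamma>. gauge \<gamma> \<and> (\<forall>\<D>. \<D> tagged_division_of (cbox a b) \<and> \<gamma> fine \<D> \<longrightarrow>
          norm ((\<Sum>(x,k)\<in>\<D>. measure lborel k *\<^sub>R g x) - z) < e)"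
        by (rule has_integral[THEN iffD1, OF z, rule_format, OF e])
      then obtain \<gamma> where \<gamma>: "gauge \<gamma>" "\<forall>\<D>. \<D> tagged_division_of (cbox a b) \<and> \<gamma> fine \<D> \<longrightarrow>
          norm ((\<Sum>(x,k)\<in>\<D>. measure lborel k *\<^sub>R g x) - z) < e"
        by (elim exE conjE)
      obtain p where "p tagged_division_of (cbox a b)" "\<gamma> fine p"
        by (rule fine_division_exists[OF \<gamma>(1)])
      moreover have "(\<Sum>(x,k)\<in>p. measure lborel k *\<^sub>R g x) \<in> V"
        by (intro subspace_sum[OF V(1)]) (auto intro!: subspace_scale[OF V(1)] gV)
      ultimately show ?thesis using \<gamma>(2) by (auto simp: dist_norm)
    qed
    then show ?thesis using closed_approachable[OF V(2)] by blast
  qed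
  have "\<exists>w\<in>V. dist w y < e" if e: "e > 0" for e :: real
  proof -
    have "\<exists>B>0. \<forall>a b. ball 0 B \<subseteq> cbox a b \<longrightarrow>
       (\<exists>z. ((\<lambda>x. if x \<in> S then f x else 0) has_integral z) (cbox a b) \<and> norm (z - y) < e)"
      by (rule has_integral'[THEN iffD1, OF f, rule_format, OF e])
    then obtain B where B: "\<forall>a b. ball 0 B \<subseteq> cbox a b \<longrightarrow>
       (\<exists>z. ((\<lambda>x. if x \<in> S then f x else 0) has_integral z) (cbox a b) \<and> norm (z - y) < e)"
      by (elim exE conjE)
    have "ball 0 B \<subseteq> cbox (-\<bar>B\<bar>) \<bar>B\<bar>" by (auto simp: dist_real_def)
    from B[rule_format, OF this] obtain z where z: "((\<lambda>x. if x \<in> S then f x else 0) has_integral z) (cbox (-\<bar>B\<bar>) \<bar>B\<bar>)" "norm (z - y) < e"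
      by blast
    have "z \<in> V" by (rule *[OF z(1)]) (use fV subspace_0[OF V(1)] in auto)
    then show ?thesis using z(2) by (auto simp: dist_norm)
  qed
  then show ?thesis using closed_approachable[OF V(2)] by blast
qed

lemma has_vector_derivative_integral_half_line:
  fixes f :: "real \<Rightarrow> 'b::banach"
  assumes "continuous_on {0..} f" "0 < t"
  shows "((\<lambda>t. integral {0..t} f) has_vector_derivative f t) (at t)"
proof -
  have "((\<lambda>t. integral {0..t} f) has_vector_derivative f t) (at t within {0..t+1})"
    by (rule integral_has_vector_derivative) (use assms in \<open>auto intro: continuous_on_subset\<close>)
  moreover have "at t within {0..t+1} = at t"
    using assms(2) by (intro at_within_Icc_at) auto
  ultimately show ?thesis by simp
qed

lemma continuous_on_integral_half_line:
  fixes f :: "real \<Rightarrow> 'b::banach"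
  assumes "continuous_on {0..} f"
  shows "continuous_on {0..} (\<lambda>t. integral {0..t} f)"
proof (unfold continuous_on_eq_continuous_within, rule ballI)
  fix t :: real assume t: "t \<in> {0..}"
  have "continuous_on {0..t+1} (\<lambda>t. integral {0..t} f)"
    by (rule indefinite_integral_continuous_1[OF integrable_continuous_interval])
      (rule continuous_on_subset[OF assms], auto)
  then have "continuous (at t within {0..t+1}) (\<lambda>t. integral {0..t} f)"
    using t by (auto simp: continuous_on_eq_continuous_within)
  moreover have "at t within {0..} = at t within {0..t+1}"
    by (rule at_within_nhd[of _ "{..<t+1}"]) auto
  ultimately show "continuous (at t within {0..}) (\<lambda>t. integral {0..t} f)" by simp
qed

text \<open>Differentiating the primitives recovers the integrands at positive times; the value at 0
  follows by continuity.\<close>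

lemma integral_half_line_inj:
  fixes f g :: "real \<Rightarrow> 'b::banach"
  assumes f: "continuous_on {0..} f" and g: "continuous_on {0..} g"
    and eq: "\<And>t. 0 < t \<Longrightarrow> integral {0..t} f = integral {0..t} g" and t: "0 \<le> t"
  shows "f t = g t"
proof -
  have pos: "f t = g t" if "0 < t" for t
  proof (rule vector_derivative_unique_at)
    show "((\<lambda>t. integral {0..t} f) has_vector_derivative f t) (at t)"
      by (rule has_vector_derivative_integral_half_line[OF f that])
    have "\<forall>\<^sub>F s in nhds t. integral {0..s} g = integral {0..s} f"
      by (rule eventually_mono[OF eventually_nhds_in_open[of "{0<..}" t]]) (use eq that in auto)
    then show "((\<lambda>t. integral {0..t} f) has_vector_derivative g t) (at t)"
      using has_vector_derivative_integral_half_line[OF g that] eq[OF that]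
      by (subst (asm) has_vector_derivative_cong_ev[where g="\<lambda>t. integral {0..t} f" and S=UNIV])
         (auto elim: eventually_mono)
  qed
  have "continuous_on (closure {0<..}) (\<lambda>t. f t - g t)"
    using f g by (simp add: continuous_on_diff)
  then have "f t - g t = 0"
    by (rule continuous_constant_on_closure) (use pos t in auto)
  then show ?thesis by simp
qed


lemma integral_exp_mult_primitive_parts:
  fixes f :: "real \<Rightarrow> real"
  assumes f: "continuous_on {0..} f" and N: "0 \<le> N" and k: "k \<noteq> 0"
  shows "integral {0..N} (\<lambda>t. exp (- k * t) * integral {0..t} f)
    = (integral {0..N} (\<lambda>t. exp (- k * t) * f t) - exp (- k * N) * integral {0..N} f) / k"
proof -
  define F where "F = (\<lambda>t. integral {0..t} f)"
  have cF: "continuous_on {0..N} F"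
    unfolding F_def by (rule continuous_on_subset[OF continuous_on_integral_half_line[OF f]]) auto
  have F': "(F has_real_derivative f t) (at t)" if "0 < t" for t
    unfolding F_def has_real_derivative_iff_has_vector_derivative
    by (rule has_vector_derivative_integral_half_line[OF f that])
  have "((\<lambda>t. - k * (exp (- k * t) * F t) + exp (- k * t) * f t) has_integral
      (exp (- k * N) * F N - exp (- k * 0) * F 0)) {0..N}"
  proof (rule fundamental_theorem_of_calculus_interior[OF N])
    show "continuous_on {0..N} (\<lambda>t. exp (- k * t) * F t)" by (intro continuous_intros cF)
    fix t assume "t \<in> {0<..<N}"
    then have "0 < t" by simp
    have "((\<lambda>t. exp (- k * t)) has_real_derivative - k * exp (- k * t)) (at t)"
      by (auto intro!: derivative_eq_intros)
    from DERIV_mult[OF this F'[OF \<open>0 < t\<close>]]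
    show "((\<lambda>t. exp (- k * t) * F t) has_vector_derivative - k * (exp (- k * t) * F t) + exp (- k * t) * f t) (at t)"
      unfolding has_real_derivative_iff_has_vector_derivative[symmetric] by (simp add: mult_ac)
  qed
  moreover have "((\<lambda>t. - k * (exp (- k * t) * F t)) has_integral - k * integral {0..N} (\<lambda>t. exp (- k * t) * F t)) {0..N}"
    by (intro has_integral_mult_right integrable_integral integrable_continuous_interval continuous_intros cF)
  ultimately have "((\<lambda>t. exp (- k * t) * f t) has_integral
      (exp (- k * N) * F N - F 0 + k * integral {0..N} (\<lambda>t. exp (- k * t) * F t))) {0..N}"
    by (auto dest: has_integral_diff)
  then have "integral {0..N} (\<lambda>t. exp (- k * t) * f t) = exp (- k * N) * F N + k * integral {0..N} (\<lambda>t. exp (- k * t) * F t)"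
    by (simp add: F_def integral_unique)
  then show ?thesis using k by (simp add: F_def)
qed

text \<open>Lerch's uniqueness theorem: integrating by parts replaces \<open>d\<close> by the bounded function
  \<open>D t = \<integral>\<^sub>0\<^sup>t e\<^sup>-\<^sup>s d s ds\<close>, which vanishes at infinity; as a continuous function of \<open>e\<^sup>-\<^sup>t\<close> it is a uniform
  limit of polynomials in \<open>e\<^sup>-\<^sup>t\<close>.\<close>

lemma laplace_transform_zero:
  fixes d :: "real \<Rightarrow> real"
  assumes d: "continuous_on {0..} d"
    and L: "\<And>k::nat. 0 < k \<Longrightarrow> ((\<lambda>N. integral {0..N} (\<lambda>t. exp (- real k * t) * d t)) \<longlongrightarrow> 0) at_top"
    and t: "0 \<le> t"
  shows "d t = 0"
proof -
  define f where "f = (\<lambda>s. exp (- s) * d s)"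
  define D where "D = (\<lambda>t. integral {0..t} f)"
  have f: "continuous_on {0..} f"
    unfolding f_def by (intro continuous_intros d)
  have D: "continuous_on {0..} D"
    unfolding D_def by (rule continuous_on_integral_half_line[OF f])
  have D0: "(D \<longlongrightarrow> 0) at_top"
    using L[of 1] by (simp add: D_def f_def)
  have cD: "continuous_on {0..N} D" for N
    by (rule continuous_on_subset[OF D]) auto
  \<comment> \<open>The weight \<open>exp (- s)\<close> inside \<open>f\<close> raises the exponent
    by one, so moment \<open>m\<close> of \<open>D\<close> comes from the hypothesis at
    \<open>Suc m\<close>. The boundary term disappears because \<open>D\<close> tends to 0.\<close>
  have mom: "((\<lambda>N. integral {0..N} (\<lambda>t. exp (- real m * t) * D t)) \<longlongrightarrow> 0) at_top" if m: "0 < m" for m :: nat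
  proof -
    have shift: "(\<lambda>t. exp (- real (Suc m) * t) * d t) = (\<lambda>t. exp (- real m * t) * f t)"
    proof (rule ext)
      fix t
      have "exp (- real (Suc m) * t) = exp (- real m * t) * exp (- t)"
        by (simp add: exp_add[symmetric] algebra_simps)
      then show "exp (- real (Suc m) * t) * d t = exp (- real m * t) * f t" by (simp add: f_def)
    qed
    have "((\<lambda>N. (integral {0..N} (\<lambda>t. exp (- real (Suc m) * t) * d t) - exp (- real m * N) * D N) / real m) \<longlongrightarrow> (0 - 0) / real m) at_top"
    proof (intro tendsto_intros L)
      have "((\<lambda>N. exp (- real m * N)) \<longlongrightarrow> 0) at_top"
        by (intro filterlim_compose[OF exp_at_bot] filterlim_tendsto_neg_mult_at_bot[of _ "- real m"] filterlim_ident tendsto_const)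
          (use m in auto)
      from tendsto_mult[OF this D0] show "((\<lambda>N. exp (- real m * N) * D N) \<longlongrightarrow> 0) at_top" by simp
    qed (use m in auto)
    moreover have "\<forall>\<^sub>F N in at_top. (integral {0..N} (\<lambda>t. exp (- real (Suc m) * t) * d t) - exp (- real m * N) * D N) / real m
        = integral {0..N} (\<lambda>t. exp (- real m * t) * D t)"
      using eventually_ge_at_top[of 0]
    proof eventually_elim
      case (elim N)
      show ?case unfolding shift D_def
        by (rule integral_exp_mult_primitive_parts[OF f elim, symmetric]) (use m in simp)
    qed
    ultimately show ?thesis by (simp add: tendsto_cong)
  qed
  define k where "k = (\<lambda>z. if z = 0 then 0 else D (- ln z))"
  have k_exp: "k (exp (- t)) = D t" for t by (simp add: k_def)
  have k: "continuous_on {0..1} k"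
  proof (unfold continuous_on_eq_continuous_within, rule ballI)
    fix z :: real assume z: "z \<in> {0..1}"
    show "continuous (at z within {0..1}) k"
    proof (cases "z = 0")
      case True
      have "((\<lambda>z. D (- ln z)) \<longlongrightarrow> 0) (at_right 0)"
        by (rule filterlim_compose[OF D0])
          (use ln_at_0 in \<open>simp add: filterlim_uminus_at_top\<close>)
      then have "(k \<longlongrightarrow> 0) (at_right 0)"
        by (rule Lim_transform_eventually) (auto simp: k_def eventually_at_filter)
      then have "(k \<longlongrightarrow> k 0) (at 0 within {0..1})"
        by (simp add: k_def at_within_Icc_at_right)
      then show ?thesis by (simp add: True continuous_within)
    next
      case False
      have "continuous_on {0<..1} (\<lambda>z. D (- ln z))"
        by (intro continuous_intros continuous_on_compose2[OF D]) auto
      then have "continuous_on {0<..1} k"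
        by (subst continuous_on_cong[OF refl, of _ _ "\<lambda>z. D (- ln z)"]) (auto simp: k_def)
      then have "continuous (at z within {0<..1}) k"
        using z False by (auto simp: continuous_on_eq_continuous_within)
      moreover have "at z within {0<..1} = at z within {0..1}"
        by (rule at_within_nhd[of _ "{0<..}"]) (use z False in auto)
      ultimately show ?thesis by simp
    qed
  qed
  obtain M where M: "\<And>t. 0 \<le> t \<Longrightarrow> \<bar>D t\<bar> \<le> M"
  proof -
    have "bounded (k ` {0..1})" by (intro compact_imp_bounded compact_continuous_image k) simp
    then obtain M where M: "\<forall>z\<in>{0..1}. \<bar>k z\<bar> \<le> M" unfolding bounded_iff by auto
    have "\<bar>D t\<bar> \<le> M" if "0 \<le> t" for t
      using M[rule_format, of "exp (- t)"] that by (simp add: k_exp)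
    then show thesis by (rule that)
  qed
  have M0: "0 \<le> M" using M[of 0] by simp
  \<comment> \<open>In the limit, \<open>D\<close> is orthogonal to every polynomial in
    \<open>exp (- t)\<close> for the weight \<open>exp (- t)\<close>. Writing the square of
    \<open>D\<close> as \<open>D * Q + D * (D - Q)\<close> with such a polynomial \<open>Q\<close>
    leaves an error of at most \<open>M * e'\<close>, and \<open>e'\<close> is chosen so that this
    is at most \<open>e / 2\<close>.\<close>
  have small: "integral {0..N} (\<lambda>t. exp (- t) * (D t)\<^sup>2) \<le> 0" if N: "0 \<le> N" for N
  proof (rule field_le_epsilon)
    fix e :: real assume e: "0 < e"
    define e' where "e' = e / (2 * (M + 1))"
    have e': "0 < e'" using e M0 by (simp add: e'_def)
    obtain a n where a: "\<And>z. z \<in> {0..1} \<Longrightarrow> \<bar>k z - (\<Sum>i\<le>n. a i * z ^ i)\<bar> < e'"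
      using polynomial_approx_unit[OF k e'] by metis
    define Q where "Q = (\<lambda>t. \<Sum>i\<le>n. a i * exp (- t) ^ i)"
    have Q: "\<bar>D t - Q t\<bar> \<le> e'" if "0 \<le> t" for t
      using a[of "exp (- t)"] that by (simp add: k_exp Q_def)
    have cQ: "continuous_on S Q" for S unfolding Q_def by (intro continuous_intros)
    have "((\<lambda>N. \<Sum>i\<le>n. a i * integral {0..N} (\<lambda>t. exp (- real (Suc i) * t) * D t)) \<longlongrightarrow> (\<Sum>i\<le>n. a i * 0)) at_top"
      by (intro tendsto_intros mom) simp
    moreover have "(\<Sum>i\<le>n. a i * integral {0..N} (\<lambda>t. exp (- real (Suc i) * t) * D t))
        = integral {0..N} (\<lambda>t. exp (- t) * D t * Q t)" for N
    proof -
      have "integral {0..N} (\<lambda>t. \<Sum>i\<le>n. a i * (exp (- real (Suc i) * t) * D t))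
        = (\<Sum>i\<le>n. integral {0..N} (\<lambda>t. a i * (exp (- real (Suc i) * t) * D t)))"
        by (rule integral_sum) (auto intro!: integrable_continuous_interval continuous_intros cD)
      moreover have "(\<lambda>t. \<Sum>i\<le>n. a i * (exp (- real (Suc i) * t) * D t)) = (\<lambda>t. exp (- t) * D t * Q t)"
      proof (rule ext)
        fix t
        have "exp (- real (Suc i) * t) = exp (- t) * exp (- t) ^ i" for i
          by (simp add: exp_add[symmetric] exp_of_nat_mult[symmetric] algebra_simps)
        then show "(\<Sum>i\<le>n. a i * (exp (- real (Suc i) * t) * D t)) = exp (- t) * D t * Q t"
          by (simp add: Q_def sum_distrib_left mult_ac)
      qed
      ultimately show ?thesis by simp
    qed
    ultimately have "((\<lambda>N. integral {0..N} (\<lambda>t. exp (- t) * D t * Q t)) \<longlongrightarrow> 0) at_top" by simp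
    then have "\<forall>\<^sub>F N in at_top. integral {0..N} (\<lambda>t. exp (- t) * D t * Q t) < e / 2"
      by (rule order_tendstoD) (use e in simp)
    \<comment> \<open>Orthogonality holds only as the upper limit of integration tends to infinity.
      Enlarging \<open>N\<close> to \<open>N'\<close> is harmless because the integrand with the
      square is nonnegative.\<close>
    then obtain N' where N': "N \<le> N'" "integral {0..N'} (\<lambda>t. exp (- t) * D t * Q t) < e / 2"
      using eventually_happens'[OF trivial_limit_at_top_linorder eventually_conj[OF eventually_ge_at_top[of N]]] by blast
    have "integral {0..N} (\<lambda>t. exp (- t) * (D t)\<^sup>2) \<le> integral {0..N'} (\<lambda>t. exp (- t) * (D t)\<^sup>2)"
      by (rule integral_subset_le) (use N' in \<open>auto intro!: integrable_continuous_interval continuous_intros cD\<close>)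
    also have "\<dots> \<le> integral {0..N'} (\<lambda>t. exp (- t) * D t * Q t + M * e' * exp (- t))"
    proof (rule integral_le)
      fix t assume "t \<in> {0..N'}"
      then have t: "0 \<le> t" by simp
      have "D t * (D t - Q t) \<le> \<bar>D t\<bar> * \<bar>D t - Q t\<bar>" by (metis abs_ge_self abs_mult)
      also have "\<dots> \<le> M * e'" by (intro mult_mono M Q t) (use M0 in auto)
      finally have "exp (- t) * (D t * (D t - Q t)) \<le> exp (- t) * (M * e')" by simp
      then show "exp (- t) * (D t)\<^sup>2 \<le> exp (- t) * D t * Q t + M * e' * exp (- t)"
        by (simp add: algebra_simps power2_eq_square)
    qed (auto intro!: integrable_continuous_interval continuous_intros cD cQ)
    also have "\<dots> = integral {0..N'} (\<lambda>t. exp (- t) * D t * Q t) + M * e' * integral {0..N'} (\<lambda>t. exp (- t))"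
      by (subst integral_add) (auto intro!: integrable_continuous_interval continuous_intros cD cQ)
    also have "integral {0..N'} (\<lambda>t. exp (- t)) = 1 - exp (- N')"
    proof (rule integral_unique)
      have "((\<lambda>t. exp (- t)) has_integral ((- exp (- N')) - (- exp (- 0)))) {0..N'}"
        by (rule fundamental_theorem_of_calculus) (use N N' in \<open>auto intro!: derivative_eq_intros
           simp: has_real_derivative_iff_has_vector_derivative[symmetric]\<close>)
      then show "((\<lambda>t. exp (- t)) has_integral 1 - exp (- N')) {0..N'}" by simp
    qed
    also have "M * e' * (1 - exp (- N')) \<le> M * e' * 1"
      using M0 e' by (intro mult_left_mono) auto
    also have "M * e' * 1 \<le> e / 2"
      using e M0 by (simp add: e'_def divide_simps)
    finally show "integral {0..N} (\<lambda>t. exp (- t) * (D t)\<^sup>2) \<le> 0 + e" using N'(2) by linarith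
  qed
  have D_zero: "D t = 0" if t: "0 \<le> t" for t
  proof -
    have c: "continuous_on {0..} (\<lambda>t. exp (- t) * (D t)\<^sup>2)" by (intro continuous_intros D)
    have "integral {0..N} (\<lambda>t. exp (- t) * (D t)\<^sup>2) = 0" if "0 < N" for N
      by (rule antisym[OF small integral_nonneg])
        (use that in \<open>auto intro!: integrable_continuous_interval continuous_intros cD\<close>)
    then have "exp (- t) * (D t)\<^sup>2 = 0"
      using integral_half_line_inj[OF c continuous_on_const _ t, of 0] by simp
    then show ?thesis by simp
  qed
  show ?thesis
  proof -
    have "f t = (0::real)"
      using integral_half_line_inj[OF f continuous_on_const _ t, of 0] D_zero by (simp add: D_def)
    then show ?thesis by (simp add: f_def)
  qed
qed

text \<open>The trapezoid \<open>g\<close>, equal to 1 up to time \<open>t\<close> and falling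
  linearly to 0 at \<open>t + e\<close>, differs from the indicator only on
  \<open>{t..t + e}\<close>. In the variable \<open>z = exp (- s)\<close> the quotient of
  \<open>g\<close> by \<open>z\<close> is continuous on the unit interval; multiplying a polynomial
  approximation of it by \<open>z\<close> gives exponentials with positive rates only, with an error
  that carries the integrable weight \<open>exp (- s)\<close>.\<close>

lemma indicator_exp_approx:
  fixes t e :: real
  assumes t: "0 \<le> t" and e: "0 < e"
  obtains a :: "nat \<Rightarrow> real" and m where
    "\<And>s. 0 \<le> s \<Longrightarrow> \<bar>indicator {0..t} s - (\<Sum>i\<le>m. a i * exp (- real (Suc i) * s))\<bar> \<le> indicator {t..t + e} s + e * exp (- s)"
proof -
  define g where "g s = max 0 (min 1 (1 + (t - s) / e))" for s
  define z0 where "z0 = exp (- (t + e))"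
  \<comment> \<open>For \<open>z\<close> at most \<open>z0\<close> the numerator vanishes, since
    \<open>g\<close> is 0 from time \<open>t + e\<close> on. The clamp thus changes no value for
    positive \<open>z\<close>, but it removes the singularity of the logarithm and of the quotient
    at 0.\<close>
  define k where "k z = g (- ln (max z z0)) / max z z0" for z
  have z0: "0 < z0" by (simp add: z0_def)
  have mz: "max z z0 \<noteq> 0" "0 < max z z0" for z using z0 by (auto simp: max_def)
  have "continuous_on {0..1} k"
    unfolding k_def[abs_def] g_def by (intro continuous_intros) (use mz e in auto)
  from polynomial_approx_unit[OF this e] obtain a n where
    a: "\<And>z. z \<in> {0..1} \<Longrightarrow> \<bar>k z - (\<Sum>i\<le>n. a i * z ^ i)\<bar> < e" by metis
  have g_out: "g s = 0" if "t + e \<le> s" for s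
  proof -
    have "1 + (t - s) / e \<le> 0" using that e by (simp add: field_simps)
    then show ?thesis by (simp add: g_def)
  qed
  have k_exp: "exp (- s) * k (exp (- s)) = g s" for s
  proof (cases "s \<le> t + e")
    case True
    then have "max (exp (- s)) z0 = exp (- s)" by (simp add: z0_def)
    then show ?thesis by (simp add: k_def)
  next
    case False
    then have "max (exp (- s)) z0 = z0" by (simp add: z0_def)
    then show ?thesis using False g_out[of s] g_out[of "t + e"] by (simp add: k_def z0_def add.commute)
  qed
  show thesis
  proof (rule that[of a n])
    fix s :: real assume s: "0 \<le> s"
    define Q where "Q = (\<Sum>i\<le>n. a i * exp (- s) ^ i)"
    have 1: "(\<Sum>i\<le>n. a i * exp (- real (Suc i) * s)) = exp (- s) * Q"
    proof -
      have "exp (- real (Suc i) * s) = exp (- s) * exp (- s) ^ i" for i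
        by (simp add: exp_add[symmetric] exp_of_nat_mult[symmetric] algebra_simps)
      then show ?thesis by (simp add: Q_def sum_distrib_left mult_ac)
    qed
    have "\<bar>k (exp (- s)) - Q\<bar> \<le> e" using a[of "exp (- s)"] s by (simp add: Q_def)
    then have "exp (- s) * \<bar>k (exp (- s)) - Q\<bar> \<le> e * exp (- s)" by simp
    moreover have "exp (- s) * \<bar>k (exp (- s)) - Q\<bar> = \<bar>exp (- s) * k (exp (- s)) - exp (- s) * Q\<bar>"
      by (simp add: abs_mult right_diff_distrib[symmetric])
    ultimately have 2: "\<bar>g s - exp (- s) * Q\<bar> \<le> e * exp (- s)" by (simp only: k_exp)
    have 3: "\<bar>indicator {0..t} s - g s\<bar> \<le> indicator {t..t + e} s"
    proof -
      consider "s < t" | "t \<le> s" "s \<le> t + e" | "t + e < s" by linarith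
      then show ?thesis
      proof cases
        case 1
        then have "g s = 1" using e by (simp add: g_def)
        then show ?thesis using 1 s by simp
      next
        case 2
        have "0 \<le> g s" "g s \<le> 1" by (auto simp: g_def)
        then show ?thesis using 2 by (auto simp: indicator_def)
      next
        case 3
        then show ?thesis using g_out[of s] e by simp
      qed
    qed
    show "\<bar>indicator {0..t} s - (\<Sum>i\<le>n. a i * exp (- real (Suc i) * s))\<bar> \<le> indicator {t..t + e} s + e * exp (- s)"
      unfolding 1 using 2 3 by linarith
  qed
qed

section \<open>Fubini computations with exponential weights\<close>

lemma fixes a c :: real assumes a: "0 < a"
  shows nn_integral_exp_half_line: "(\<integral>\<^sup>+t. ennreal (indicator {c..} t * exp (- a * t)) \<partial>lborel) = ennreal (exp (- a * c) / a)"
    and integrable_exp_half_line: "integrable lborel (\<lambda>t. indicator {c..} t * exp (- a * t))"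
    and integral_exp_half_line: "(\<integral>t. indicator {c..} t * exp (- a * t) \<partial>lborel) = exp (- a * c) / a"
proof -
  have "(\<integral>\<^sup>+t. ennreal (exp (- a * t)) * indicator {c..} t \<partial>lborel) = ennreal (0 - (- exp (- a * c) / a))"
  proof (rule nn_integral_FTC_atLeast)
    have "((\<lambda>t. exp (- a * t)) \<longlongrightarrow> 0) at_top"
      by (intro filterlim_compose[OF exp_at_bot] filterlim_tendsto_neg_mult_at_bot[of _ "- a"] filterlim_ident tendsto_const)
        (use a in auto)
    from tendsto_divide[OF tendsto_minus[OF this] tendsto_const[of a]]
    show "((\<lambda>t. - exp (- a * t) / a) \<longlongrightarrow> 0) at_top" using a by simp
  qed (use a in \<open>auto intro!: derivative_eq_intros\<close>)
  moreover have "(\<lambda>t. ennreal (exp (- a * t)) * indicator {c..} t) = (\<lambda>t. ennreal (indicator {c..} t * exp (- a * t)))"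
    by (auto simp: indicator_def)
  ultimately show 1: "(\<integral>\<^sup>+t. ennreal (indicator {c..} t * exp (- a * t)) \<partial>lborel) = ennreal (exp (- a * c) / a)" by simp
  have "has_bochner_integral lborel (\<lambda>t. indicator {c..} t * exp (- a * t)) (exp (- a * c) / a)"
    by (rule has_bochner_integral_nn_integral[OF _ _ _ 1]) (use a in auto)
  then show "integrable lborel (\<lambda>t. indicator {c..} t * exp (- a * t))"
    "(\<integral>t. indicator {c..} t * exp (- a * t) \<partial>lborel) = exp (- a * c) / a"
    by (auto simp: has_bochner_integral_iff)
qed

lemma lborel_integral_swap:
  fixes k :: "real \<Rightarrow> real \<Rightarrow> real"
  assumes [measurable]: "(\<lambda>(r, s). k r s) \<in> borel_measurable (lborel \<Otimes>\<^sub>M lborel)"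
    and fin: "(\<integral>\<^sup>+r. \<integral>\<^sup>+s. ennreal \<bar>k r s\<bar> \<partial>lborel \<partial>lborel) < \<infinity>"
  shows "(\<integral>r. \<integral>s. k r s \<partial>lborel \<partial>lborel) = (\<integral>s. \<integral>r. k r s \<partial>lborel \<partial>lborel)"
proof -
  have "integrable (lborel \<Otimes>\<^sub>M lborel) (\<lambda>(r, s). k r s)"
  proof (rule integrableI_bounded)
    show "(\<integral>\<^sup>+x. ennreal (norm (case x of (r, s) \<Rightarrow> k r s)) \<partial>(lborel \<Otimes>\<^sub>M lborel)) < \<infinity>"
      using fin by (simp add: lborel.nn_integral_fst[symmetric] split_beta')
  qed simp
  from lborel_pair.Fubini_integral[OF this] show ?thesis by simp
qed

text \<open>After exchanging the integrals, the weight of \<open>f s\<close> is the integral of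
  \<open>exp (- a * t)\<close> over t from s to infinity, which is \<open>exp (- a * s) / a\<close>.
  In contrast to the integration by parts above, \<open>f\<close> is only assumed
  measurable.\<close>

lemma integral_exp_mult_primitive:
  fixes f :: "real \<Rightarrow> real"
  assumes a: "0 < a" and [measurable]: "f \<in> borel_measurable borel"
    and int: "integrable lborel (\<lambda>s. indicator {0..} s * (exp (- a * s) * f s))"
  shows "(\<integral>t. indicator {0..} t * (exp (- a * t) * (\<integral>s. indicator {0..t} s * f s \<partial>lborel)) \<partial>lborel)
    = (\<integral>s. indicator {0..} s * (exp (- a * s) * f s) \<partial>lborel) / a"
proof -
  define k where "k = (\<lambda>s t. indicator {0..} s * f s * (if s \<le> t then exp (- a * t) else 0))"
  have [measurable]: "(\<lambda>(s, t). k s t) \<in> borel_measurable (lborel \<Otimes>\<^sub>M lborel)"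
    unfolding k_def by measurable
  have k_eq: "k s t = indicator {0..} s * f s * (indicator {s..} t * exp (- a * t))" for s t
    by (auto simp: k_def indicator_def)
  have "(\<integral>\<^sup>+s. \<integral>\<^sup>+t. ennreal \<bar>k s t\<bar> \<partial>lborel \<partial>lborel)
      = (\<integral>\<^sup>+s. ennreal (norm (indicator {0..} s * (exp (- a * s) * f s)) / a) \<partial>lborel)"
  proof (rule nn_integral_cong)
    fix s
    have "(\<integral>\<^sup>+t. ennreal \<bar>k s t\<bar> \<partial>lborel) = (\<integral>\<^sup>+t. ennreal \<bar>indicator {0..} s * f s\<bar> * ennreal (indicator {s..} t * exp (- a * t)) \<partial>lborel)"
      by (intro nn_integral_cong) (simp add: k_eq abs_mult ennreal_mult'[symmetric])
    also have "\<dots> = ennreal \<bar>indicator {0..} s * f s\<bar> * ennreal (exp (- a * s) / a)"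
      by (subst nn_integral_cmult, simp, simp only: nn_integral_exp_half_line[OF a])
    finally show "(\<integral>\<^sup>+t. ennreal \<bar>k s t\<bar> \<partial>lborel) = ennreal (norm (indicator {0..} s * (exp (- a * s) * f s)) / a)"
      using a by (simp add: ennreal_mult'[symmetric] abs_mult mult_ac)
  qed
  also have "\<dots> < \<infinity>"
    using integrable_divide[OF integrable_norm[OF int], of a] a
    by (subst (asm) integrable_iff_bounded) (auto simp: abs_mult)
  finally have fin: "(\<integral>\<^sup>+s. \<integral>\<^sup>+t. ennreal \<bar>k s t\<bar> \<partial>lborel \<partial>lborel) < \<infinity>" .
  have "(\<integral>t. indicator {0..} t * (exp (- a * t) * (\<integral>s. indicator {0..t} s * f s \<partial>lborel)) \<partial>lborel)
      = (\<integral>t. \<integral>s. k s t \<partial>lborel \<partial>lborel)"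
  proof (rule Bochner_Integration.integral_cong[OF refl])
    fix t
    have "(\<lambda>s. k s t) = (\<lambda>s. (indicator {0..} t * exp (- a * t)) * (indicator {0..t} s * f s))"
      by (auto simp: k_def indicator_def)
    then show "indicator {0..} t * (exp (- a * t) * (\<integral>s. indicator {0..t} s * f s \<partial>lborel)) = (\<integral>s. k s t \<partial>lborel)"
      by (simp add: mult.assoc)
  qed
  also have "\<dots> = (\<integral>s. \<integral>t. k s t \<partial>lborel \<partial>lborel)"
    by (rule lborel_integral_swap[symmetric]) (use fin in simp_all)
  also have "\<dots> = (\<integral>s. indicator {0..} s * (exp (- a * s) * f s) / a \<partial>lborel)"
    by (simp only: k_eq integral_mult_right_zero integral_exp_half_line[OF a]) (simp add: mult_ac)
  finally show ?thesis by simp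
qed

text \<open>The substitution \<open>s = r + t\<close> turns the double integral into one over
  \<open>0 \<le> r \<le> s\<close>. Integrating first over \<open>r\<close> produces the difference
  of the two exponentials divided by \<open>a - b\<close>. With \<open>f\<close> the mean of the
  time-changed path this is the resolvent equation.\<close>

lemma integral_exp_mult_shift:
  fixes f :: "real \<Rightarrow> real"
  assumes a: "0 < a" and b: "0 < b" and ab: "a \<noteq> b" and [measurable]: "f \<in> borel_measurable borel"
    and B: "\<And>s. \<bar>f s\<bar> \<le> B"
  shows "(\<integral>r. indicator {0..} r * (exp (- a * r) * (\<integral>t. indicator {0..} t * (exp (- b * t) * f (r + t)) \<partial>lborel)) \<partial>lborel)
    = ((\<integral>s. indicator {0..} s * (exp (- b * s) * f s) \<partial>lborel) - (\<integral>s. indicator {0..} s * (exp (- a * s) * f s) \<partial>lborel)) / (a - b)"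
proof -
  have B0: "0 \<le> B" using B[of 0] by simp
  have int: "integrable lborel (\<lambda>s. indicator {0..} s * (exp (- c * s) * f s))" if c: "0 < c" for c
  proof (rule Bochner_Integration.integrable_bound)
    show "integrable lborel (\<lambda>s. B * (indicator {0..} s * exp (- c * s)))"
      by (intro integrable_mult_right integrable_exp_half_line c)
    show "AE s in lborel. norm (indicator {0..} s * (exp (- c * s) * f s)) \<le> norm (B * (indicator {0..} s * exp (- c * s)))"
      using B B0 by (auto intro!: AE_I2 simp: abs_mult indicator_def mult.commute intro: mult_right_mono)
  qed simp
  define k where "k = (\<lambda>r s. if 0 \<le> r \<and> r \<le> s then exp (- a * r) * exp (- b * (s - r)) * f s else 0)"
  have [measurable]: "(\<lambda>(r, s). k r s) \<in> borel_measurable (lborel \<Otimes>\<^sub>M lborel)"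
    unfolding k_def by measurable
  have k_le: "\<bar>k r s\<bar> \<le> B * (indicator {0..} r * exp ((b - a) * r)) * (indicator {r..} s * exp (- b * s))" for r s
  proof (cases "0 \<le> r \<and> r \<le> s")
    case True
    have "exp (- a * r) * exp (- b * (s - r)) = exp ((b - a) * r) * exp (- b * s)"
      by (simp add: exp_add[symmetric] algebra_simps)
    then have "\<bar>k r s\<bar> = \<bar>f s\<bar> * (exp ((b - a) * r) * exp (- b * s))"
      using True by (simp add: k_def abs_mult)
    also have "\<dots> \<le> B * (exp ((b - a) * r) * exp (- b * s))"
      by (intro mult_right_mono B) auto
    finally show ?thesis using True by (simp add: mult.assoc)
  qed (auto simp: k_def B0)
  have fin: "(\<integral>\<^sup>+r. \<integral>\<^sup>+s. ennreal \<bar>k r s\<bar> \<partial>lborel \<partial>lborel) < \<infinity>"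
  proof -
    have "(\<integral>\<^sup>+r. \<integral>\<^sup>+s. ennreal \<bar>k r s\<bar> \<partial>lborel \<partial>lborel) \<le> (\<integral>\<^sup>+r. ennreal (B / b) * ennreal (indicator {0..} r * exp (- a * r)) \<partial>lborel)"
    proof (rule nn_integral_mono)
      fix r
      have "(\<integral>\<^sup>+s. ennreal \<bar>k r s\<bar> \<partial>lborel)
          \<le> (\<integral>\<^sup>+s. ennreal (B * (indicator {0..} r * exp ((b - a) * r))) * ennreal (indicator {r..} s * exp (- b * s)) \<partial>lborel)"
        by (intro nn_integral_mono) (use k_le B0 in \<open>simp add: ennreal_mult'[symmetric]\<close>)
      also have "\<dots> = ennreal (B * (indicator {0..} r * exp ((b - a) * r))) * ennreal (exp (- b * r) / b)"
        by (subst nn_integral_cmult, simp, simp only: nn_integral_exp_half_line[OF b])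
      also have "\<dots> = ennreal (B / b * (indicator {0..} r * (exp ((b - a) * r) * exp (- b * r))))"
        using B0 b by (simp add: ennreal_mult'[symmetric] mult_ac)
      also have "exp ((b - a) * r) * exp (- b * r) = exp (- a * r)"
        by (simp add: exp_add[symmetric] algebra_simps)
      finally show "(\<integral>\<^sup>+s. ennreal \<bar>k r s\<bar> \<partial>lborel) \<le> ennreal (B / b) * ennreal (indicator {0..} r * exp (- a * r))"
        using B0 b by (simp add: ennreal_mult'[symmetric])
    qed
    also have "\<dots> = ennreal (B / b) * ennreal (exp (- a * 0) / a)"
      by (subst nn_integral_cmult, simp, simp only: nn_integral_exp_half_line[OF a])
    also have "\<dots> < \<infinity>" by (simp add: ennreal_mult_less_top)
    finally show ?thesis .
  qed
  have "(\<integral>r. indicator {0..} r * (exp (- a * r) * (\<integral>t. indicator {0..} t * (exp (- b * t) * f (r + t)) \<partial>lborel)) \<partial>lborel)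
      = (\<integral>r. \<integral>s. k r s \<partial>lborel \<partial>lborel)"
  proof (rule Bochner_Integration.integral_cong[OF refl])
    fix r
    have "(\<integral>s. k r s \<partial>lborel) = (\<integral>t. k r (r + t) \<partial>lborel)"
      using lborel_integral_real_affine[of 1 "k r" r] by simp
    also have "(\<lambda>t. k r (r + t)) = (\<lambda>t. (indicator {0..} r * exp (- a * r)) * (indicator {0..} t * (exp (- b * t) * f (r + t))))"
      by (auto simp: k_def indicator_def)
    finally show "indicator {0..} r * (exp (- a * r) * (\<integral>t. indicator {0..} t * (exp (- b * t) * f (r + t)) \<partial>lborel)) = (\<integral>s. k r s \<partial>lborel)"
      by (simp add: mult.assoc)
  qed
  also have "\<dots> = (\<integral>s. \<integral>r. k r s \<partial>lborel \<partial>lborel)"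
    by (rule lborel_integral_swap) (use fin in simp_all)
  also have "\<dots> = (\<integral>s. (indicator {0..} s * (exp (- b * s) * f s) - indicator {0..} s * (exp (- a * s) * f s)) / (a - b) \<partial>lborel)"
  proof (rule Bochner_Integration.integral_cong[OF refl])
    fix s :: real
    have 1: "(\<lambda>r. k r s) = (\<lambda>r. (exp (- b * s) * f s) * (exp ((b - a) * r) * indicator {0..s} r))"
      by (auto simp: k_def indicator_def fun_eq_iff exp_add[symmetric] algebra_simps)
    have 2: "(\<integral>r. exp ((b - a) * r) * indicator {0..s} r \<partial>lborel) = exp ((b - a) * s) / (b - a) - exp ((b - a) * 0) / (b - a)" if "0 \<le> s"
      by (rule integral_FTC_Icc_real[OF that]) (use ab in \<open>auto intro!: derivative_eq_intros\<close>)
    have 3: "exp (- b * s) * exp ((b - a) * s) = exp (- a * s)"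
      by (simp add: exp_add[symmetric] algebra_simps)
    show "(\<integral>r. k r s \<partial>lborel) = (indicator {0..} s * (exp (- b * s) * f s) - indicator {0..} s * (exp (- a * s) * f s)) / (a - b)"
    proof (cases "0 \<le> s")
      case True
      have "(\<integral>r. k r s \<partial>lborel) = exp (- b * s) * f s * (exp ((b - a) * s) / (b - a) - 1 / (b - a))"
        unfolding 1 by (subst integral_mult_right_zero) (use 2[OF True] in simp)
      also have "\<dots> = (exp (- b * s) * exp ((b - a) * s) * f s - exp (- b * s) * f s) / (b - a)"
        by (simp add: algebra_simps diff_divide_distrib)
      also have "\<dots> = (exp (- b * s) * f s - exp (- a * s) * f s) / (a - b)"
        unfolding 3 by (metis minus_diff_eq minus_divide_divide)
      finally show ?thesis using True by simp
    qed (simp add: 1)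
  qed
  also have "\<dots> = ((\<integral>s. indicator {0..} s * (exp (- b * s) * f s) \<partial>lborel) - (\<integral>s. indicator {0..} s * (exp (- a * s) * f s) \<partial>lborel)) / (a - b)"
    using Bochner_Integration.integral_diff[OF int[OF b] int[OF a]] by simp
  finally show ?thesis .
qed


section \<open>Continuous clocks and their inverses\<close>

text \<open>The inverse clock for a single deterministic path, so that it can be studied without a
  process. It is infinite if the level is never exceeded; a path is in the cemetery at that
  time.\<close>

definition passage :: "(real \<Rightarrow> ennreal) \<Rightarrow> real \<Rightarrow> ennreal" where
  "passage a t = Inf {ennreal s | s. 0 \<le> s \<and> ennreal t < a s}"

lemma right_inverse_eq_passage: "right_inverse A t \<omega> = passage (\<lambda>s. A s \<omega>) t"
  by (simp add: right_inverse_def passage_def)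

text \<open>Because of the added 1 the rounded point is strictly larger than \<open>s\<close> even
  when \<open>s\<close> lies on the grid. Paths are right-continuous, so the approach has to be
  strictly from the right.\<close>

lemma filterlim_grid_at_right:
  "filterlim (\<lambda>n. (of_int \<lfloor>s * real (Suc n)\<rfloor> + 1) / real (Suc n)) (at_right s) sequentially"
proof -
  define r where "r n = (of_int \<lfloor>s * real (Suc n)\<rfloor> + 1) / real (Suc n)" for n
  have r: "s < r n" "r n \<le> s + 1 / real (Suc n)" for n
  proof -
    have "s * real (Suc n) < of_int \<lfloor>s * real (Suc n)\<rfloor> + 1" by linarith
    then show "s < r n" unfolding r_def by (simp add: less_divide_eq del: of_nat_Suc)
    have "of_int \<lfloor>s * real (Suc n)\<rfloor> + 1 \<le> s * real (Suc n) + 1" by linarith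
    then show "r n \<le> s + 1 / real (Suc n)"
      unfolding r_def by (simp add: divide_le_eq distrib_right del: of_nat_Suc)
  qed
  have "(\<lambda>n. s + 1 / real (Suc n)) \<longlonglongrightarrow> s + 0"
    by (intro tendsto_add tendsto_const LIMSEQ_Suc[OF lim_1_over_n])
  then have "(\<lambda>n. s + 1 / real (Suc n)) \<longlonglongrightarrow> s" by simp
  then have "r \<longlonglongrightarrow> s"
    by (rule tendsto_sandwich[OF _ _ tendsto_const, rotated 2]) (use r in \<open>auto intro!: always_eventually less_imp_le\<close>)
  then show ?thesis
    using r(1) unfolding r_def[symmetric]
    by (auto simp: filterlim_at order_less_imp_not_eq2 intro!: always_eventually)
qed

lemma emeasure_distr_density_indicator:
  fixes g :: "real \<Rightarrow> real"
  assumes [measurable]: "C \<in> sets borel" "g \<in> borel_measurable borel" "B \<in> sets borel"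
  shows "emeasure (distr (density lborel (indicator C)) borel g) B = emeasure lborel {t \<in> C. g t \<in> B}"
proof -
  have [measurable]: "g -` B \<in> sets borel" using measurable_sets[OF assms(2,3)] by simp
  have "emeasure (distr (density lborel (indicator C)) borel g) B = (\<integral>\<^sup>+t. indicator C t * indicator (g -` B) t \<partial>lborel)"
    by (subst emeasure_distr) (auto simp: emeasure_density)
  also have "\<dots> = (\<integral>\<^sup>+t. indicator {t \<in> C. g t \<in> B} t \<partial>lborel)"
    by (intro nn_integral_cong) (auto simp: indicator_def)
  also have "\<dots> = emeasure lborel {t \<in> C. g t \<in> B}"
  proof (rule nn_integral_indicator)
    have "{t \<in> C. g t \<in> B} = C \<inter> g -` B" by auto
    then show "{t \<in> C. g t \<in> B} \<in> sets lborel" by simp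
  qed
  finally show ?thesis .
qed

text \<open>The discretised inverse clock: at most one summand survives, the one for the grid cell
  containing the passage time of level \<open>t\<close>, and \<open>c\<close> is read at the right
  end of that cell. The cell is described through clock values at grid times, which makes
  measurability immediate; the cut-off after \<open>Suc n * Suc n\<close> cells, that is at time
  \<open>Suc n\<close>, keeps the sum finite.\<close>

definition step_sum :: "(real \<Rightarrow> ennreal) \<Rightarrow> nat \<Rightarrow> real \<Rightarrow> (nat \<Rightarrow> real) \<Rightarrow> real" where
  "step_sum a n t c = (\<Sum>k\<in>{1..Suc n * Suc n}.
     if a (real (k - 1) / real (Suc n)) \<le> ennreal t \<and> ennreal t < a (real k / real (Suc n)) then c k else 0)"

lemma passage_top: "\<not> (\<exists>s\<ge>0. ennreal t < a s) \<Longrightarrow> passage a t = \<infinity>"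
  unfolding passage_def by (auto intro: arg_cong[of _ "{}" Inf, THEN trans])

lemma step_sum_zero:
  assumes "\<not> (\<exists>s\<ge>0. ennreal t < a s)"
  shows "step_sum a n t c = 0"
  unfolding step_sum_def by (rule sum.neutral) (use assms in force)

locale clock =
  fixes a :: "real \<Rightarrow> ennreal"
  assumes zero: "a 0 = 0"
    and mono: "\<And>s t. 0 \<le> s \<Longrightarrow> s \<le> t \<Longrightarrow> a s \<le> a t"
    and cont: "continuous_on {0..} a"
begin

text \<open>Continuity of the clock forces the level to be attained exactly at the infimum
  \<open>T\<close>. The last conclusion trades comparisons of clock values with \<open>t\<close> for
  comparisons of times with \<open>T\<close>.\<close>

lemma passage_finite:
  assumes t: "0 \<le> t" and s0: "0 \<le> s0" "ennreal t < a s0"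
  obtains T where "0 \<le> T" "passage a t = ennreal T" "a T = ennreal t"
    "\<And>s. 0 \<le> s \<Longrightarrow> ennreal t < a s \<longleftrightarrow> T < s"
proof -
  define S where "S = {s. 0 \<le> s \<and> ennreal t < a s}"
  define T where "T = Inf S"
  have S: "S \<noteq> {}" "bdd_below S" using s0 by (auto simp: S_def intro!: bdd_belowI[of _ 0])
  have T0: "0 \<le> T" unfolding T_def by (rule cInf_greatest[OF S(1)]) (auto simp: S_def)
  have gt: "ennreal t < a s" if Ts: "T < s" for s
  proof -
    obtain s' where "s' \<in> S" "s' < s" using cInf_less_iff[OF S, of s, folded T_def, THEN iffD1, OF Ts] by blast
    then show ?thesis using mono[of s' s] by (auto simp: S_def intro: less_le_trans)
  qed
  have le: "T \<le> s" if "s \<in> S" for s using cInf_lower[OF that S(2)] by (simp add: T_def)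
  have tend: "(a \<longlongrightarrow> a T) (at T within {0..})"
    using cont T0 by (auto simp: continuous_on_def)
  have aT: "a T = ennreal t"
  proof (rule antisym)
    show "a T \<le> ennreal t"
    proof (rule ccontr)
      assume "\<not> a T \<le> ennreal t"
      then have T: "ennreal t < a T" by simp
      with zero t have "T \<noteq> 0" by auto
      with T0 have Tpos: "0 < T" by simp
      obtain d where d: "0 < d" "\<forall>s\<in>{0..}. s \<noteq> T \<and> dist s T < d \<longrightarrow> ennreal t < a s"
        using order_tendstoD(1)[OF tend T] unfolding eventually_at by blast
      define s where "s = max (T / 2) (T - d / 2)"
      have "s < T" "0 \<le> s" "dist s T < d" using d(1) Tpos by (auto simp: s_def dist_real_def)
      with d(2) have "s \<in> S" by (auto simp: S_def)
      from le[OF this] \<open>s < T\<close> show False by simp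
    qed
    show "ennreal t \<le> a T"
    proof (rule ccontr)
      assume "\<not> ennreal t \<le> a T"
      then have T: "a T < ennreal t" by simp
      obtain d where d: "0 < d" "\<forall>s\<in>{0..}. s \<noteq> T \<and> dist s T < d \<longrightarrow> a s < ennreal t"
        using order_tendstoD(2)[OF tend T] unfolding eventually_at by blast
      have "a (T + d / 2) < ennreal t"
        using d T0 by (auto simp: dist_real_def)
      with gt[of "T + d / 2"] d(1) show False by simp
    qed
  qed
  have iff: "ennreal t < a s \<longleftrightarrow> T < s" if "0 \<le> s" for s
  proof
    assume *: "ennreal t < a s"
    then have "T \<le> s" using le[of s] that by (simp add: S_def)
    moreover have "s \<noteq> T" using * aT by auto
    ultimately show "T < s" by simp
  qed (rule gt)
  have pT: "passage a t = ennreal T"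
  proof (rule antisym)
    show "passage a t \<le> ennreal T"
    proof (rule ennreal_le_epsilon)
      fix e :: real assume e: "0 < e"
      have "passage a t \<le> ennreal (T + e)"
        unfolding passage_def
        by (rule Inf_lower, rule CollectI, rule exI[of _ "T + e"]) (use gt[of "T + e"] e T0 in auto)
      then show "passage a t \<le> ennreal T + ennreal e" using e T0 by (simp add: ennreal_plus)
    qed
    show "ennreal T \<le> passage a t"
      unfolding passage_def by (rule Inf_greatest) (use le in \<open>auto simp: S_def intro: ennreal_leI\<close>)
  qed
  show thesis by (rule that[OF T0 pT aT iff])
qed

text \<open>\<open>j\<close> is the right end of the half-open cell containing \<open>T\<close>,
  hence the rounding down followed by adding 1. If \<open>T + 1 \<le> real (Suc n)\<close>, then
  \<open>T * real (Suc n) + 1\<close> is at most the square of \<open>Suc n\<close>, so this cell is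
  not cut off.\<close>

lemma step_sum_eq:
  fixes n :: nat
  assumes T: "0 \<le> T" "\<And>s. 0 \<le> s \<Longrightarrow> ennreal t < a s \<longleftrightarrow> T < s"
  defines "j \<equiv> nat \<lfloor>T * real (Suc n)\<rfloor> + 1"
  shows "step_sum a n t c = (if j \<le> Suc n * Suc n then c j else 0)"
    and "T + 1 \<le> real (Suc n) \<Longrightarrow> step_sum a n t c = c j"
proof -
  have fl: "real (nat \<lfloor>T * real (Suc n)\<rfloor>) = of_int \<lfloor>T * real (Suc n)\<rfloor>"
    using T(1) by simp
  have j1: "real (j - 1) \<le> T * real (Suc n)" "T * real (Suc n) < real j"
    unfolding j_def by (simp_all only: fl of_nat_add add_diff_cancel_right' of_nat_1) linarith+
  have iff: "(a (real (k - 1) / real (Suc n)) \<le> ennreal t \<and> ennreal t < a (real k / real (Suc n))) \<longleftrightarrow> k = j"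
    if k: "1 \<le> k" for k
  proof -
    have "(a (real (k - 1) / real (Suc n)) \<le> ennreal t \<and> ennreal t < a (real k / real (Suc n)))
       \<longleftrightarrow> real (k - 1) \<le> T * real (Suc n) \<and> T * real (Suc n) < real k"
      using T(2)[of "real (k - 1) / real (Suc n)"] T(2)[of "real k / real (Suc n)"]
      by (auto simp: not_less[symmetric] divide_less_eq less_divide_eq simp del: of_nat_Suc)
    also have "\<dots> \<longleftrightarrow> k = j"
    proof
      assume A: "real (k - 1) \<le> T * real (Suc n) \<and> T * real (Suc n) < real k"
      then have "real (k - 1) < real j" "real (j - 1) < real k" using j1 by linarith+
      then show "k = j" using k by (simp add: j_def)
    qed (use j1 in auto)
    finally show ?thesis .
  qed
  have "step_sum a n t c = (\<Sum>k\<in>{1..Suc n * Suc n}. if k = j then c k else 0)"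
    unfolding step_sum_def by (rule sum.cong[OF refl]) (use iff in auto)
  also have "\<dots> = (if j \<le> Suc n * Suc n then c j else 0)" by (simp add: j_def)
  finally show *: "step_sum a n t c = (if j \<le> Suc n * Suc n then c j else 0)" .
  assume n: "T + 1 \<le> real (Suc n)"
  have "T * real (Suc n) + 1 \<le> real (Suc n) * real (Suc n)"
  proof -
    have "(T + 1) * real (Suc n) \<le> real (Suc n) * real (Suc n)"
      by (rule mult_right_mono[OF n]) simp
    then show ?thesis by (simp add: algebra_simps)
  qed
  then have "real j \<le> real (Suc n * Suc n)"
    unfolding j_def of_nat_add of_nat_mult fl by linarith
  then have "j \<le> Suc n * Suc n" unfolding of_nat_le_iff .
  then show "step_sum a n t c = c j" unfolding * by simp
qed

lemma abs_step_sum_le: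
  assumes t: "0 \<le> t" and B: "0 \<le> B" "\<And>k. \<bar>c k\<bar> \<le> B"
  shows "\<bar>step_sum a n t c\<bar> \<le> B"
proof (cases "\<exists>s\<ge>0. ennreal t < a s")
  case True
  then obtain s0 where s0: "0 \<le> s0" "ennreal t < a s0" by blast
  obtain T where T: "0 \<le> T" "passage a t = ennreal T" "a T = ennreal t"
    "\<And>s. 0 \<le> s \<Longrightarrow> ennreal t < a s \<longleftrightarrow> T < s"
    by (rule passage_finite[OF t s0]) blast
  show ?thesis using step_sum_eq(1)[OF T(1,4), of n c] B by simp
qed (simp add: step_sum_zero B)

lemma step_sum_tendsto:
  assumes T: "0 \<le> T" "\<And>s. 0 \<le> s \<Longrightarrow> ennreal t < a s \<longleftrightarrow> T < s" and g: "(g \<longlongrightarrow> l) (at_right T)"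
  shows "(\<lambda>n. step_sum a n t (\<lambda>k. g (real k / real (Suc n)))) \<longlonglongrightarrow> l"
proof -
  define r where "r = (\<lambda>n. real (nat \<lfloor>T * real (Suc n)\<rfloor> + 1) / real (Suc n))"
  have "real (nat \<lfloor>T * real (Suc n)\<rfloor> + 1) = of_int \<lfloor>T * real (Suc n)\<rfloor> + 1" for n
    using T(1) by simp
  then have "filterlim r (at_right T) sequentially"
    unfolding r_def using filterlim_grid_at_right[of T] by presburger
  with g have "(\<lambda>n. g (r n)) \<longlonglongrightarrow> l" by (rule filterlim_compose)
  moreover have "\<forall>\<^sub>F n in sequentially. g (r n) = step_sum a n t (\<lambda>k. g (real k / real (Suc n)))"
  proof -
    obtain N where N: "T \<le> real N" using real_arch_simple by blast
    show ?thesis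
      using eventually_ge_at_top[of N]
    proof eventually_elim
      case (elim n)
      then have "T + 1 \<le> real (Suc n)" using N by simp
      from step_sum_eq(2)[OF T this] show ?case by (simp add: r_def del: of_nat_Suc)
    qed
  qed
  ultimately show ?thesis by (rule Lim_transform_eventually)
qed

section \<open>The Stieltjes measure of a clock as an image of Lebesgue measure\<close>

definition range_clock :: "real set" where
  "range_clock = {t. 0 \<le> t \<and> (\<exists>s\<ge>0. ennreal t < a s)}"

text \<open>The default 0 outside \<open>range_clock\<close> has no effect on the integrals below,
  which all carry the indicator of a subset of \<open>range_clock\<close>.\<close>

definition position :: "real \<Rightarrow> real" where
  "position t = (if t \<in> range_clock then enn2real (passage a t) else 0)"

lemma position:
  assumes "t \<in> range_clock"
  shows "0 \<le> position t" "passage a t = ennreal (position t)" "a (position t) = ennreal t"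
    "\<And>s. 0 \<le> s \<Longrightarrow> ennreal t < a s \<longleftrightarrow> position t < s"
proof -
  from assms obtain s0 where s0: "0 \<le> t" "0 \<le> s0" "ennreal t < a s0" by (auto simp: range_clock_def)
  obtain T where T: "0 \<le> T" "passage a t = ennreal T" "a T = ennreal t"
    "\<And>s. 0 \<le> s \<Longrightarrow> ennreal t < a s \<longleftrightarrow> T < s"
    by (rule passage_finite[OF s0]) blast
  then have "position t = T" using assms by (simp add: position_def)
  with T show "0 \<le> position t" "passage a t = ennreal (position t)" "a (position t) = ennreal t"
    "\<And>s. 0 \<le> s \<Longrightarrow> ennreal t < a s \<longleftrightarrow> position t < s" by auto
qed

lemma range_clock_sets[measurable]: "range_clock \<in> sets borel"
proof -
  have "range_clock = (\<Union>n::nat. {t. 0 \<le> t \<and> ennreal t < a (real n)})"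
  proof (intro equalityI subsetI)
    fix t assume "t \<in> range_clock"
    then obtain s where s: "0 \<le> t" "0 \<le> s" "ennreal t < a s" by (auto simp: range_clock_def)
    obtain n where "s \<le> real n" using real_arch_simple by blast
    with s mono[of s "real n"] show "t \<in> (\<Union>n::nat. {t. 0 \<le> t \<and> ennreal t < a (real n)})"
      by (auto intro: less_le_trans)
  next
    fix t assume "t \<in> (\<Union>n::nat. {t. 0 \<le> t \<and> ennreal t < a (real n)})"
    then obtain n :: nat where "0 \<le> t" "ennreal t < a (real n)" by blast
    then show "t \<in> range_clock" by (auto simp: range_clock_def intro!: exI[of _ "real n"])
  qed
  also have "\<dots> \<in> sets borel" by measurable
  finally show ?thesis .
qed

lemma position_measurable[measurable]: "position \<in> borel_measurable borel"
proof (rule borel_measurableI_less)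
  fix y :: real
  have "{t. position t < y} = (if y \<le> 0 then {} else {t. 0 \<le> t \<and> ennreal t < a y} \<union> - range_clock)"
  proof -
    have 0: "0 \<le> position t" for t using position(1)[of t] by (auto simp: position_def)
    have "position t < y \<longleftrightarrow> 0 \<le> t \<and> ennreal t < a y \<or> t \<notin> range_clock" if "0 < y" for t
    proof (cases "t \<in> range_clock")
      case True
      then show ?thesis using position(4)[of t y] that by (auto simp: range_clock_def)
    qed (use that in \<open>simp add: position_def\<close>)
    then show ?thesis using 0 by (auto simp: not_less intro: order_trans)
  qed
  then show "{x \<in> space borel. position x < y} \<in> sets borel" by simp
qed

text \<open>Substituting the level for the time: Lebesgue measure on the finite levels below
  \<open>k\<close>, transported by the inverse clock, is the Stieltjes measure of the clock
  truncated at \<open>k\<close>, whose distribution function is \<open>clock_cdf k\<close>.\<close>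

definition clock_measure :: "nat \<Rightarrow> real measure" where
  "clock_measure k = distr (density lborel (indicator {t \<in> range_clock. t < real k})) borel position"

definition clock_cdf :: "nat \<Rightarrow> real \<Rightarrow> real" where
  "clock_cdf k y = enn2real (min (a (max 0 y)) (of_nat k))"

lemma emeasure_clock_measure:
  "B \<in> sets borel \<Longrightarrow> emeasure (clock_measure k) B = emeasure lborel {t \<in> range_clock. t < real k \<and> position t \<in> B}"
  unfolding clock_measure_def by (subst emeasure_distr_density_indicator) (auto simp: conj_assoc)

text \<open>The levels whose passage time is at most \<open>y\<close> form a set between
  \<open>{0..<c}\<close> and \<open>{0..c}\<close>, where \<open>c\<close> is the truncated clock
  value at \<open>y\<close>; flat pieces of the clock can only affect the end point.\<close>

lemma emeasure_clock_measure_Iic: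
  "emeasure (clock_measure k) {..y} = ennreal (clock_cdf k y)"
proof (cases "0 \<le> y")
  case False
  then have "{t \<in> range_clock. t < real k \<and> position t \<in> {..y}} = {}"
    using position(1) by force
  with False show ?thesis by (simp add: emeasure_clock_measure clock_cdf_def zero del: Collect_empty_eq)
next
  case True
  define c where "c = clock_cdf k y"
  have c: "ennreal c = min (a y) (of_nat k)" "0 \<le> c"
    using True by (auto simp: c_def clock_cdf_def min_def less_top[symmetric] top_unique
        of_nat_less_top ennreal_of_nat_eq_real_of_nat intro!: ennreal_enn2real intro: le_less_trans[OF _ ennreal_less_top] )
  let ?S = "{t \<in> range_clock. t < real k \<and> position t \<in> {..y}}"
  have [measurable]: "?S \<in> sets borel" by measurable
  have less: "t < c \<longleftrightarrow> ennreal t < a y \<and> t < real k" if "0 \<le> t" for t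
    using ennreal_less_iff[OF that, of c] that unfolding c(1) min_less_iff_conj
    by (simp add: ennreal_of_nat_eq_real_of_nat ennreal_less_iff)
  have le: "t \<le> c" if "0 \<le> t" "ennreal t \<le> a y" "t < real k" for t
    using that ennreal_le_iff[OF c(2), of t] unfolding c(1)
    by (simp add: ennreal_of_nat_eq_real_of_nat)
  have "{0..<c} \<subseteq> ?S"
  proof
    fix t assume "t \<in> {0..<c}"
    then have t: "0 \<le> t" "ennreal t < a y" "t < real k" using less by auto
    then have "t \<in> range_clock" using True by (auto simp: range_clock_def)
    with position(4)[OF this True] t show "t \<in> ?S" by auto
  qed
  moreover have "?S \<subseteq> {0..c}"
  proof
    fix t assume t: "t \<in> ?S"
    then have "a (position t) \<le> a y" using mono position(1) by auto
    with t position(3)[of t] le[of t] show "t \<in> {0..c}" by (auto simp: range_clock_def)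
  qed
  ultimately have "emeasure lborel {0..<c} \<le> emeasure lborel ?S" "emeasure lborel ?S \<le> emeasure lborel {0..c}"
    by (auto intro!: emeasure_mono)
  then have "emeasure lborel ?S = ennreal c" using c(2) by (intro antisym) auto
  then show ?thesis by (subst emeasure_clock_measure) (simp_all add: c_def)
qed

text \<open>Both sides have the same distribution function, which determines a finite Borel measure.
  Finiteness is what the truncation at \<open>k\<close> provides.\<close>

lemma interval_measure_clock_cdf: "interval_measure (clock_cdf k) = clock_measure k"
proof -
  have fin: "min x (of_nat k) < (top::ennreal)" for x
    by (simp add: min_less_iff_disj of_nat_less_top)
  have mono': "clock_cdf k x \<le> clock_cdf k y" if "x \<le> y" for x y
    unfolding clock_cdf_def by (intro enn2real_mono fin min.mono mono) (use that in auto)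
  have "continuous_on UNIV (\<lambda>y. min (a (max 0 y)) (of_nat k))"
    by (intro continuous_on_min continuous_on_const continuous_on_compose2[OF cont] continuous_on_max continuous_on_id) auto
  then have "isCont (clock_cdf k) y" for y
    using fin[of "a (max 0 y)"] unfolding continuous_on_eq_continuous_at[OF open_UNIV] clock_cdf_def isCont_def
    by (intro tendsto_enn2real) auto
  then have rc: "continuous (at_right y) (clock_cdf k)" for y
    by (rule continuous_at_imp_continuous_at_within)
  have "\<forall>\<^sub>F y in at_bot. clock_cdf k y = 0"
    using eventually_le_at_bot[of 0] by eventually_elim (simp add: clock_cdf_def zero)
  then have bot: "(clock_cdf k \<longlongrightarrow> 0) at_bot" by (rule tendsto_eventually)
  have bnd: "ennreal (clock_cdf k y) \<le> of_nat k" for y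
    using fin[of "a (max 0 y)"] by (simp add: clock_cdf_def ennreal_enn2real)
  have finite: "finite_borel_measure M" if M: "sets M = sets borel" "\<And>y. emeasure M {..y} = ennreal (clock_cdf k y)" for M
  proof -
    have "emeasure M (\<Union>n::nat. {..real n}) = (SUP n::nat. emeasure M {..real n})"
      by (rule SUP_emeasure_incseq[symmetric]) (auto simp: incseq_def M(1))
    also have "\<dots> \<le> of_nat k" using bnd by (auto simp: M(2) intro!: SUP_least)
    also have "(\<Union>n::nat. {..real n}) = space M"
      using sets_eq_imp_space_eq[OF M(1)] by (auto intro: real_arch_simple)
    finally have "emeasure M (space M) \<noteq> \<infinity>" by (auto simp: top_unique)
    then show ?thesis
      by (auto simp: finite_borel_measure_def finite_borel_measure_axioms_def M(1) intro!: finite_measureI)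
  qed
  have I: "emeasure (interval_measure (clock_cdf k)) {..y} = ennreal (clock_cdf k y)" for y
    by (rule emeasure_interval_measure_Iic[OF mono' rc bot])
  have S: "sets (clock_measure k) = sets borel" by (simp add: clock_measure_def)
  show ?thesis
    by (rule cdf_unique'[OF finite[OF sets_interval_measure I] finite[OF S emeasure_clock_measure_Iic]])
      (simp add: cdf_def measure_def I emeasure_clock_measure_Iic)
qed

text \<open>The supremum over \<open>k\<close> in \<open>stieltjes\<close> is continuity from below
  along the increasing sets of levels below \<open>k\<close>.\<close>

lemma stieltjes_eq: "stieltjes a = distr (density lborel (indicator range_clock)) borel position"
proof -
  let ?M = "distr (density lborel (indicator range_clock)) borel position"
  have "emeasure ?M B = (SUP k. emeasure (interval_measure (\<lambda>t. enn2real (min (a (max 0 t)) (of_nat k)))) B)"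
    if B: "B \<in> sets borel" for B
  proof -
    have "(SUP k. emeasure (interval_measure (\<lambda>t. enn2real (min (a (max 0 t)) (of_nat k)))) B)
        = (SUP k. emeasure lborel {t \<in> range_clock. t < real k \<and> position t \<in> B})"
      using interval_measure_clock_cdf[unfolded clock_cdf_def[abs_def]]
      by (simp add: emeasure_clock_measure[OF B])
    also have "\<dots> = emeasure lborel (\<Union>k. {t \<in> range_clock. t < real k \<and> position t \<in> B})"
      by (rule SUP_emeasure_incseq) (use B in \<open>auto simp: incseq_def\<close>)
    also have "(\<Union>k. {t \<in> range_clock. t < real k \<and> position t \<in> B}) = {t \<in> range_clock. position t \<in> B}"
      by (auto intro: reals_Archimedean2)
    also have "emeasure lborel \<dots> = emeasure ?M B"
      by (rule emeasure_distr_density_indicator[symmetric]) (use B in auto)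
    finally show ?thesis by simp
  qed
  then have "stieltjes a = measure_of UNIV (sets borel) (emeasure ?M)"
    unfolding stieltjes_def using sets.sigma_sets_eq[of "borel :: real measure"]
    by (intro measure_of_eq) (auto simp del: sets.sigma_sets_eq)
  then have "stieltjes a = measure_of (space ?M) (sets ?M) (emeasure ?M)" by simp
  then show ?thesis by (simp only: measure_of_of_measure)
qed

lemma nn_integral_stieltjes:
  assumes [measurable]: "f \<in> borel_measurable borel"
  shows "(\<integral>\<^sup>+s. f s \<partial>stieltjes a) = (\<integral>\<^sup>+t. indicator range_clock t * f (position t) \<partial>lborel)"
  unfolding stieltjes_eq by (simp add: nn_integral_distr nn_integral_density)

end


section \<open>The Markov property for completed path functionals\<close>

lemma measurable_mono_sigma:
  assumes "F \<in> measurable M N" "space M' = space M" "sets M \<subseteq> sets M'"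
  shows "F \<in> measurable M' N"
  using assms by (auto simp: measurable_def)

lemma emeasure_density_indicator:
  assumes [measurable]: "A \<in> sets M" "B \<in> sets M"
  shows "emeasure (density M (indicator A)) B = emeasure M (A \<inter> B)"
proof -
  have "emeasure (density M (indicator A)) B = (\<integral>\<^sup>+x. indicator A x * indicator B x \<partial>M)"
    by (rule emeasure_density) measurable
  also have "\<dots> = (\<integral>\<^sup>+x. indicator (A \<inter> B) x \<partial>M)"
    by (rule nn_integral_cong) (auto simp: indicator_def)
  finally show ?thesis by simp
qed

lemma space_borel_opc[simp]: "space borel_opc = UNIV"
  by (simp add: borel_opc_def space_measure_of_conv)

lemma sets_borel_opc_openin: "openin opc U \<Longrightarrow> U \<in> sets borel_opc"
  unfolding borel_opc_def by (simp add: sets_measure_of_conv sigma_sets.Basic)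

locale std_process =
  fixes Y :: "('w, 'a::topological_space) process"
  assumes std: "standard_process Y"
begin

abbreviation paths :: "'w set" where "paths \<equiv> space (events Y)"

lemma markov: "markov_process Y" using std by (simp add: standard_process_def)

lemma filtration: "filtration paths (hist Y)"
  and sets_hist_subset: "sets (hist Y t) \<subseteq> sets (events Y)"
  and prob_law: "prob_space (law Y x)"
  and sets_law: "sets (law Y x) = sets (events Y)"
  and pos_hist: "pos Y t \<in> hist Y t \<rightarrow>\<^sub>M borel_opc"
  and pos_infinity: "\<omega> \<in> paths \<Longrightarrow> pos Y \<infinity> \<omega> = None"
  and pos_absorb: "\<omega> \<in> paths \<Longrightarrow> s \<le> t \<Longrightarrow> pos Y s \<omega> = None \<Longrightarrow> pos Y t \<omega> = None"
  and shift_paths: "\<omega> \<in> paths \<Longrightarrow> shift Y t \<omega> \<in> paths"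
  and pos_shift: "\<omega> \<in> paths \<Longrightarrow> pos Y t (shift Y s \<omega>) = pos Y (t + s) \<omega>"
  and law_pos_measurable: "B \<in> sets borel_opc \<Longrightarrow>
        (\<lambda>x. emeasure (law Y x) {\<omega>\<in>paths. pos Y t \<omega> \<in> B}) \<in> borel_measurable borel_opc"
  and AE_pos_0: "AE \<omega> in law Y x. pos Y 0 \<omega> = x"
  and markov_sets: "B \<in> sets borel_opc \<Longrightarrow> \<Lambda> \<in> sets (hist Y t) \<Longrightarrow>
        emeasure (law Y x) {\<omega>\<in>\<Lambda>. pos Y (t + s) \<omega> \<in> B} =
        (\<integral>\<^sup>+\<omega>\<in>\<Lambda>. emeasure (law Y (pos Y t \<omega>)) {\<omega>'\<in>paths. pos Y s \<omega>' \<in> B} \<partial>law Y x)"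
  using markov unfolding markov_process_def Let_def by (auto simp: Pi_iff)

lemma space_law[simp]: "space (law Y x) = paths"
  by (rule sets_eq_imp_space_eq[OF sets_law])

lemma space_hist[simp]: "space (hist Y t) = paths"
  using filtration by (rule filtration.space_F)

lemma sets_hist_mono: "s \<le> t \<Longrightarrow> sets (hist Y s) \<subseteq> sets (hist Y t)"
  using filtration by (rule filtration.sets_F_mono)

lemma measurable_law: "measurable (law Y x) N = measurable (events Y) N"
  by (rule measurable_cong_sets[OF sets_law refl])

lemma pos_events[measurable]: "pos Y t \<in> events Y \<rightarrow>\<^sub>M borel_opc"
  by (rule measurable_mono_sigma[OF pos_hist]) (simp_all add: sets_hist_subset)

lemma pos_law[measurable]: "pos Y t \<in> law Y x \<rightarrow>\<^sub>M borel_opc"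
  by (simp add: measurable_law)

lemma vimage_paths: "f -` B \<inter> paths = {\<omega>\<in>paths. f \<omega> \<in> B}"
  by auto

definition trans_kernel :: "ennreal \<Rightarrow> 'a option \<Rightarrow> 'a option measure" where
  "trans_kernel s y = distr (law Y y) borel_opc (pos Y s)"

lemma trans_kernel_measurable[measurable]: "trans_kernel s \<in> borel_opc \<rightarrow>\<^sub>M subprob_algebra borel_opc"
proof (rule measurable_subprob_algebra)
  fix y show "subprob_space (trans_kernel s y)"
    unfolding trans_kernel_def
    by (intro prob_space_imp_subprob_space prob_space.prob_space_distr prob_law) simp
next
  fix B :: "'a option set" assume B: "B \<in> sets borel_opc"
  have "pos Y s -` B \<inter> paths = {\<omega>\<in>paths. pos Y s \<omega> \<in> B}" by auto
  with law_pos_measurable[OF B, of s] B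
  show "(\<lambda>y. emeasure (trans_kernel s y) B) \<in> borel_measurable borel_opc"
    by (simp add: trans_kernel_def emeasure_distr)
qed (simp add: trans_kernel_def)

lemma nn_integral_trans_kernel:
  "g \<in> borel_measurable borel_opc \<Longrightarrow> (\<integral>\<^sup>+z. g z \<partial>trans_kernel s y) = (\<integral>\<^sup>+\<omega>. g (pos Y s \<omega>) \<partial>law Y y)"
  unfolding trans_kernel_def by (rule nn_integral_distr) simp_all

lemma trans_measurable[measurable]:
  assumes [measurable]: "g \<in> borel_measurable borel_opc"
  shows "(\<lambda>y. \<integral>\<^sup>+\<omega>. g (pos Y s \<omega>) \<partial>law Y y) \<in> borel_measurable borel_opc"
  unfolding nn_integral_trans_kernel[OF assms, symmetric]
  by (rule measurable_compose[OF trans_kernel_measurable nn_integral_measurable_subprob_algebra]) simp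

lemma indicator_hist_law:
  "\<Lambda> \<in> sets (hist Y t) \<Longrightarrow> \<Lambda> \<in> sets (law Y x)"
  using sets_hist_subset sets_law by blast

text \<open>The Markov property is given for events only. Read as an identity of measures, it says
  that on \<Lambda> the law of the position at \<open>t + s\<close> is the law at \<open>t\<close>
  followed by \<open>trans_kernel s\<close>; integrating \<open>g\<close> against both sides extends
  it to functions.\<close>

lemma markov_nn_integral:
  assumes \<Lambda>: "\<Lambda> \<in> sets (hist Y t)" and g[measurable]: "g \<in> borel_measurable borel_opc"
  shows "(\<integral>\<^sup>+\<omega>. indicator \<Lambda> \<omega> * g (pos Y (t + s) \<omega>) \<partial>law Y x)
     = (\<integral>\<^sup>+\<omega>. indicator \<Lambda> \<omega> * (\<integral>\<^sup>+\<omega>'. g (pos Y s \<omega>') \<partial>law Y (pos Y t \<omega>)) \<partial>law Y x)"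
proof -
  have [measurable]: "\<Lambda> \<in> sets (law Y x)" by (rule indicator_hist_law[OF \<Lambda>])
  let ?D = "density (law Y x) (indicator \<Lambda>)"
  let ?Q = "distr ?D borel_opc (pos Y t)"
  have "distr ?D borel_opc (pos Y (t + s)) = ?Q \<bind> trans_kernel s"
  proof (rule measure_eqI)
    show "sets (distr ?D borel_opc (pos Y (t + s))) = sets (?Q \<bind> trans_kernel s)"
      by (subst sets_bind[of _ _ borel_opc]) (simp_all add: trans_kernel_def)
    fix B assume "B \<in> sets (distr ?D borel_opc (pos Y (t + s)))"
    then have B[measurable]: "B \<in> sets borel_opc" by simp
    have vim: "pos Y r -` B \<inter> paths = {\<omega>\<in>paths. pos Y r \<omega> \<in> B}" for r by auto
    have [measurable]: "(\<lambda>y. emeasure (trans_kernel s y) B) \<in> borel_measurable borel_opc" by measurable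
    have "emeasure (distr ?D borel_opc (pos Y (t + s))) B = emeasure (law Y x) {\<omega>\<in>\<Lambda>. pos Y (t + s) \<omega> \<in> B}"
    proof -
      have S: "pos Y (t + s) -` B \<inter> paths \<in> sets (law Y x)"
        using measurable_sets[OF pos_law[of "t + s" x] B] by simp
      have "emeasure (distr ?D borel_opc (pos Y (t + s))) B
          = emeasure (law Y x) (\<Lambda> \<inter> (pos Y (t + s) -` B \<inter> paths))"
        using S by (simp add: emeasure_distr emeasure_density_indicator)
      also have "\<Lambda> \<inter> (pos Y (t + s) -` B \<inter> paths) = {\<omega>\<in>\<Lambda>. pos Y (t + s) \<omega> \<in> B}"
        using sets.sets_into_space[OF \<Lambda>] by auto
      finally show ?thesis .
    qed
    also have "\<dots> = (\<integral>\<^sup>+\<omega>\<in>\<Lambda>. emeasure (trans_kernel s (pos Y t \<omega>)) B \<partial>law Y x)"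
      unfolding markov_sets[OF B \<Lambda>] by (simp add: trans_kernel_def emeasure_distr vim)
    also have "\<dots> = (\<integral>\<^sup>+z. emeasure (trans_kernel s z) B \<partial>?Q)"
      by (subst nn_integral_distr) (simp_all add: nn_integral_density mult.commute)
    also have "\<dots> = emeasure (?Q \<bind> trans_kernel s) B"
      by (rule emeasure_bind[symmetric, of _ _ borel_opc]) auto
    finally show "emeasure (distr ?D borel_opc (pos Y (t + s))) B = emeasure (?Q \<bind> trans_kernel s) B" .
  qed
  then have "(\<integral>\<^sup>+z. g z \<partial>distr ?D borel_opc (pos Y (t + s))) = (\<integral>\<^sup>+z. g z \<partial>(?Q \<bind> trans_kernel s))" by simp
  also have "\<dots> = (\<integral>\<^sup>+y. \<integral>\<^sup>+z. g z \<partial>trans_kernel s y \<partial>?Q)"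
    by (rule nn_integral_bind[OF g]) simp
  finally show ?thesis
    by (simp add: nn_integral_distr nn_integral_density nn_integral_trans_kernel)
qed

section \<open>Cylinder events and functionals of the uncompleted path\<close>

text \<open>Times are encoded by successive increments after a base time \<open>q\<close>. In this
  form a translation of the path only changes the base time, and the Markov property can be applied
  one increment at a time.\<close>

fun cyl :: "ennreal \<Rightarrow> (ennreal \<times> 'a option set) list \<Rightarrow> 'w set" where
  "cyl q [] = paths"
| "cyl q ((d, B) # l) = (pos Y (q + d) -` B \<inter> paths) \<inter> cyl (q + d) l"

fun cyl_prob :: "(ennreal \<times> 'a option set) list \<Rightarrow> 'a option \<Rightarrow> ennreal" where
  "cyl_prob [] y = 1"
| "cyl_prob ((d, B) # l) y = (\<integral>\<^sup>+\<omega>. indicator B (pos Y d \<omega>) * cyl_prob l (pos Y d \<omega>) \<partial>law Y y)"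

lemma cyl_prob_measurable:
  "(\<And>d B. (d, B) \<in> set l \<Longrightarrow> B \<in> sets borel_opc) \<Longrightarrow> cyl_prob l \<in> borel_measurable borel_opc"
proof (induction l)
  case (Cons p l)
  obtain d B where p: "p = (d, B)" by force
  have [measurable]: "B \<in> sets borel_opc" "cyl_prob l \<in> borel_measurable borel_opc"
    using Cons by (auto simp: p)
  show ?case unfolding p cyl_prob.simps by (rule trans_measurable) measurable
qed (simp add: cyl_prob.simps(1)[abs_def])

text \<open>The first constraint is absorbed into \<Lambda>, which then belongs to the history at
  time \<open>q + d\<close>; the induction hypothesis is applied there, and one use of the Markov
  property steps back from \<open>q + d\<close> to \<open>q\<close>.\<close>

lemma cyl_markov:
  "(\<And>d B. (d, B) \<in> set l \<Longrightarrow> B \<in> sets borel_opc) \<Longrightarrow> \<Lambda> \<in> sets (hist Y q) \<Longrightarrow>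
   emeasure (law Y x) (\<Lambda> \<inter> cyl q l) = (\<integral>\<^sup>+\<omega>. indicator \<Lambda> \<omega> * cyl_prob l (pos Y q \<omega>) \<partial>law Y x)"
proof (induction l arbitrary: \<Lambda> q)
  case Nil
  then have "\<Lambda> \<inter> paths = \<Lambda>" using sets.sets_into_space by force
  with indicator_hist_law[OF Nil(2), of x] show ?case by simp
next
  case (Cons p l)
  obtain d B where p: "p = (d, B)" by force
  have B[measurable]: "B \<in> sets borel_opc" using Cons.prems by (auto simp: p)
  have [measurable]: "cyl_prob l \<in> borel_measurable borel_opc"
    by (rule cyl_prob_measurable) (use Cons.prems in auto)
  let ?\<Lambda> = "\<Lambda> \<inter> (pos Y (q + d) -` B \<inter> paths)"
  have "pos Y (q + d) -` B \<inter> paths \<in> sets (hist Y (q + d))"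
    using measurable_sets[OF pos_hist B] by simp
  moreover have "\<Lambda> \<in> sets (hist Y (q + d))"
    using Cons.prems(2) sets_hist_mono[of q "q + d"] by auto
  ultimately have "emeasure (law Y x) (?\<Lambda> \<inter> cyl (q + d) l)
      = (\<integral>\<^sup>+\<omega>. indicator ?\<Lambda> \<omega> * cyl_prob l (pos Y (q + d) \<omega>) \<partial>law Y x)"
    by (intro Cons.IH) (use Cons.prems in auto)
  also have "\<dots> = (\<integral>\<^sup>+\<omega>. indicator \<Lambda> \<omega> * (indicator B (pos Y (q + d) \<omega>) * cyl_prob l (pos Y (q + d) \<omega>)) \<partial>law Y x)"
    by (rule nn_integral_cong) (auto simp: indicator_def)
  also have "\<dots> = (\<integral>\<^sup>+\<omega>. indicator \<Lambda> \<omega> * cyl_prob (p # l) (pos Y q \<omega>) \<partial>law Y x)"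
    unfolding p cyl_prob.simps by (rule markov_nn_integral[OF Cons.prems(2)]) measurable
  finally show ?case by (simp add: p Int_assoc)
qed

text \<open>The case of base time 0 and the full event, where normality replaces the random starting
  position by \<open>y\<close>.\<close>

lemma cyl_law:
  assumes "\<And>d B. (d, B) \<in> set l \<Longrightarrow> B \<in> sets borel_opc"
  shows "emeasure (law Y y) (cyl 0 l) = cyl_prob l y"
proof -
  have sub: "cyl q l \<subseteq> paths" for q l by (induction l arbitrary: q) auto
  have "emeasure (law Y y) (paths \<inter> cyl 0 l) = (\<integral>\<^sup>+\<omega>. indicator paths \<omega> * cyl_prob l (pos Y 0 \<omega>) \<partial>law Y y)"
    by (rule cyl_markov[OF assms]) (use sets.top[of "hist Y 0"] in auto)
  also have "\<dots> = (\<integral>\<^sup>+\<omega>. cyl_prob l y \<partial>law Y y)"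
    by (rule nn_integral_cong_AE) (use AE_pos_0[of y] AE_space in \<open>eventually_elim, simp\<close>)
  also have "\<dots> = cyl_prob l y"
    using prob_space.emeasure_space_1[OF prob_law[of y]] by simp
  finally show ?thesis using sub[of 0 l] by (simp add: Int_absorb1)
qed

lemma shift_vimage_cyl: "shift Y q -` cyl r l \<inter> paths = cyl (r + q) l"
proof (induction l arbitrary: r)
  case (Cons p l)
  obtain d B where p: "p = (d, B)" by force
  have "shift Y q -` cyl r (p # l) \<inter> paths
      = (shift Y q -` (pos Y (r + d) -` B \<inter> paths) \<inter> paths) \<inter> (shift Y q -` cyl (r + d) l \<inter> paths)"
    by (auto simp: p)
  also have "\<dots> = (pos Y (r + d + q) -` B \<inter> paths) \<inter> cyl (r + d + q) l"
    unfolding Cons.IH by (auto simp: pos_shift shift_paths)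
  finally show ?case by (simp add: p add_ac)
qed (auto simp: shift_paths)

fun increments :: "(ennreal \<Rightarrow> 'a option set) \<Rightarrow> ennreal \<Rightarrow> ennreal list \<Rightarrow> (ennreal \<times> 'a option set) list" where
  "increments B q [] = []"
| "increments B q (t # ts) = (t - q, B t) # increments B t ts"

lemma cyl_increments:
  "sorted (q # ts) \<Longrightarrow> cyl q (increments B q ts) = {\<omega>\<in>paths. \<forall>t\<in>set ts. pos Y t \<omega> \<in> B t}"
proof (induction ts arbitrary: q)
  case (Cons t ts)
  then have q: "q + (t - q) = t" by (simp add: add_diff_inverse_ennreal)
  have "cyl t (increments B t ts) = {\<omega>\<in>paths. \<forall>t\<in>set ts. pos Y t \<omega> \<in> B t}"
    by (rule Cons.IH) (use Cons.prems in auto)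
  then show ?case unfolding increments.simps cyl.simps q by auto
qed simp

lemma increments_sets: "(d, C) \<in> set (increments B q ts) \<Longrightarrow> \<exists>t\<in>set ts. C = B t"
  by (induction ts arbitrary: q) auto

definition cylinders :: "'w set set" where
  "cylinders = {{\<omega>\<in>paths. \<forall>t\<in>J. pos Y t \<omega> \<in> B t} | J B. finite J \<and> (\<forall>t\<in>J. B t \<in> sets borel_opc)}"

lemma cylinders_cyl:
  assumes "C \<in> cylinders"
  obtains l where "C = cyl 0 l" "\<And>d B. (d, B) \<in> set l \<Longrightarrow> B \<in> sets borel_opc"
proof -
  obtain J B where C: "C = {\<omega>\<in>paths. \<forall>t\<in>J. pos Y t \<omega> \<in> B t}" "finite J" "\<forall>t\<in>J. B t \<in> sets borel_opc"
    using assms by (auto simp: cylinders_def)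
  show thesis
  proof (rule that[of "increments B 0 (sorted_list_of_set J)"])
    show "C = cyl 0 (increments B 0 (sorted_list_of_set J))"
      using C(2) by (subst cyl_increments) (simp_all add: C(1))
  qed (use C increments_sets in fastforce)
qed

lemma Int_stable_cylinders: "Int_stable cylinders"
proof (rule Int_stableI)
  fix C D assume "C \<in> cylinders" "D \<in> cylinders"
  then obtain J B K E where
    C: "C = {\<omega>\<in>paths. \<forall>t\<in>J. pos Y t \<omega> \<in> B t}" "finite J" "\<forall>t\<in>J. B t \<in> sets borel_opc" and
    D: "D = {\<omega>\<in>paths. \<forall>t\<in>K. pos Y t \<omega> \<in> E t}" "finite K" "\<forall>t\<in>K. E t \<in> sets borel_opc"
    unfolding cylinders_def by blast
  define H where "H = (\<lambda>t. (if t \<in> J then B t else UNIV) \<inter> (if t \<in> K then E t else UNIV))"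
  have "UNIV \<in> sets (borel_opc :: 'a option measure)" using sets.top[of borel_opc] by simp
  then have "\<forall>t\<in>J \<union> K. H t \<in> sets borel_opc"
    using C(3) D(3) by (auto simp: H_def)
  moreover have "C \<inter> D = {\<omega>\<in>paths. \<forall>t\<in>J \<union> K. pos Y t \<omega> \<in> H t}"
    unfolding C(1) D(1) H_def by auto
  ultimately show "C \<inter> D \<in> cylinders"
    unfolding cylinders_def using C(2) D(2) by (intro CollectI exI[of _ "J \<union> K"] exI[of _ H]) auto
qed

lemma cylinders_Pow: "cylinders \<subseteq> Pow paths"
  by (auto simp: cylinders_def)

lemma paths_cylinders: "paths \<in> cylinders"
  unfolding cylinders_def by (rule CollectI, rule exI[of _ "{}"]) auto

definition path_sigma :: "'w measure" where "path_sigma = sigma paths cylinders"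

lemma space_path_sigma[simp]: "space path_sigma = paths"
  by (simp add: path_sigma_def space_measure_of_conv)

lemma sets_path_sigma: "sets path_sigma = sigma_sets paths cylinders"
  by (simp add: path_sigma_def cylinders_Pow)

lemma nat_hist0_infinity: "nat_hist0 Y \<infinity> = sets path_sigma"
proof -
  let ?G = "{pos Y s -` B \<inter> paths | s B. s \<le> \<infinity> \<and> B \<in> sets borel_opc}"
  have 1: "?G \<subseteq> cylinders"
  proof (clarsimp simp: cylinders_def)
    fix s B assume "B \<in> sets (borel_opc :: 'a option measure)"
    then show "\<exists>J Ba. pos Y s -` B \<inter> paths = {\<omega>\<in>paths. \<forall>t\<in>J. pos Y t \<omega> \<in> Ba t} \<and> finite J \<and> (\<forall>t\<in>J. Ba t \<in> sets borel_opc)"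
      by (intro exI[of _ "{s}"] exI[of _ "\<lambda>_. B"]) auto
  qed
  have 2: "cylinders \<subseteq> sigma_sets paths ?G"
  proof (rule subsetI)
    fix C assume "C \<in> cylinders"
    then obtain J B where C: "C = {\<omega>\<in>paths. \<forall>t\<in>J. pos Y t \<omega> \<in> B t}" "finite J" "\<forall>t\<in>J. B t \<in> sets borel_opc"
      by (auto simp: cylinders_def)
    interpret S: sigma_algebra paths "sigma_sets paths ?G" by (rule sigma_algebra_sigma_sets) auto
    have "{\<omega>\<in>paths. \<forall>t\<in>J. pos Y t \<omega> \<in> B t} \<in> sigma_sets paths ?G"
    proof (rule S.sets_Collect_finite_All[OF _ C(2)])
      fix t assume "t \<in> J"
      then have "B t \<in> sets borel_opc" using C(3) by simp
      then have "pos Y t -` B t \<inter> paths \<in> ?G"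
        by (intro CollectI, rule_tac x=t in exI, rule_tac x="B t" in exI, intro conjI refl) simp
      then show "{\<omega>\<in>paths. pos Y t \<omega> \<in> B t} \<in> sigma_sets paths ?G"
        unfolding vimage_paths by (rule sigma_sets.Basic)
    qed
    then show "C \<in> sigma_sets paths ?G" unfolding C(1) .
  qed
  have "sigma_sets paths ?G = sigma_sets paths cylinders"
    by (rule antisym, rule sigma_sets_mono', rule 1, rule sigma_sets_mono, rule 2)
  then show ?thesis unfolding nat_hist0_def sets_path_sigma .
qed

lemma sets_path_sigma_subset: "sets path_sigma \<subseteq> sets (events Y)"
  unfolding sets_path_sigma
proof (rule sets.sigma_sets_subset, rule subsetI)
  fix C assume "C \<in> cylinders"
  then obtain J B where C: "C = {\<omega>\<in>paths. \<forall>t\<in>J. pos Y t \<omega> \<in> B t}" "finite J" "\<forall>t\<in>J. B t \<in> sets borel_opc"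
    by (auto simp: cylinders_def)
  show "C \<in> sets (events Y)" unfolding C(1)
  proof (rule sets.sets_Collect_finite_All[OF _ C(2)])
    fix t assume "t \<in> J"
    then have "pos Y t -` B t \<inter> paths \<in> sets (events Y)" using C(3) by (intro measurable_sets[OF pos_events]) auto
    then show "{\<omega>\<in>paths. pos Y t \<omega> \<in> B t} \<in> sets (events Y)" by (simp only: vimage_paths)
  qed
qed

text \<open>On all of \<open>events Y\<close> the law depends on the starting point only in a
  universally measurable way. Restricted to \<open>path_sigma\<close> the dependence is Borel, so
  that the monadic bind of measures is available.\<close>

definition path_law :: "'a option \<Rightarrow> 'w measure" where
  "path_law y = distr (law Y y) path_sigma (\<lambda>\<omega>. \<omega>)"

lemma ident_path_sigma[measurable]: "(\<lambda>\<omega>. \<omega>) \<in> law Y x \<rightarrow>\<^sub>M path_sigma"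
  using sets_path_sigma_subset sets_law[of x] sets.sets_into_space[of _ path_sigma]
  by (auto simp: measurable_def Int_absorb2)

lemma emeasure_path_law: "N \<in> sets path_sigma \<Longrightarrow> emeasure (path_law y) N = emeasure (law Y y) N"
  using sets.sets_into_space[of N path_sigma] by (simp add: path_law_def emeasure_distr Int_absorb2)

text \<open>Cylinders form an intersection-stable generator, and on them the law is the Borel
  function \<open>cyl_prob\<close>.\<close>

lemma path_law_measurable[measurable]: "path_law \<in> borel_opc \<rightarrow>\<^sub>M subprob_algebra path_sigma"
proof (rule measurable_prob_algebraD, rule measurable_prob_algebra_generated[OF sets_path_sigma Int_stable_cylinders cylinders_Pow])
  show "prob_space (path_law y)" for y
    unfolding path_law_def by (intro prob_space.prob_space_distr prob_law) simp
  show "sets (path_law y) = sets path_sigma" for y by (simp add: path_law_def)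
  fix C assume C: "C \<in> cylinders"
  then have "C \<in> sets path_sigma" by (simp add: sets_path_sigma sigma_sets.Basic)
  moreover obtain l where "C = cyl 0 l" "\<And>d B. (d, B) \<in> set l \<Longrightarrow> B \<in> sets borel_opc"
    using cylinders_cyl[OF C] by blast
  ultimately show "(\<lambda>y. emeasure (path_law y) C) \<in> borel_measurable borel_opc"
    using cyl_prob_measurable[of l] cyl_law[of l] by (simp add: emeasure_path_law)
qed

lemma shift_path_sigma[measurable]: "shift Y q \<in> events Y \<rightarrow>\<^sub>M path_sigma"
  unfolding path_sigma_def
proof (rule measurable_sigma_sets[OF _ cylinders_Pow])
  show "sets (sigma paths cylinders) = sigma_sets paths cylinders" by (simp add: cylinders_Pow)
  fix C assume "C \<in> cylinders"
  then obtain J B where C: "C = {\<omega>\<in>paths. \<forall>t\<in>J. pos Y t \<omega> \<in> B t}" "finite J" "\<forall>t\<in>J. B t \<in> sets borel_opc"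
    by (auto simp: cylinders_def)
  have "shift Y q -` C \<inter> paths = {\<omega>\<in>paths. \<forall>t\<in>J. pos Y (t + q) \<omega> \<in> B t}"
    by (auto simp: C(1) pos_shift shift_paths)
  also have "\<dots> \<in> sets (events Y)"
  proof (rule sets.sets_Collect_finite_All[OF _ C(2)])
    fix t assume "t \<in> J"
    then have "pos Y (t + q) -` B t \<inter> paths \<in> sets (events Y)" using C(3) by (intro measurable_sets[OF pos_events]) auto
    then show "{\<omega>\<in>paths. pos Y (t + q) \<omega> \<in> B t} \<in> sets (events Y)" by (simp only: vimage_paths)
  qed
  finally show "shift Y q -` C \<inter> paths \<in> sets (events Y)" .
qed (auto simp: shift_paths)

lemma shift_path_sigma_law[measurable]: "shift Y q \<in> law Y x \<rightarrow>\<^sub>M path_sigma"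
  by (simp add: measurable_law)

text \<open>Two finite measures on \<open>path_sigma\<close> that agree on cylinders coincide. By
  \<open>shift_vimage_cyl\<close> a translated cylinder is a cylinder with base time
  \<open>q\<close>, for which \<open>cyl_markov\<close> evaluates the left side and
  \<open>cyl_law\<close> identifies the kernel on the right side.\<close>

lemma markov_shift:
  assumes \<Lambda>: "\<Lambda> \<in> sets (hist Y q)"
  shows "distr (density (law Y x) (indicator \<Lambda>)) path_sigma (shift Y q)
       = distr (density (law Y x) (indicator \<Lambda>)) borel_opc (pos Y q) \<bind> path_law"
    (is "distr ?D _ _ = ?Q \<bind> _")
proof (rule measure_eqI_generator_eq[OF Int_stable_cylinders cylinders_Pow])
  have [measurable]: "\<Lambda> \<in> sets (law Y x)" by (rule indicator_hist_law[OF \<Lambda>])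
  have E: "emeasure (distr ?D path_sigma (shift Y q)) C = emeasure (law Y x) (\<Lambda> \<inter> (shift Y q -` C \<inter> paths))"
    if C[measurable]: "C \<in> sets path_sigma" for C
  proof -
    have S: "shift Y q -` C \<inter> paths \<in> sets (law Y x)"
      using measurable_sets[OF shift_path_sigma_law[of q x] C] by simp
    then show ?thesis
      by (simp add: emeasure_distr emeasure_density_indicator)
  qed
  show "sets (distr ?D path_sigma (shift Y q)) = sigma_sets paths cylinders"
    by (simp add: sets_path_sigma)
  show "sets (?Q \<bind> path_law) = sigma_sets paths cylinders"
    by (subst sets_bind[of _ _ path_sigma]) (simp_all add: path_law_def sets_path_sigma)
  fix C assume C: "C \<in> cylinders"
  then have Cs[measurable]: "C \<in> sets path_sigma" by (simp add: sets_path_sigma sigma_sets.Basic)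
  obtain l where l: "C = cyl 0 l" "\<And>d B. (d, B) \<in> set l \<Longrightarrow> B \<in> sets borel_opc"
    using cylinders_cyl[OF C] by blast
  have [measurable]: "cyl_prob l \<in> borel_measurable borel_opc" by (rule cyl_prob_measurable[OF l(2)])
  have "emeasure (distr ?D path_sigma (shift Y q)) C = emeasure (law Y x) (\<Lambda> \<inter> cyl q l)"
    unfolding E[OF Cs] unfolding l(1) shift_vimage_cyl by simp
  also have "\<dots> = (\<integral>\<^sup>+\<omega>. indicator \<Lambda> \<omega> * cyl_prob l (pos Y q \<omega>) \<partial>law Y x)"
    by (rule cyl_markov[OF l(2) \<Lambda>])
  also have "\<dots> = (\<integral>\<^sup>+y. emeasure (path_law y) C \<partial>?Q)"
  proof -
    have "(\<lambda>y. emeasure (path_law y) C) = cyl_prob l"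
    proof (rule ext)
      fix y
      have "emeasure (path_law y) C = emeasure (law Y y) (cyl 0 l)"
        using emeasure_path_law[OF Cs, of y] l(1) by simp
      also have "\<dots> = cyl_prob l y" by (rule cyl_law[OF l(2)])
      finally show "emeasure (path_law y) C = cyl_prob l y" .
    qed
    then show ?thesis by (simp add: nn_integral_distr nn_integral_density)
  qed
  also have "\<dots> = emeasure (?Q \<bind> path_law) C"
    by (rule emeasure_bind[symmetric, of _ _ path_sigma]) auto
  finally show "emeasure (distr ?D path_sigma (shift Y q)) C = emeasure (?Q \<bind> path_law) C" .
next
  have "emeasure (distr (density (law Y x) (indicator \<Lambda>)) path_sigma (shift Y q)) paths \<le> 1"
  proof -
    have m: "\<Lambda> \<in> sets (law Y x)" by (rule indicator_hist_law[OF \<Lambda>])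
    have p: "paths \<in> sets path_sigma" using sets.top[of path_sigma] by simp
    have "shift Y q -` paths \<inter> paths = paths" by (auto simp: shift_paths)
    then have "emeasure (distr (density (law Y x) (indicator \<Lambda>)) path_sigma (shift Y q)) paths
        = emeasure (density (law Y x) (indicator \<Lambda>)) (space (density (law Y x) (indicator \<Lambda>)))"
      using p by (subst emeasure_distr) auto
    also have "\<dots> = (\<integral>\<^sup>+\<omega>. indicator \<Lambda> \<omega> * indicator paths \<omega> \<partial>law Y x)"
      using m sets.top[of "law Y x"] by (subst emeasure_density) auto
    also have "\<dots> \<le> (\<integral>\<^sup>+\<omega>. 1 \<partial>law Y x)" by (rule nn_integral_mono) (auto simp: indicator_def)
    also have "\<dots> = 1" using prob_space.emeasure_space_1[OF prob_law[of x]] by simp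
    finally show ?thesis .
  qed
  then show "emeasure (distr (density (law Y x) (indicator \<Lambda>)) path_sigma (shift Y q)) paths \<noteq> \<infinity>"
    by (auto simp: top_unique)
qed (use paths_cylinders in auto)

lemma law_nn_integral_measurable:
  assumes F: "F \<in> borel_measurable path_sigma"
  shows "(\<lambda>y. \<integral>\<^sup>+\<omega>. F \<omega> \<partial>law Y y) \<in> borel_measurable borel_opc"
proof -
  have "(\<lambda>y. \<integral>\<^sup>+\<omega>. F \<omega> \<partial>path_law y) \<in> borel_measurable borel_opc"
    by (rule measurable_compose[OF path_law_measurable nn_integral_measurable_subprob_algebra[OF F]])
  moreover have "(\<integral>\<^sup>+\<omega>. F \<omega> \<partial>path_law y) = (\<integral>\<^sup>+\<omega>. F \<omega> \<partial>law Y y)" for y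
    using F by (simp add: path_law_def nn_integral_distr)
  ultimately show ?thesis by simp
qed

lemma markov_shift_nn_integral:
  assumes \<Lambda>: "\<Lambda> \<in> sets (hist Y q)" and F[measurable]: "F \<in> borel_measurable path_sigma"
  shows "(\<integral>\<^sup>+\<omega>. indicator \<Lambda> \<omega> * F (shift Y q \<omega>) \<partial>law Y x)
     = (\<integral>\<^sup>+\<omega>. indicator \<Lambda> \<omega> * (\<integral>\<^sup>+\<omega>'. F \<omega>' \<partial>law Y (pos Y q \<omega>)) \<partial>law Y x)"
proof -
  have [measurable]: "\<Lambda> \<in> sets (law Y x)" by (rule indicator_hist_law[OF \<Lambda>])
  have "(\<integral>\<^sup>+\<omega>. F \<omega> \<partial>distr (density (law Y x) (indicator \<Lambda>)) path_sigma (shift Y q))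
     = (\<integral>\<^sup>+y. \<integral>\<^sup>+\<omega>'. F \<omega>' \<partial>path_law y \<partial>distr (density (law Y x) (indicator \<Lambda>)) borel_opc (pos Y q))"
    unfolding markov_shift[OF \<Lambda>] by (rule nn_integral_bind[OF F]) simp
  moreover have "(\<integral>\<^sup>+\<omega>'. F \<omega>' \<partial>path_law y) = (\<integral>\<^sup>+\<omega>'. F \<omega>' \<partial>law Y y)" for y
    by (simp add: path_law_def nn_integral_distr)
  moreover have [measurable]: "(\<lambda>y. \<integral>\<^sup>+\<omega>'. F \<omega>' \<partial>law Y y) \<in> borel_measurable borel_opc"
    by (rule law_nn_integral_measurable[OF F])
  ultimately show ?thesis by (simp add: nn_integral_distr nn_integral_density)
qed

section \<open>Null sets and completed histories\<close>

text \<open>A set that is null from every starting point is null for every initial law, so the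
  completeness of \<open>events Y\<close> applies to each of its subsets.\<close>

lemma polar_subset_events:
  assumes Z: "Z \<in> sets (events Y)" "\<And>y. emeasure (law Y y) Z = 0" and E: "E \<subseteq> Z"
  shows "E \<in> sets (events Y)"
proof -
  have "E \<in> completion_in Y (sets (events Y)) (sets (events Y))"
    unfolding completion_in_def
  proof (intro CollectI conjI ballI)
    show "E \<subseteq> paths" using sets.sets_into_space[OF Z(1)] E by simp
    fix \<nu> :: "'a option measure"
    have "init_prob Y \<nu> Z = 0" by (simp add: init_prob_def Z(2))
    then show "\<exists>\<Lambda>\<in>sets (events Y). \<exists>N\<in>sets (events Y). sym_diff E \<Lambda> \<subseteq> N \<and> init_prob Y \<nu> N = 0"
      using Z(1) E by (intro bexI[of _ "{}"] bexI[of _ Z]) auto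
  qed
  moreover have "sets (events Y) = completion_in Y (sets (events Y)) (sets (events Y))"
    using std by (simp add: standard_process_def)
  ultimately show ?thesis by simp
qed

text \<open>This supplies measurability of expressions that are only known to agree with a
  measurable one off such a set, such as the path integral inside
  \<open>tc_resolvent\<close>.\<close>

lemma polar_modification_measurable:
  fixes f g :: "'w \<Rightarrow> real"
  assumes Z: "Z \<in> sets (events Y)" "\<And>y. emeasure (law Y y) Z = 0"
    and g: "g \<in> borel_measurable (events Y)" and eq: "\<And>\<omega>. \<omega> \<in> paths \<Longrightarrow> \<omega> \<notin> Z \<Longrightarrow> f \<omega> = g \<omega>"
  shows "f \<in> borel_measurable (events Y)"
proof (rule measurableI)
  fix B :: "real set" assume B: "B \<in> sets borel"
  have "f -` B \<inter> paths = ((g -` B \<inter> paths) - Z) \<union> (f -` B \<inter> paths \<inter> Z)"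
    using eq by auto
  also have "\<dots> \<in> sets (events Y)"
    by (intro sets.Un sets.Diff measurable_sets[OF g B] Z(1) polar_subset_events[OF Z]) auto
  finally show "f -` B \<inter> paths \<in> sets (events Y)" .
qed simp

lemma nat_hist0_mono: "s \<le> t \<Longrightarrow> nat_hist0 Y s \<subseteq> nat_hist0 Y t"
  unfolding nat_hist0_def by (rule sigma_sets_mono') (auto intro: order_trans)

lemma nat_hist0_subset: "nat_hist0 Y t \<subseteq> sets (hist Y t)"
proof -
  have "{pos Y s -` B \<inter> paths | s B. s \<le> t \<and> B \<in> sets borel_opc} \<subseteq> sets (hist Y t)"
  proof (rule subsetI, elim CollectE exE conjE)
    fix C s B assume C: "C = pos Y s -` B \<inter> paths" "s \<le> t" "B \<in> sets (borel_opc :: 'a option measure)"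
    have "C \<in> sets (hist Y s)" using measurable_sets[OF pos_hist C(3), of s] by (simp add: C(1))
    then show "C \<in> sets (hist Y t)" using sets_hist_mono[OF C(2)] by blast
  qed
  from sets.sigma_sets_subset[OF this] show ?thesis by (simp add: nat_hist0_def)
qed

lemma completion_in_mono:
  assumes "N \<subseteq> N'" "G \<subseteq> G'"
  shows "completion_in Y N G \<subseteq> completion_in Y N' G'"
proof
  fix E assume E: "E \<in> completion_in Y N G"
  show "E \<in> completion_in Y N' G'" unfolding completion_in_def
  proof (intro CollectI conjI ballI)
    show "E \<subseteq> paths" using E by (simp add: completion_in_def)
    fix \<nu> :: "'a option measure" assume "\<nu> \<in> init_laws"
    then obtain L M where "L \<in> G" "M \<in> N" "sym_diff E L \<subseteq> M \<and> init_prob Y \<nu> M = 0"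
      using E unfolding completion_in_def mem_Collect_eq by meson
    with assms show "\<exists>L\<in>G'. \<exists>M\<in>N'. sym_diff E L \<subseteq> M \<and> init_prob Y \<nu> M = 0" by blast
  qed
qed

lemma completion_in_Pow: "completion_in Y N G \<subseteq> Pow paths"
  by (auto simp: completion_in_def)

lemma space_nat_hist[simp]: "space (nat_hist Y t) = paths"
  by (simp add: nat_hist_def space_measure_of_conv)

lemma sets_nat_hist: "sets (nat_hist Y t) = sigma_sets paths (completion_in Y (nat_hist0 Y \<infinity>) (nat_hist0 Y t))"
  unfolding nat_hist_def by (rule sets_measure_of[OF completion_in_Pow])

lemma nat_hist_mono: "s \<le> t \<Longrightarrow> sets (nat_hist Y s) \<subseteq> sets (nat_hist Y t)"
  unfolding sets_nat_hist by (intro sigma_sets_mono' completion_in_mono nat_hist0_mono) auto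

text \<open>The uncompleted natural history lies in \<open>hist Y t\<close>, which is already
  complete with respect to the larger class of null sets from \<open>events Y\<close>. Thus the
  Markov property given for \<open>hist Y\<close> applies to events built from the additive
  functional.\<close>

lemma nat_hist_subset_hist: "sets (nat_hist Y t) \<subseteq> sets (hist Y t)"
proof -
  have "completion_in Y (nat_hist0 Y \<infinity>) (nat_hist0 Y t) \<subseteq> completion_in Y (sets (events Y)) (sets (hist Y t))"
    by (intro completion_in_mono nat_hist0_subset, unfold nat_hist0_infinity, rule sets_path_sigma_subset)
  also have "\<dots> = sets (hist Y t)" using std unfolding standard_process_def by blast
  finally have "completion_in Y (nat_hist0 Y \<infinity>) (nat_hist0 Y t) \<subseteq> sets (hist Y t)" .
  from sets.sigma_sets_subset[OF this] show ?thesis by (simp add: sets_nat_hist)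
qed

lemma path_sigma_subset_nat_hist: "sets path_sigma \<subseteq> sets (nat_hist Y \<infinity>)"
proof
  fix C assume C: "C \<in> sets path_sigma"
  have "C \<in> completion_in Y (nat_hist0 Y \<infinity>) (nat_hist0 Y \<infinity>)"
    unfolding completion_in_def nat_hist0_infinity
  proof (intro CollectI conjI ballI)
    show "C \<subseteq> paths" using sets.sets_into_space[OF C] by simp
    fix \<nu> :: "'a option measure"
    show "\<exists>\<Lambda>\<in>sets path_sigma. \<exists>N\<in>sets path_sigma. sym_diff C \<Lambda> \<subseteq> N \<and> init_prob Y \<nu> N = 0"
      using C by (intro bexI[of _ C] bexI[of _ "{}"]) (auto simp: init_prob_def)
  qed
  then show "C \<in> sets (nat_hist Y \<infinity>)" unfolding sets_nat_hist by (rule sigma_sets.Basic)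
qed

lemma nat_hist_subset_events: "sets (nat_hist Y t) \<subseteq> sets (events Y)"
  using nat_hist_subset_hist sets_hist_subset by blast

lemma nat_hist_measurable_events: "F \<in> nat_hist Y t \<rightarrow>\<^sub>M N \<Longrightarrow> F \<in> events Y \<rightarrow>\<^sub>M N"
  by (rule measurable_mono_sigma[OF _ _ nat_hist_subset_events]) simp_all

lemma pos_nat_hist: "pos Y s \<in> nat_hist Y \<infinity> \<rightarrow>\<^sub>M borel_opc"
proof (rule measurable_mono_sigma[OF _ _ path_sigma_subset_nat_hist])
  show "pos Y s \<in> path_sigma \<rightarrow>\<^sub>M borel_opc"
  proof (rule measurableI)
    fix B assume B: "B \<in> sets (borel_opc :: 'a option measure)"
    have "{\<omega>\<in>paths. \<forall>t\<in>{s}. pos Y t \<omega> \<in> B} \<in> cylinders"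
      unfolding cylinders_def by (rule CollectI, rule exI[of _ "{s}"], rule exI[of _ "\<lambda>_. B"]) (use B in simp)
    then show "pos Y s -` B \<inter> space path_sigma \<in> sets path_sigma"
      by (simp add: sets_path_sigma vimage_paths sigma_sets.Basic)
  qed simp
qed simp

text \<open>Apply the Markov property at time \<open>q\<close> to the indicator of \<open>N\<close>:
  starting afresh from the law of the position at \<open>q\<close> has the same effect on
  \<open>N\<close> as translating the path by \<open>q\<close>.\<close>

lemma init_prob_distr_pos:
  assumes N[measurable]: "N \<in> sets path_sigma"
  shows "init_prob Y (distr (law Y x) borel_opc (pos Y q)) N = emeasure (distr (law Y x) path_sigma (shift Y q)) N"
    and "(\<integral>\<^sup>+\<omega>. emeasure (law Y (pos Y q \<omega>)) N \<partial>law Y x) = emeasure (distr (law Y x) path_sigma (shift Y q)) N"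
    and "(\<lambda>\<omega>. emeasure (law Y (pos Y q \<omega>)) N) \<in> borel_measurable (law Y x)"
proof -
  have NE: "N \<in> sets (law Y y)" for y using N sets_path_sigma_subset sets_law by blast
  have [measurable]: "(\<lambda>y. emeasure (law Y y) N) \<in> borel_measurable borel_opc"
    using law_nn_integral_measurable[of "indicator N"] NE by simp
  show "(\<lambda>\<omega>. emeasure (law Y (pos Y q \<omega>)) N) \<in> borel_measurable (law Y x)" by measurable
  have top: "paths \<in> sets (hist Y q)" using sets.top[of "hist Y q"] by simp
  have "(\<integral>\<^sup>+\<omega>. emeasure (law Y (pos Y q \<omega>)) N \<partial>law Y x) = (\<integral>\<^sup>+\<omega>. indicator paths \<omega> * (\<integral>\<^sup>+\<omega>'. indicator N \<omega>' \<partial>law Y (pos Y q \<omega>)) \<partial>law Y x)"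
    by (rule nn_integral_cong) (simp add: NE)
  also have "\<dots> = (\<integral>\<^sup>+\<omega>. indicator paths \<omega> * indicator N (shift Y q \<omega>) \<partial>law Y x)"
    by (rule markov_shift_nn_integral[OF top, symmetric]) simp
  also have "\<dots> = (\<integral>\<^sup>+\<omega>. indicator N (shift Y q \<omega>) \<partial>law Y x)"
    by (rule nn_integral_cong) simp
  also have "\<dots> = (\<integral>\<^sup>+\<omega>. indicator N \<omega> \<partial>distr (law Y x) path_sigma (shift Y q))"
    by (rule nn_integral_distr[symmetric]) simp_all
  finally show 1: "(\<integral>\<^sup>+\<omega>. emeasure (law Y (pos Y q \<omega>)) N \<partial>law Y x) = emeasure (distr (law Y x) path_sigma (shift Y q)) N"
    by simp
  show "init_prob Y (distr (law Y x) borel_opc (pos Y q)) N = emeasure (distr (law Y x) path_sigma (shift Y q)) N"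
    unfolding init_prob_def 1[symmetric] by (subst nn_integral_completion) (simp add: nn_integral_distr)
qed

text \<open>A functional that is measurable only for the completed history is replaced by one measurable
  for \<open>\<F>\<^sup>0\<close>, off a set that is null for the law of the shifted path started from \<open>P\<^sub>x\<close>.\<close>

lemma markov_nat_hist:
  fixes F :: "'w \<Rightarrow> ennreal"
  assumes \<Lambda>: "\<Lambda> \<in> sets (hist Y q)" and F: "F \<in> borel_measurable (nat_hist Y \<infinity>)"
  shows "(\<integral>\<^sup>+\<omega>. indicator \<Lambda> \<omega> * F (shift Y q \<omega>) \<partial>law Y x)
     = (\<integral>\<^sup>+\<omega>. indicator \<Lambda> \<omega> * (\<integral>\<^sup>+\<omega>'. F \<omega>' \<partial>law Y (pos Y q \<omega>)) \<partial>law Y x)"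
proof -
  \<comment> \<open>The completion behind \<open>nat_hist\<close> refers to all initial laws. The
    law of the position at time \<open>q\<close> is the one needed, because its null sets in
    \<open>path_sigma\<close> are those of the law \<open>Q\<close> of the translated path.\<close>
  define \<nu> where "\<nu> = distr (law Y x) borel_opc (pos Y q)"
  define Q where "Q = distr (law Y x) path_sigma (shift Y q)"
  have spQ[simp]: "space Q = paths" "sets Q = sets path_sigma" by (simp_all add: Q_def)
  have \<nu>: "\<nu> \<in> init_laws"
    unfolding init_laws_def \<nu>_def by (simp add: prob_space.prob_space_distr prob_law)
  have "completion_in Y (nat_hist0 Y \<infinity>) (nat_hist0 Y \<infinity>) \<subseteq> sets (completion Q)"
  proof
    fix \<Gamma> assume \<Gamma>: "\<Gamma> \<in> completion_in Y (nat_hist0 Y \<infinity>) (nat_hist0 Y \<infinity>)"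
    then have "\<exists>\<Lambda>\<in>sets path_sigma. \<exists>N\<in>sets path_sigma. sym_diff \<Gamma> \<Lambda> \<subseteq> N \<and> init_prob Y \<nu> N = 0"
      using \<nu> unfolding completion_in_def nat_hist0_infinity by blast
    then obtain L N where LN: "L \<in> sets path_sigma" "N \<in> sets path_sigma" "sym_diff \<Gamma> L \<subseteq> N" "init_prob Y \<nu> N = 0"
      by blast
    have "N \<in> null_sets Q"
      using LN(4) init_prob_distr_pos(1)[OF LN(2), where q=q and x=x] LN(2) by (simp add: null_sets_def \<nu>_def Q_def)
    then show "\<Gamma> \<in> sets (completion Q)"
      by (rule sets_completionI[of _ "L - N" "\<Gamma> \<inter> N", rotated 2]) (use LN in auto)
  qed
  then have "sets (nat_hist Y \<infinity>) \<subseteq> sets (completion Q)"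
    unfolding sets_nat_hist using sets.sigma_sets_subset[of _ "completion Q"] by simp
  then have "F \<in> borel_measurable (completion Q)"
    by (rule measurable_mono_sigma[OF F, rotated]) simp
  then obtain F0 where F0: "F0 \<in> borel_measurable Q" "AE \<omega> in Q. F \<omega> = F0 \<omega>"
    using completion_ex_borel_measurable by blast
  have F0m[measurable]: "F0 \<in> borel_measurable path_sigma" using F0(1) by (simp add: Q_def)
  obtain N where N: "{\<omega>\<in>space Q. F \<omega> \<noteq> F0 \<omega>} \<subseteq> N" "emeasure Q N = 0" "N \<in> sets Q"
    by (rule AE_E[OF F0(2)])
  have Nm[measurable]: "N \<in> sets path_sigma" using N(3) by simp
  have "(\<integral>\<^sup>+\<omega>. emeasure (law Y (pos Y q \<omega>)) N \<partial>law Y x) = 0"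
    using N(2) init_prob_distr_pos(2)[OF Nm, where q=q and x=x] by (simp add: Q_def)
  \<comment> \<open>The same \<open>N\<close> must be negligible in the inner expectation. The mean
    of its probability over the position at time \<open>q\<close> is \<open>emeasure Q N\<close>,
    which is 0, so it is null for almost every starting point occurring there.\<close>
  then have AE1: "AE \<omega> in law Y x. emeasure (law Y (pos Y q \<omega>)) N = 0"
    using nn_integral_0_iff_AE[OF init_prob_distr_pos(3)[OF Nm, where q=q and x=x]] by simp
  have "AE \<omega> in Q. \<omega> \<notin> N" using N(2,3) by (intro AE_not_in) (auto simp: null_sets_def)
  then have AE2: "AE \<omega> in law Y x. shift Y q \<omega> \<notin> N"
    unfolding Q_def by (rule AE_distrD[rotated]) simp
  have "(\<integral>\<^sup>+\<omega>. indicator \<Lambda> \<omega> * F (shift Y q \<omega>) \<partial>law Y x) = (\<integral>\<^sup>+\<omega>. indicator \<Lambda> \<omega> * F0 (shift Y q \<omega>) \<partial>law Y x)"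
  proof (rule nn_integral_cong_AE, use AE2 AE_space in eventually_elim)
    case (elim \<omega>)
    then show ?case using N(1) shift_paths[of \<omega> q] by auto
  qed
  also have "\<dots> = (\<integral>\<^sup>+\<omega>. indicator \<Lambda> \<omega> * (\<integral>\<^sup>+\<omega>'. F0 \<omega>' \<partial>law Y (pos Y q \<omega>)) \<partial>law Y x)"
    by (rule markov_shift_nn_integral[OF \<Lambda> F0m])
  also have "\<dots> = (\<integral>\<^sup>+\<omega>. indicator \<Lambda> \<omega> * (\<integral>\<^sup>+\<omega>'. F \<omega>' \<partial>law Y (pos Y q \<omega>)) \<partial>law Y x)"
  proof (rule nn_integral_cong_AE, use AE1 in eventually_elim)
    case (elim \<omega>)
    have "N \<in> sets (law Y (pos Y q \<omega>))" using Nm sets_path_sigma_subset sets_law by blast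
    with elim have AE3: "AE \<omega>' in law Y (pos Y q \<omega>). \<omega>' \<notin> N" by (intro AE_not_in) (auto simp: null_sets_def)
    have "(\<integral>\<^sup>+\<omega>'. F0 \<omega>' \<partial>law Y (pos Y q \<omega>)) = (\<integral>\<^sup>+\<omega>'. F \<omega>' \<partial>law Y (pos Y q \<omega>))"
      by (rule nn_integral_cong_AE, use AE3 AE_space in eventually_elim) (use N(1) in auto)
    then show ?case by simp
  qed
  finally show ?thesis .
qed

text \<open>The hypothesis on \<open>G\<close> avoids a measurability statement about the translation operators.\<close>

lemma markov_bounded:
  fixes F G :: "'w \<Rightarrow> real"
  assumes \<Lambda>: "\<Lambda> \<in> sets (hist Y q)" and F: "F \<in> borel_measurable (nat_hist Y \<infinity>)"
    and B: "\<And>\<omega>. \<bar>F \<omega>\<bar> \<le> B"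
    and G: "G \<in> borel_measurable (law Y x)" "AE \<omega> in law Y x. \<omega> \<in> \<Lambda> \<longrightarrow> F (shift Y q \<omega>) = G \<omega>"
    and h: "h \<in> borel_measurable borel_opc" "\<And>y. (\<integral>\<omega>. F \<omega> \<partial>law Y y) = h y"
  shows "(\<integral>\<omega>. indicator \<Lambda> \<omega> * G \<omega> \<partial>law Y x) = (\<integral>\<omega>. indicator \<Lambda> \<omega> * h (pos Y q \<omega>) \<partial>law Y x)"
proof -
  have [measurable]: "\<Lambda> \<in> sets (law Y x)" by (rule indicator_hist_law[OF \<Lambda>])
  note [measurable] = F G(1) h(1)
  have Fl[measurable]: "F \<in> borel_measurable (law Y y)" for y
    using nat_hist_measurable_events[OF F] by (simp add: measurable_law)
  have Fint: "integrable (law Y y) F" for y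
  proof -
    interpret prob_space "law Y y" by (rule prob_law)
    show ?thesis by (rule integrable_const_bound[of _ B]) (use B in auto)
  qed
  have hB: "\<bar>h y\<bar> \<le> B" for y
  proof -
    interpret prob_space "law Y y" by (rule prob_law)
    have "\<bar>\<integral>\<omega>. F \<omega> \<partial>law Y y\<bar> \<le> (\<integral>\<omega>. B \<partial>law Y y)"
      by (rule integral_abs_bound[THEN order_trans], rule integral_mono) (use Fint B in auto)
    then show ?thesis using prob_space by (simp add: h(2))
  qed
  interpret prob_space "law Y x" by (rule prob_law)
  have GB: "AE \<omega> in law Y x. \<omega> \<in> \<Lambda> \<longrightarrow> \<bar>G \<omega>\<bar> \<le> B"
    using G(2)
  proof eventually_elim
    case (elim \<omega>)
    then show ?case using B[of "shift Y q \<omega>"] by auto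
  qed
  have iG: "integrable (law Y x) (\<lambda>\<omega>. indicator \<Lambda> \<omega> * G \<omega>)"
    by (rule integrable_const_bound[of _ "max 0 B"], use GB in eventually_elim) (auto simp: indicator_def)
  have ih: "integrable (law Y x) (\<lambda>\<omega>. indicator \<Lambda> \<omega> * h (pos Y q \<omega>))"
    by (rule integrable_const_bound[of _ "max 0 B"]) (use hB in \<open>auto simp: indicator_def le_max_iff_disj\<close>)
  have iB: "integrable (law Y x) (\<lambda>\<omega>. indicator \<Lambda> \<omega> * B)"
    by (rule integrable_const_bound[of _ "\<bar>B\<bar>"]) (auto simp: indicator_def)
  \<comment> \<open>Adding \<open>B\<close> makes the functional nonnegative, so that
    \<open>markov_nat_hist\<close> applies; the added term is \<open>B\<close> times the indicator
    of \<Lambda> on both sides and cancels at the end.\<close>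
  have F1: "(\<lambda>\<omega>. ennreal (F \<omega> + B)) \<in> borel_measurable (nat_hist Y \<infinity>)" by measurable
  have "(\<integral>\<^sup>+\<omega>. ennreal (indicator \<Lambda> \<omega> * G \<omega> + indicator \<Lambda> \<omega> * B) \<partial>law Y x)
      = (\<integral>\<^sup>+\<omega>. indicator \<Lambda> \<omega> * ennreal (F (shift Y q \<omega>) + B) \<partial>law Y x)"
    by (rule nn_integral_cong_AE, use G(2) in eventually_elim) (auto simp: indicator_def)
  also have "\<dots> = (\<integral>\<^sup>+\<omega>. indicator \<Lambda> \<omega> * (\<integral>\<^sup>+\<omega>'. ennreal (F \<omega>' + B) \<partial>law Y (pos Y q \<omega>)) \<partial>law Y x)"
    by (rule markov_nat_hist[OF \<Lambda> F1])
  also have "\<dots> = (\<integral>\<^sup>+\<omega>. ennreal (indicator \<Lambda> \<omega> * h (pos Y q \<omega>) + indicator \<Lambda> \<omega> * B) \<partial>law Y x)"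
  proof (rule nn_integral_cong)
    fix \<omega>
    interpret P: prob_space "law Y (pos Y q \<omega>)" by (rule prob_law)
    have "(\<integral>\<^sup>+\<omega>'. ennreal (F \<omega>' + B) \<partial>law Y (pos Y q \<omega>)) = ennreal (\<integral>\<omega>'. F \<omega>' + B \<partial>law Y (pos Y q \<omega>))"
    proof (rule nn_integral_eq_integral)
      show "AE \<omega>' in law Y (pos Y q \<omega>). 0 \<le> F \<omega>' + B"
      proof (rule AE_I2)
        fix \<omega>' show "0 \<le> F \<omega>' + B" using B[of \<omega>'] by linarith
      qed
    qed (use Fint in simp)
    also have "\<dots> = ennreal (h (pos Y q \<omega>) + B)"
      using Fint P.prob_space by (simp add: h(2))
    finally show "indicator \<Lambda> \<omega> * (\<integral>\<^sup>+\<omega>'. ennreal (F \<omega>' + B) \<partial>law Y (pos Y q \<omega>))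
        = ennreal (indicator \<Lambda> \<omega> * h (pos Y q \<omega>) + indicator \<Lambda> \<omega> * B)"
      by (auto simp: indicator_def)
  qed
  finally have eq: "(\<integral>\<^sup>+\<omega>. ennreal (indicator \<Lambda> \<omega> * G \<omega> + indicator \<Lambda> \<omega> * B) \<partial>law Y x)
      = (\<integral>\<^sup>+\<omega>. ennreal (indicator \<Lambda> \<omega> * h (pos Y q \<omega>) + indicator \<Lambda> \<omega> * B) \<partial>law Y x)" .
  have "(\<integral>\<omega>. indicator \<Lambda> \<omega> * G \<omega> + indicator \<Lambda> \<omega> * B \<partial>law Y x)
      = (\<integral>\<omega>. indicator \<Lambda> \<omega> * h (pos Y q \<omega>) + indicator \<Lambda> \<omega> * B \<partial>law Y x)"
  proof -
    have 1: "AE \<omega> in law Y x. 0 \<le> indicator \<Lambda> \<omega> * G \<omega> + indicator \<Lambda> \<omega> * B"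
      using GB by eventually_elim (auto simp: indicator_def)
    have 2: "AE \<omega> in law Y x. 0 \<le> indicator \<Lambda> \<omega> * h (pos Y q \<omega>) + indicator \<Lambda> \<omega> * B"
    proof (rule AE_I2)
      fix \<omega> show "0 \<le> indicator \<Lambda> \<omega> * h (pos Y q \<omega>) + indicator \<Lambda> \<omega> * B"
        using hB[of "pos Y q \<omega>"] by (auto simp: indicator_def)
    qed
    show ?thesis
      by (subst (1 2) integral_eq_nn_integral) (use 1 2 eq in \<open>simp_all\<close>)
  qed
  then show ?thesis using iG ih iB by simp
qed

end


section \<open>The time-changed process\<close>

text \<open>Vanishing at infinity is exactly continuity of the extension by 0 at the added point. If
  \<open>U\<close> contains 0, the points sent outside \<open>U\<close> form a closed subset of a
  compact set, so the preimage is a neighbourhood of the cemetery.\<close>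

lemma openin_opc_ext0_vimage:
  fixes u :: "'a::topological_space \<Rightarrow>\<^sub>C real"
  assumes u: "u \<in> C0" and U: "open U"
  shows "openin opc (ext0 u -` U)"
proof (cases "0 \<in> U")
  case False
  then have "ext0 u -` U = Some ` (u -` U)" by (auto split: option.splits)
  moreover have "open (apply_bcontfun u -` U)"
    by (rule open_vimage[OF U continuous_on_apply_bcontfun])
  ultimately show ?thesis unfolding opc_def openin_Alexandroff_compactification by auto
next
  case True
  then obtain e where e: "0 < e" "ball 0 e \<subseteq> U" using U open_contains_ball by metis
  define C where "C = apply_bcontfun u -` (- U)"
  have "closed C" unfolding C_def
    by (rule closed_vimage[OF closed_Compl[OF U] continuous_on_apply_bcontfun])
  obtain K where K: "compact K" "\<And>x. x \<notin> K \<Longrightarrow> \<bar>u x\<bar> < e"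
    using u e(1) unfolding C0_def vanishing_at_infinity_def by blast
  have "C \<subseteq> K" using K(2) e(2) by (force simp: C_def dist_real_def)
  then have "C = C \<inter> K" by blast
  with compact_Int_closed[OF K(1) \<open>closed C\<close>] have "compact C" by (simp add: Int_commute)
  moreover have "ext0 u -` U = insert None (Some ` (UNIV - C))"
    using True by (auto simp: C_def split: option.splits)
  ultimately show ?thesis
    using \<open>closed C\<close> unfolding opc_def openin_Alexandroff_compactification by auto
qed

lemma ext0_measurable: "u \<in> C0 \<Longrightarrow> ext0 (apply_bcontfun u) \<in> borel_measurable borel_opc"
  by (rule borel_measurableI) (simp add: openin_opc_ext0_vimage sets_borel_opc_openin)

lemma ext0_limitin:
  assumes u: "u \<in> C0" and l: "limitin opc f l F"
  shows "((\<lambda>s. ext0 (apply_bcontfun u) (f s)) \<longlongrightarrow> ext0 (apply_bcontfun u) l) F"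
proof (rule topological_tendstoI)
  fix U :: "real set" assume U: "open U" "ext0 (apply_bcontfun u) l \<in> U"
  then have "\<forall>\<^sub>F s in F. f s \<in> ext0 (apply_bcontfun u) -` U"
    using l openin_opc_ext0_vimage[OF u U(1)] unfolding limitin_def by blast
  then show "\<forall>\<^sub>F s in F. ext0 (apply_bcontfun u) (f s) \<in> U" by simp
qed

lemma abs_ext0_le: "\<bar>ext0 (apply_bcontfun u) z\<bar> \<le> norm u"
  using norm_bounded[of u] by (auto split: option.splits)

text \<open>Right limits of paths are given over the time set [0,infinity]; this transfers them to
  real times.\<close>

lemma filterlim_ennreal_at_right:
  assumes "0 \<le> t" shows "filterlim ennreal (at_right (ennreal t)) (at_right t)"
  unfolding filterlim_at
proof
  show "\<forall>\<^sub>F s in at_right t. ennreal s \<in> {ennreal t<..} \<and> ennreal s \<noteq> ennreal t"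
    using eventually_at_right_less[of t] by eventually_elim (use assms in \<open>auto simp: ennreal_less_iff\<close>)
  show "(ennreal \<longlongrightarrow> ennreal t) (at_right t)" by (intro tendsto_ennrealI tendsto_ident_at)
qed

locale time_change = std_process Y for Y :: "('w, 'a::topological_space) process" +
  fixes A :: "real \<Rightarrow> 'w \<Rightarrow> ennreal"
  assumes pcaf: "pcaf Y A"
begin

definition is_defining_set :: "'w set \<Rightarrow> bool" where
  "is_defining_set \<Lambda> \<longleftrightarrow> \<Lambda> \<in> sets (nat_hist Y \<infinity>) \<and> (\<forall>x. emeasure (law Y (Some x)) \<Lambda> = 1) \<and>
        (\<forall>t<\<infinity>. shift Y t ` \<Lambda> \<subseteq> \<Lambda>) \<and>
        (\<forall>\<omega>\<in>\<Lambda>.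
           A 0 \<omega> = 0 \<and>
           continuous_on {0..} (\<lambda>t. A t \<omega>) \<and>
           (\<forall>t\<ge>0. ennreal t < lifetime Y \<omega> \<longrightarrow> A t \<omega> < \<infinity>) \<and>
           (\<forall>t\<ge>0. lifetime Y \<omega> \<le> ennreal t \<longrightarrow> A t \<omega> = A (enn2real (lifetime Y \<omega>)) \<omega>) \<and>
           (\<forall>s\<ge>0. \<forall>t\<ge>0. A (s + t) \<omega> = A s \<omega> + A t (shift Y (ennreal s) \<omega>)))"

definition defining_set :: "'w set" where "defining_set = (SOME \<Lambda>. is_defining_set \<Lambda>)"

lemma is_defining_set: "is_defining_set defining_set"
proof -
  have "\<exists>\<Lambda>. is_defining_set \<Lambda>"
    using conjunct2[OF pcaf[unfolded pcaf_def]] unfolding is_defining_set_def Bex_def .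
  then show ?thesis unfolding defining_set_def by (rule someI_ex)
qed

lemma A_nat_hist: "0 \<le> t \<Longrightarrow> A t \<in> borel_measurable (nat_hist Y (ennreal t))"
  using conjunct1[OF pcaf[unfolded pcaf_def]] by simp

lemma A_measurable: "0 \<le> t \<Longrightarrow> A t \<in> borel_measurable (nat_hist Y \<infinity>)"
  by (rule measurable_mono_sigma[OF A_nat_hist _ nat_hist_mono]) simp_all

lemma A_hist: "0 \<le> s \<Longrightarrow> s \<le> t \<Longrightarrow> A s \<in> borel_measurable (hist Y (ennreal t))"
  by (rule measurable_mono_sigma[OF A_nat_hist])
    (use nat_hist_subset_hist sets_hist_mono[of "ennreal s" "ennreal t"] in \<open>auto intro: ennreal_leI\<close>)

text \<open>Right-continuity is required only after composition with the functions in
  \<open>C0\<close>, the form in which it enters the limits below. No measurability of this set of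
  paths is claimed: it is handled through null sets that contain the other paths.\<close>

definition good :: "'w \<Rightarrow> bool" where
  "good \<omega> \<longleftrightarrow> \<omega> \<in> defining_set \<and> \<omega> \<in> paths \<and>
     (\<forall>u\<in>C0. \<forall>t\<ge>0. ((\<lambda>s. ext0 (apply_bcontfun u) (pos Y (ennreal s) \<omega>)) \<longlongrightarrow>
         ext0 (apply_bcontfun u) (pos Y (ennreal t) \<omega>)) (at_right t))"

lemma good_right_continuous:
  "good \<omega> \<Longrightarrow> u \<in> C0 \<Longrightarrow> 0 \<le> t \<Longrightarrow> ((\<lambda>s. ext0 (apply_bcontfun u) (pos Y (ennreal s) \<omega>)) \<longlongrightarrow>
         ext0 (apply_bcontfun u) (pos Y (ennreal t) \<omega>)) (at_right t)"
  unfolding good_def by blast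

lemma good_paths: "good \<omega> \<Longrightarrow> \<omega> \<in> paths" by (simp add: good_def)

lemma good_A:
  assumes "good \<omega>"
  shows "A 0 \<omega> = 0" "continuous_on {0..} (\<lambda>t. A t \<omega>)"
    "0 \<le> t \<Longrightarrow> lifetime Y \<omega> \<le> ennreal t \<Longrightarrow> A t \<omega> = A (enn2real (lifetime Y \<omega>)) \<omega>"
    "0 \<le> s \<Longrightarrow> 0 \<le> t \<Longrightarrow> A (s + t) \<omega> = A s \<omega> + A t (shift Y (ennreal s) \<omega>)"
  using is_defining_set assms unfolding is_defining_set_def good_def by blast+

lemma good_clock: "good \<omega> \<Longrightarrow> clock (\<lambda>t. A t \<omega>)"
proof
  fix s t :: real assume g: "good \<omega>" and st: "0 \<le> s" "s \<le> t"
  have "A (s + (t - s)) \<omega> = A s \<omega> + A (t - s) (shift Y (ennreal s) \<omega>)"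
    by (rule good_A(4)[OF g]) (use st in auto)
  then show "A s \<omega> \<le> A t \<omega>" by simp
qed (simp_all add: good_A)

lemma good_shift:
  assumes g: "good \<omega>" and q: "0 \<le> q"
  shows "good (shift Y (ennreal q) \<omega>)"
  unfolding good_def
proof (intro conjI ballI allI impI)
  have "shift Y (ennreal q) ` defining_set \<subseteq> defining_set"
    using is_defining_set unfolding is_defining_set_def by simp
  then show "shift Y (ennreal q) \<omega> \<in> defining_set" using g unfolding good_def by blast
  show "shift Y (ennreal q) \<omega> \<in> paths" using good_paths[OF g] by (rule shift_paths)
  fix u :: "'a \<Rightarrow>\<^sub>C real" and t :: real assume u: "u \<in> C0" and t: "0 \<le> t"
  have "filterlim (\<lambda>s. s + q) (at_right (t + q)) (at_right t)"
    unfolding filterlim_at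
  proof
    show "\<forall>\<^sub>F s in at_right t. s + q \<in> {t + q<..} \<and> s + q \<noteq> t + q"
      using eventually_at_right_less[of t] by eventually_elim auto
    show "((\<lambda>s. s + q) \<longlongrightarrow> t + q) (at_right t)" by (intro tendsto_intros)
  qed
  from filterlim_compose[OF good_right_continuous[OF g u, of "t + q"] this]
  have "((\<lambda>s. ext0 (apply_bcontfun u) (pos Y (ennreal (s + q)) \<omega>)) \<longlongrightarrow>
         ext0 (apply_bcontfun u) (pos Y (ennreal (t + q)) \<omega>)) (at_right t)"
    using t q by simp
  moreover have "\<forall>\<^sub>F s in at_right t. ext0 (apply_bcontfun u) (pos Y (ennreal (s + q)) \<omega>)
      = ext0 (apply_bcontfun u) (pos Y (ennreal s) (shift Y (ennreal q) \<omega>))"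
    using eventually_at_right_less[of t]
    by eventually_elim (use t q in \<open>simp add: pos_shift good_paths[OF g] ennreal_plus\<close>)
  ultimately show "((\<lambda>s. ext0 (apply_bcontfun u) (pos Y (ennreal s) (shift Y (ennreal q) \<omega>))) \<longlongrightarrow>
         ext0 (apply_bcontfun u) (pos Y (ennreal t) (shift Y (ennreal q) \<omega>))) (at_right t)"
    using t q by (simp add: pos_shift good_paths[OF g] ennreal_plus tendsto_cong)
qed

text \<open>The defining set of the additive functional has full measure only for starting points in
  the state space. Intersecting the bad set with the event that the path does not start in the
  cemetery makes it null from the cemetery as well, at the price of the second alternative; such
  paths stay in the cemetery and need no clock.\<close>

lemma polar_bad_set:
  obtains Z where "Z \<in> sets (events Y)" "\<And>y. emeasure (law Y y) Z = 0"
    "\<And>\<omega>. \<omega> \<in> paths \<Longrightarrow> \<omega> \<notin> Z \<Longrightarrow> good \<omega> \<or> pos Y 0 \<omega> = None"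
proof -
  have "\<exists>N\<in>sets (events Y). (\<forall>x. emeasure (law Y x) N = 0) \<and>
        (\<forall>\<omega>\<in>paths - N.
          (\<forall>t<\<infinity>. limitin opc (\<lambda>s. pos Y s \<omega>) (pos Y t \<omega>) (at_right t)) \<and>
          (\<forall>t. 0 < t \<and> t < lifetime Y \<omega> \<longrightarrow> (\<exists>y. limitin opc (\<lambda>s. pos Y s \<omega>) y (at_left t))))"
    using std unfolding standard_process_def by (elim conjE)
  then obtain N where N: "N \<in> sets (events Y)" "\<forall>x. emeasure (law Y x) N = 0"
    and N': "\<forall>\<omega>\<in>paths - N.
          (\<forall>t<\<infinity>. limitin opc (\<lambda>s. pos Y s \<omega>) (pos Y t \<omega>) (at_right t)) \<and>
          (\<forall>t. 0 < t \<and> t < lifetime Y \<omega> \<longrightarrow> (\<exists>y. limitin opc (\<lambda>s. pos Y s \<omega>) y (at_left t)))"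
    by (elim bexE conjE)
  define L where "L = defining_set"
  have L: "L \<in> sets (events Y)" "\<And>x. emeasure (law Y (Some x)) L = 1"
    using is_defining_set nat_hist_subset_events[of "\<infinity>"] unfolding L_def is_defining_set_def by auto
  have L0: "emeasure (law Y (Some x)) (paths - L) = 0" for x
  proof -
    interpret prob_space "law Y (Some x)" by (rule prob_law)
    show ?thesis
      using L sets_law sets.sets_into_space[OF L(1)] emeasure_space_1 by (subst emeasure_Diff) auto
  qed
  have "UNIV - {None} \<in> sets (borel_opc :: 'a option measure)"
  proof -
    have "openin opc (UNIV - {None :: 'a option})"
      unfolding opc_def openin_Alexandroff_compactification
      by (rule disjI1, rule exI[of _ UNIV]) (simp add: UNIV_option_conv)
    then show ?thesis by (rule sets_borel_opc_openin)
  qed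
  from measurable_sets[OF pos_events this]
  have P: "pos Y 0 -` (UNIV - {None}) \<inter> paths \<in> sets (events Y)" .
  define Z where "Z = (N \<union> (paths - L)) \<inter> (pos Y 0 -` (UNIV - {None}) \<inter> paths)"
  have Zs: "Z \<in> sets (events Y)" unfolding Z_def using N(1) L(1) P by auto
  show thesis
  proof (rule that[OF Zs])
    fix y
    show "emeasure (law Y y) Z = 0"
    proof (cases y)
      case None
      have "AE \<omega> in law Y y. \<omega> \<notin> Z"
        using AE_pos_0[of y] by eventually_elim (simp add: None Z_def)
      moreover have "Z \<in> sets (law Y y)" using Zs sets_law by simp
      ultimately have "Z \<in> null_sets (law Y y)" by (simp add: AE_iff_null_sets)
      then show ?thesis by (simp add: null_sets_def)
    next
      case (Some x)
      have "emeasure (law Y y) Z \<le> emeasure (law Y y) (N \<union> (paths - L))"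
        by (rule emeasure_mono) (use N(1) L(1) sets_law in \<open>auto simp: Z_def\<close>)
      also have "\<dots> \<le> emeasure (law Y y) N + emeasure (law Y y) (paths - L)"
        by (rule emeasure_subadditive) (use N(1) L(1) sets_law in auto)
      also have "\<dots> = 0" using N(2) L0 by (simp add: Some)
      finally show ?thesis by simp
    qed
  next
    fix \<omega> assume \<omega>: "\<omega> \<in> paths" "\<omega> \<notin> Z"
    show "good \<omega> \<or> pos Y 0 \<omega> = None"
    proof (rule disjCI)
      assume "pos Y 0 \<omega> \<noteq> None"
      with \<omega> have "\<omega> \<notin> N" "\<omega> \<in> L" by (auto simp: Z_def)
      show "good \<omega>" unfolding good_def
      proof (intro conjI ballI allI impI)
        show "\<omega> \<in> defining_set" using \<open>\<omega> \<in> L\<close> by (simp add: L_def)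
        fix u :: "'a \<Rightarrow>\<^sub>C real" and t :: real assume u: "u \<in> C0" and t: "0 \<le> t"
        have "limitin opc (\<lambda>s. pos Y s \<omega>) (pos Y (ennreal t) \<omega>) (at_right (ennreal t))"
          using N' \<omega>(1) \<open>\<omega> \<notin> N\<close> by simp
        from filterlim_compose[OF ext0_limitin[OF u this] filterlim_ennreal_at_right[OF t]]
        show "((\<lambda>s. ext0 (apply_bcontfun u) (pos Y (ennreal s) \<omega>)) \<longlongrightarrow>
          ext0 (apply_bcontfun u) (pos Y (ennreal t) \<omega>)) (at_right t)" .
      qed fact
    qed
  qed
qed

lemma AE_good: "AE \<omega> in law Y (Some x). good \<omega>"
proof -
  obtain Z where Z: "Z \<in> sets (events Y)" "\<And>y. emeasure (law Y y) Z = 0"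
    "\<And>\<omega>. \<omega> \<in> paths \<Longrightarrow> \<omega> \<notin> Z \<Longrightarrow> good \<omega> \<or> pos Y 0 \<omega> = None"
    by (rule polar_bad_set) blast
  have "AE \<omega> in law Y (Some x). \<omega> \<notin> Z"
    using Z(1,2) sets_law by (intro AE_not_in) (auto simp: null_sets_def)
  then show ?thesis using AE_pos_0[of "Some x"] AE_space
  proof eventually_elim
    case (elim \<omega>)
    then show ?case using Z(3)[of \<omega>] by simp
  qed
qed

text \<open>The time-changed path \<open>t \<mapsto> u (X\<^bsub>\<tau>(t)\<^esub>)\<close>, written as a limit of explicitly measurable expressions. The
  clamping only matters on bad paths, where it keeps the function bounded.\<close>

definition tc_path :: "('a \<Rightarrow>\<^sub>C real) \<Rightarrow> real \<Rightarrow> 'w \<Rightarrow> real" where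
  "tc_path u t \<omega> = max (- norm u) (min (norm u) (lim (\<lambda>n. step_sum (\<lambda>s. A s \<omega>) n t
     (\<lambda>k. ext0 (apply_bcontfun u) (pos Y (ennreal (real k / real (Suc n))) \<omega>)))))"

lemma abs_tc_path_le: "\<bar>tc_path u t \<omega>\<bar> \<le> norm u"
  unfolding tc_path_def by (simp add: abs_le_iff min_def max_def)

lemma
  assumes g: "good \<omega>" and t: "0 \<le> t" and u: "u \<in> C0"
  shows step_sum_tendsto_tc_path: "(\<lambda>n. step_sum (\<lambda>s. A s \<omega>) n t
     (\<lambda>k. ext0 (apply_bcontfun u) (pos Y (ennreal (real k / real (Suc n))) \<omega>))) \<longlonglongrightarrow> tc_path u t \<omega>"
    and tc_path_good: "tc_path u t \<omega> = ext0 (apply_bcontfun u) (pos Y (passage (\<lambda>s. A s \<omega>) t) \<omega>)"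
proof -
  interpret clock "\<lambda>t. A t \<omega>" by (rule good_clock[OF g])
  let ?l = "ext0 (apply_bcontfun u) (pos Y (passage (\<lambda>s. A s \<omega>) t) \<omega>)"
  have *: "(\<lambda>n. step_sum (\<lambda>s. A s \<omega>) n t
     (\<lambda>k. ext0 (apply_bcontfun u) (pos Y (ennreal (real k / real (Suc n))) \<omega>))) \<longlonglongrightarrow> ?l"
  proof (cases "\<exists>s\<ge>0. ennreal t < A s \<omega>")
    case True
    then obtain s0 where s0: "0 \<le> s0" "ennreal t < A s0 \<omega>" by blast
    obtain T where T: "0 \<le> T" "passage (\<lambda>s. A s \<omega>) t = ennreal T" "A T \<omega> = ennreal t"
      "\<And>s. 0 \<le> s \<Longrightarrow> ennreal t < A s \<omega> \<longleftrightarrow> T < s"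
      by (rule passage_finite[OF t s0]) blast
    show ?thesis unfolding T(2)
      by (rule step_sum_tendsto[OF T(1,4) good_right_continuous[OF g u T(1)]])
  next
    case False
    then show ?thesis
      using pos_infinity[OF good_paths[OF g]] by (simp add: step_sum_zero passage_top)
  qed
  have "tc_path u t \<omega> = ?l"
    unfolding tc_path_def limI[OF *] using abs_ext0_le[of u "pos Y (passage (\<lambda>s. A s \<omega>) t) \<omega>"]
    by (auto simp: abs_le_iff min_def max_def)
  with * show "tc_path u t \<omega> = ?l" "(\<lambda>n. step_sum (\<lambda>s. A s \<omega>) n t
     (\<lambda>k. ext0 (apply_bcontfun u) (pos Y (ennreal (real k / real (Suc n))) \<omega>))) \<longlonglongrightarrow> tc_path u t \<omega>"
    by simp_all
qed

lemma dead:
  assumes "\<omega> \<in> paths" "pos Y 0 \<omega> = None"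
  shows "pos Y t \<omega> = None"
  using pos_absorb[OF assms(1) _ assms(2), of t] by simp

lemma tc_path_dead:
  assumes "\<omega> \<in> paths" "pos Y 0 \<omega> = None"
  shows "tc_path u t \<omega> = 0"
proof -
  have "step_sum (\<lambda>s. A s \<omega>) n t (\<lambda>k. ext0 (apply_bcontfun u) (pos Y (ennreal (real k / real (Suc n))) \<omega>)) = 0" for n
    unfolding step_sum_def by (rule sum.neutral) (simp add: dead[OF assms])
  then show ?thesis by (simp add: tc_path_def limI)
qed

lemma step_sum_measurable:
  assumes [measurable]: "\<And>k. c k \<in> borel_measurable (borel \<Otimes>\<^sub>M nat_hist Y \<infinity>)"
  shows "(\<lambda>(t, \<omega>). step_sum (\<lambda>s. A s \<omega>) n t (\<lambda>k. c k (t, \<omega>))) \<in> borel_measurable (borel \<Otimes>\<^sub>M nat_hist Y \<infinity>)"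
proof -
  have [measurable]: "A (real k / real (Suc n)) \<in> borel_measurable (nat_hist Y \<infinity>)" for k
    by (rule A_measurable) simp
  show ?thesis unfolding step_sum_def by measurable
qed

lemma tc_path_measurable:
  assumes u: "u \<in> C0"
  shows "(\<lambda>(t, \<omega>). tc_path u t \<omega>) \<in> borel_measurable (borel \<Otimes>\<^sub>M nat_hist Y \<infinity>)"
proof -
  note [measurable] = ext0_measurable[OF u] pos_nat_hist
  have "(\<lambda>(t, \<omega>). step_sum (\<lambda>s. A s \<omega>) n t
     (\<lambda>k. (\<lambda>(t, \<omega>). ext0 (apply_bcontfun u) (pos Y (ennreal (real k / real (Suc n))) \<omega>)) (t, \<omega>)))
    \<in> borel_measurable (borel \<Otimes>\<^sub>M nat_hist Y \<infinity>)" for n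
    by (rule step_sum_measurable) measurable
  then have m: "(\<lambda>(t, \<omega>). step_sum (\<lambda>s. A s \<omega>) n t
     (\<lambda>k. ext0 (apply_bcontfun u) (pos Y (ennreal (real k / real (Suc n))) \<omega>)))
    \<in> borel_measurable (borel \<Otimes>\<^sub>M nat_hist Y \<infinity>)" for n by (simp only: prod.case)
  show ?thesis unfolding tc_path_def split_beta'
    by (intro borel_measurable_max borel_measurable_min borel_measurable_const borel_measurable_lim_metric)
      (use m in \<open>simp only: split_beta'\<close>)
qed


lemma ident_nat_hist[measurable]: "(\<lambda>\<omega>. \<omega>) \<in> law Y y \<rightarrow>\<^sub>M nat_hist Y \<infinity>"
  using nat_hist_subset_events sets_law[of y] sets.sets_into_space[of _ "nat_hist Y \<infinity>"]
  by (auto simp: measurable_def Int_absorb2)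

lemma nat_hist_law: "f \<in> nat_hist Y \<infinity> \<rightarrow>\<^sub>M N \<Longrightarrow> f \<in> law Y y \<rightarrow>\<^sub>M N"
  using measurable_compose[OF ident_nat_hist] by blast

lemma nat_hist_law_pair:
  assumes "f \<in> borel \<Otimes>\<^sub>M nat_hist Y \<infinity> \<rightarrow>\<^sub>M N"
  shows "f \<in> lborel \<Otimes>\<^sub>M law Y y \<rightarrow>\<^sub>M N"
proof -
  have "(\<lambda>z. (fst z, snd z)) \<in> lborel \<Otimes>\<^sub>M law Y y \<rightarrow>\<^sub>M borel \<Otimes>\<^sub>M nat_hist Y \<infinity>"
    by (intro measurable_Pair measurable_compose[OF measurable_snd ident_nat_hist]) simp_all
  from measurable_compose[OF this assms] show ?thesis by simp
qed

lemma tc_path_section: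
  assumes u: "u \<in> C0" and \<omega>: "\<omega> \<in> paths"
  shows "(\<lambda>t. tc_path u t \<omega>) \<in> borel_measurable borel"
proof -
  have "(\<lambda>t. (t, \<omega>)) \<in> borel \<rightarrow>\<^sub>M borel \<Otimes>\<^sub>M nat_hist Y \<infinity>"
    using \<omega> by (intro measurable_Pair) auto
  from measurable_compose[OF this tc_path_measurable[OF u]] show ?thesis by simp
qed

section \<open>Discounted integrals and the time-changed Markov property\<close>

text \<open>The starting level \<open>b\<close> is a separate argument because it will be random:
  the clock value at a grid time.\<close>

definition discounted :: "real \<Rightarrow> ('a \<Rightarrow>\<^sub>C real) \<Rightarrow> real \<Rightarrow> 'w \<Rightarrow> real" where
  "discounted \<gamma> u b \<omega> = (\<integral>t. indicator {0..} t * (exp (- \<gamma> * t) * tc_path u (b + t) \<omega>) \<partial>lborel)"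

lemma abs_discounted_le:
  assumes \<gamma>: "0 < \<gamma>"
  shows "\<bar>discounted \<gamma> u b \<omega>\<bar> \<le> norm u / \<gamma>"
proof (cases "integrable lborel (\<lambda>t. indicator {0..} t * (exp (- \<gamma> * t) * tc_path u (b + t) \<omega>))")
  case True
  have "\<bar>discounted \<gamma> u b \<omega>\<bar> \<le> (\<integral>t. norm u * (indicator {0..} t * exp (- \<gamma> * t)) \<partial>lborel)"
    unfolding discounted_def
  proof (rule order_trans[OF integral_abs_bound integral_mono])
    show "integrable lborel (\<lambda>t. \<bar>indicator {0..} t * (exp (- \<gamma> * t) * tc_path u (b + t) \<omega>)\<bar>)"
      using True by (rule integrable_abs)
    show "integrable lborel (\<lambda>t. norm u * (indicator {0..} t * exp (- \<gamma> * t)))"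
      by (intro integrable_mult_right integrable_exp_half_line \<gamma>)
    show "\<bar>indicator {0..} t * (exp (- \<gamma> * t) * tc_path u (b + t) \<omega>)\<bar> \<le> norm u * (indicator {0..} t * exp (- \<gamma> * t))" for t
      using abs_tc_path_le[of u "b + t" \<omega>] by (auto simp: abs_mult indicator_def mult.commute)
  qed
  also have "\<dots> = norm u / \<gamma>"
    by (simp only: integral_mult_right_zero integral_exp_half_line[OF \<gamma>]) simp
  finally show ?thesis .
qed (use \<gamma> in \<open>simp add: discounted_def not_integrable_integral_eq\<close>)

lemma discounted_measurable:
  assumes u: "u \<in> C0" and [measurable]: "f \<in> borel_measurable (nat_hist Y \<infinity>)"
  shows "(\<lambda>\<omega>. discounted \<gamma> u (f \<omega>) \<omega>) \<in> borel_measurable (nat_hist Y \<infinity>)"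
proof -
  have "(\<lambda>z. (f (fst z) + snd z, fst z)) \<in> nat_hist Y \<infinity> \<Otimes>\<^sub>M lborel \<rightarrow>\<^sub>M borel \<Otimes>\<^sub>M nat_hist Y \<infinity>"
    by measurable
  from measurable_compose[OF this tc_path_measurable[OF u]]
  have [measurable]: "(\<lambda>(\<omega>, t). tc_path u (f \<omega> + t) \<omega>) \<in> borel_measurable (nat_hist Y \<infinity> \<Otimes>\<^sub>M lborel)"
    by (simp add: split_beta')
  have "(\<lambda>(\<omega>, t). indicator {0..} t * (exp (- \<gamma> * t) * tc_path u (f \<omega> + t) \<omega>)) \<in> borel_measurable (nat_hist Y \<infinity> \<Otimes>\<^sub>M lborel)"
    by measurable
  from lborel.borel_measurable_lebesgue_integral[OF this] show ?thesis by (simp add: discounted_def)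
qed

text \<open>Substituting \<open>s = b + t\<close> moves \<open>b\<close> from the path into the
  domain of integration and an exponential factor. Hence continuity in \<open>b\<close> needs no
  regularity of the time-changed path. It is used when the clock value at a rounded time tends to
  the exact level.\<close>

lemma isCont_discounted:
  assumes u: "u \<in> C0" and \<omega>: "\<omega> \<in> paths" and \<gamma>: "0 < \<gamma>"
  shows "isCont (\<lambda>b. discounted \<gamma> u b \<omega>) b0"
proof -
  note [measurable] = tc_path_section[OF u \<omega>]
  define K where "K b = (\<integral>s. indicator {b..} s * (exp (- \<gamma> * s) * tc_path u s \<omega>) \<partial>lborel)" for b
  have eq: "discounted \<gamma> u b \<omega> = exp (\<gamma> * b) * K b" for b
  proof -
    have "K b = (\<integral>t. indicator {b..} (b + t) * (exp (- \<gamma> * (b + t)) * tc_path u (b + t) \<omega>) \<partial>lborel)"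
      unfolding K_def using lborel_integral_real_affine[of 1 "\<lambda>s. indicator {b..} s * (exp (- \<gamma> * s) * tc_path u s \<omega>)" b] by simp
    also have "(\<lambda>t. indicator {b..} (b + t) * (exp (- \<gamma> * (b + t)) * tc_path u (b + t) \<omega>))
      = (\<lambda>t. exp (- \<gamma> * b) * (indicator {0..} t * (exp (- \<gamma> * t) * tc_path u (b + t) \<omega>)))"
    proof (rule ext)
      fix t
      have "exp (- \<gamma> * (b + t)) = exp (- \<gamma> * b) * exp (- \<gamma> * t)"
        by (simp add: exp_add[symmetric] algebra_simps)
      then show "indicator {b..} (b + t) * (exp (- \<gamma> * (b + t)) * tc_path u (b + t) \<omega>)
        = exp (- \<gamma> * b) * (indicator {0..} t * (exp (- \<gamma> * t) * tc_path u (b + t) \<omega>))"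
        by (simp add: indicator_def)
    qed
    finally have "K b = exp (- \<gamma> * b) * discounted \<gamma> u b \<omega>" by (simp add: discounted_def)
    then show ?thesis by (simp add: exp_minus)
  qed
  have "isCont K b0"
    unfolding continuous_at_sequentially
  proof (intro allI impI)
    fix b :: "nat \<Rightarrow> real" assume b: "b \<longlonglongrightarrow> b0"
    then have "Bseq b" by (intro convergent_imp_Bseq convergentI)
    then obtain L where L: "\<And>n. \<bar>b n\<bar> \<le> L" unfolding Bseq_def by auto
    have "(\<lambda>n. \<integral>s. indicator {b n..} s * (exp (- \<gamma> * s) * tc_path u s \<omega>) \<partial>lborel)
       \<longlonglongrightarrow> (\<integral>s. indicator {b0..} s * (exp (- \<gamma> * s) * tc_path u s \<omega>) \<partial>lborel)"
    proof (rule integral_dominated_convergence[where w="\<lambda>s. norm u * (indicator {- L..} s * exp (- \<gamma> * s))"])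
      show "integrable lborel (\<lambda>s. norm u * (indicator {- L..} s * exp (- \<gamma> * s)))"
        by (intro integrable_mult_right integrable_exp_half_line \<gamma>)
      have "AE s in lborel. s \<noteq> b0" by (rule AE_lborel_singleton)
      then show "AE s in lborel. (\<lambda>n. indicator {b n..} s * (exp (- \<gamma> * s) * tc_path u s \<omega>))
         \<longlonglongrightarrow> indicator {b0..} s * (exp (- \<gamma> * s) * tc_path u s \<omega>)"
      proof eventually_elim
        case (elim s)
        then have "\<forall>\<^sub>F n in sequentially. indicator {b n..} s = (indicator {b0..} s :: real)"
          using order_tendstoD[OF b, of s] by (cases s b0 rule: linorder_cases) (auto simp: indicator_def elim: eventually_mono)
        then show ?case by (intro tendsto_mult tendsto_const tendsto_eventually)
      qed
      show "AE s in lborel. norm (indicator {b n..} s * (exp (- \<gamma> * s) * tc_path u s \<omega>))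
          \<le> norm u * (indicator {- L..} s * exp (- \<gamma> * s))" for n
      proof (rule AE_I2)
        fix s show "norm (indicator {b n..} s * (exp (- \<gamma> * s) * tc_path u s \<omega>))
          \<le> norm u * (indicator {- L..} s * exp (- \<gamma> * s))"
          using abs_tc_path_le[of u s \<omega>] L[of n] by (auto simp: indicator_def abs_mult mult.commute)
      qed
    qed measurable
    then show "(K \<circ> b) \<longlonglongrightarrow> K b0" by (simp add: K_def o_def)
  qed
  then show ?thesis unfolding eq by (intro continuous_intros)
qed

text \<open>This is T_t u(x) in the notation of the overview. It is a plain function of
  \<open>t\<close> and \<open>x\<close>, since no continuity in \<open>x\<close> is known for fixed
  \<open>t\<close>.\<close>

definition tc_mean :: "'a \<Rightarrow> ('a \<Rightarrow>\<^sub>C real) \<Rightarrow> real \<Rightarrow> real" where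
  "tc_mean x u t = (\<integral>\<omega>. tc_path u t \<omega> \<partial>law Y (Some x))"

lemma tc_path_law:
  assumes u: "u \<in> C0" shows "tc_path u t \<in> borel_measurable (law Y y)"
proof (rule nat_hist_law)
  have "(\<lambda>\<omega>. (t, \<omega>)) \<in> nat_hist Y \<infinity> \<rightarrow>\<^sub>M borel \<Otimes>\<^sub>M nat_hist Y \<infinity>" by simp
  from measurable_compose[OF this tc_path_measurable[OF u]]
  show "tc_path u t \<in> borel_measurable (nat_hist Y \<infinity>)" by simp
qed

lemma tc_path_integrable:
  assumes u: "u \<in> C0" shows "integrable (law Y y) (tc_path u t)"
proof -
  interpret prob_space "law Y y" by (rule prob_law)
  show ?thesis by (rule integrable_const_bound[of _ "norm u"]) (use tc_path_law[OF u] abs_tc_path_le in auto)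
qed

lemma tc_mean_measurable:
  assumes u: "u \<in> C0" shows "tc_mean x u \<in> borel_measurable borel"
proof -
  interpret prob_space "law Y (Some x)" by (rule prob_law)
  have "tc_mean x u \<in> borel_measurable lborel"
    unfolding tc_mean_def[abs_def]
    by (rule borel_measurable_lebesgue_integral[OF nat_hist_law_pair[OF tc_path_measurable[OF u]]])
  then show ?thesis by simp
qed

lemma abs_tc_mean_le: "\<bar>tc_mean x u t\<bar> \<le> norm u"
proof -
  interpret prob_space "law Y (Some x)" by (rule prob_law)
  show ?thesis
  proof (cases "integrable (law Y (Some x)) (tc_path u t)")
    case True
    have "\<bar>tc_mean x u t\<bar> \<le> (\<integral>\<omega>. norm u \<partial>law Y (Some x))"
      unfolding tc_mean_def
      by (rule order_trans[OF integral_abs_bound integral_mono]) (use True abs_tc_path_le in auto)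
    then show ?thesis using prob_space by simp
  qed (simp add: tc_mean_def not_integrable_integral_eq)
qed

lemma integral_discounted:
  assumes u: "u \<in> C0" and \<gamma>: "0 < \<gamma>"
  shows "(\<integral>\<omega>. discounted \<gamma> u b \<omega> \<partial>law Y (Some x))
    = (\<integral>t. indicator {0..} t * (exp (- \<gamma> * t) * tc_mean x u (b + t)) \<partial>lborel)"
proof -
  interpret Q: prob_space "law Y (Some x)" by (rule prob_law)
  interpret pair_sigma_finite lborel "law Y (Some x)" ..
  have "(\<lambda>z. (b + fst z, snd z)) \<in> borel \<Otimes>\<^sub>M nat_hist Y \<infinity> \<rightarrow>\<^sub>M borel \<Otimes>\<^sub>M nat_hist Y \<infinity>" by measurable
  from nat_hist_law_pair[OF measurable_compose[OF this tc_path_measurable[OF u]]]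
  have [measurable]: "(\<lambda>(t, \<omega>). tc_path u (b + t) \<omega>) \<in> borel_measurable (lborel \<Otimes>\<^sub>M law Y (Some x))"
    by (simp add: split_beta')
  let ?f = "\<lambda>(t, \<omega>). indicator {0..} t * (exp (- \<gamma> * t) * tc_path u (b + t) \<omega>)"
  have "integrable (lborel \<Otimes>\<^sub>M law Y (Some x)) ?f"
  proof (rule integrableI_bounded)
    show "?f \<in> borel_measurable (lborel \<Otimes>\<^sub>M law Y (Some x))" by measurable
    have "(\<integral>\<^sup>+z. ennreal (norm (?f z)) \<partial>(lborel \<Otimes>\<^sub>M law Y (Some x)))
      = (\<integral>\<^sup>+t. \<integral>\<^sup>+\<omega>. ennreal (norm (?f (t, \<omega>))) \<partial>law Y (Some x) \<partial>lborel)"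
      by (rule Q.nn_integral_fst[where f="\<lambda>z. ennreal (norm (?f z))", symmetric]) measurable
    also have "\<dots> \<le> (\<integral>\<^sup>+t. \<integral>\<^sup>+\<omega>. ennreal (norm u) * ennreal (indicator {0..} t * exp (- \<gamma> * t)) \<partial>law Y (Some x) \<partial>lborel)"
    proof (intro nn_integral_mono)
      fix t \<omega>
      show "ennreal (norm (?f (t, \<omega>))) \<le> ennreal (norm u) * ennreal (indicator {0..} t * exp (- \<gamma> * t))"
        using abs_tc_path_le[of u "b + t" \<omega>]
        by (auto simp: indicator_def abs_mult mult.commute ennreal_mult'[symmetric] intro!: ennreal_leI mult_right_mono)
    qed
    also have "\<dots> = (\<integral>\<^sup>+t. ennreal (norm u) * ennreal (indicator {0..} t * exp (- \<gamma> * t)) \<partial>lborel)"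
      using Q.emeasure_space_1 by simp
    also have "\<dots> = ennreal (norm u) * ennreal (exp (- \<gamma> * 0) / \<gamma>)"
      by (subst nn_integral_cmult, simp, simp only: nn_integral_exp_half_line[OF \<gamma>])
    also have "\<dots> < \<infinity>" by (simp add: ennreal_mult_less_top)
    finally show "(\<integral>\<^sup>+z. ennreal (norm (?f z)) \<partial>(lborel \<Otimes>\<^sub>M law Y (Some x))) < \<infinity>" .
  qed
  from Fubini_integral[OF this] show ?thesis
    by (simp add: discounted_def tc_mean_def)
qed

text \<open>The two integrands agree on good paths and on paths started in the cemetery, hence off a
  set that is null from every starting point. Completeness of \<open>events Y\<close> then gives
  measurability of the original one, without which almost everywhere equality would say nothing
  about its integral.\<close>

lemma tc_resolvent_eq_discounted:
  assumes u: "u \<in> C0"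
  shows "tc_resolvent Y A \<alpha> (apply_bcontfun u) x = (\<integral>\<omega>. discounted \<alpha> u 0 \<omega> \<partial>law Y (Some x))"
proof -
  define I where "I \<omega> = (LBINT t:{0..}. exp (- \<alpha> * t) * ext0 (apply_bcontfun u) (pos Y (right_inverse A t \<omega>) \<omega>))" for \<omega>
  have I_good: "I \<omega> = discounted \<alpha> u 0 \<omega>" if "good \<omega>" for \<omega>
    unfolding I_def discounted_def set_lebesgue_integral_def
    by (rule Bochner_Integration.integral_cong) (auto simp: indicator_def right_inverse_eq_passage tc_path_good[OF that _ u])
  have I_dead: "I \<omega> = discounted \<alpha> u 0 \<omega>" if "\<omega> \<in> paths" "pos Y 0 \<omega> = None" for \<omega>
    unfolding I_def discounted_def set_lebesgue_integral_def by (simp add: dead[OF that] tc_path_dead[OF that])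
  obtain Z where Z: "Z \<in> sets (events Y)" "\<And>y. emeasure (law Y y) Z = 0"
    "\<And>\<omega>. \<omega> \<in> paths \<Longrightarrow> \<omega> \<notin> Z \<Longrightarrow> good \<omega> \<or> pos Y 0 \<omega> = None"
    by (rule polar_bad_set) blast
  have D: "discounted \<alpha> u 0 \<in> borel_measurable (nat_hist Y \<infinity>)"
    using discounted_measurable[OF u, of "\<lambda>_. 0" \<alpha>] by simp
  have "I \<in> borel_measurable (events Y)"
    by (rule polar_modification_measurable[OF Z(1,2) nat_hist_measurable_events[OF D]])
      (use Z(3) I_good I_dead in blast)
  then have "(\<integral>\<omega>. I \<omega> \<partial>law Y (Some x)) = (\<integral>\<omega>. discounted \<alpha> u 0 \<omega> \<partial>law Y (Some x))"
    by (intro integral_cong_AE)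
      (use nat_hist_law[OF D] AE_good[of x] I_good in \<open>auto simp: measurable_law elim: eventually_mono\<close>)
  then show ?thesis by (simp add: tc_resolvent_def I_def)
qed

lemma tc_resolvent_eq_laplace:
  assumes u: "u \<in> C0" and \<alpha>: "0 < \<alpha>"
  shows "tc_resolvent Y A \<alpha> (apply_bcontfun u) x
    = (\<integral>t. indicator {0..} t * (exp (- \<alpha> * t) * tc_mean x u t) \<partial>lborel)"
  using integral_discounted[OF u \<alpha>, where b=0 and x=x] tc_resolvent_eq_discounted[OF u] by simp

text \<open>Additivity of the clock gives: the inverse clock of the translated path at level
  \<open>t\<close>, plus \<open>q\<close>, is the inverse clock of the original path at level
  \<open>b + t\<close>. Finiteness of the clock at \<open>q\<close> is needed to cancel
  \<open>b\<close>.\<close>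

lemma tc_path_shift:
  assumes g: "good \<omega>" and q: "0 \<le> q" and t: "0 \<le> t" and b: "0 \<le> b" "A q \<omega> = ennreal b" and u: "u \<in> C0"
  shows "tc_path u t (shift Y (ennreal q) \<omega>) = tc_path u (b + t) \<omega>"
proof -
  let ?\<theta> = "shift Y (ennreal q) \<omega>"
  have g': "good ?\<theta>" by (rule good_shift[OF g q])
  interpret C: clock "\<lambda>t. A t \<omega>" by (rule good_clock[OF g])
  interpret D: clock "\<lambda>t. A t ?\<theta>" by (rule good_clock[OF g'])
  have iff: "ennreal t < A s ?\<theta> \<longleftrightarrow> ennreal (b + t) < A (q + s) \<omega>" if "0 \<le> s" for s
  proof -
    have "A (q + s) \<omega> = ennreal b + A s ?\<theta>" using good_A(4)[OF g q that] by (simp add: b(2))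
    then show ?thesis using b(1) t by (simp add: ennreal_plus ennreal_add_left_cancel_less)
  qed
  have "passage (\<lambda>s. A s ?\<theta>) t + ennreal q = passage (\<lambda>s. A s \<omega>) (b + t)"
  proof (cases "\<exists>s\<ge>0. ennreal t < A s ?\<theta>")
    case False
    have "\<not> (\<exists>s\<ge>0. ennreal (b + t) < A s \<omega>)"
    proof
      assume "\<exists>s\<ge>0. ennreal (b + t) < A s \<omega>"
      then obtain s where s: "0 \<le> s" "ennreal (b + t) < A s \<omega>" by blast
      then have "ennreal (b + t) < A (q + s) \<omega>" using C.mono[of s "q + s"] q by (auto intro: less_le_trans)
      with iff[OF s(1)] False s(1) show False by blast
    qed
    then show ?thesis using False by (simp add: passage_top)
  next
    case True
    then obtain s0 where s0: "0 \<le> s0" "ennreal t < A s0 ?\<theta>" by blast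
    obtain T' where T': "0 \<le> T'" "passage (\<lambda>s. A s ?\<theta>) t = ennreal T'" "A T' ?\<theta> = ennreal t"
      "\<And>s. 0 \<le> s \<Longrightarrow> ennreal t < A s ?\<theta> \<longleftrightarrow> T' < s"
      by (rule D.passage_finite[OF t s0]) blast
    have s1: "0 \<le> q + s0" "ennreal (b + t) < A (q + s0) \<omega>" using iff[OF s0(1)] s0 q by auto
    have bt: "0 \<le> b + t" using b t by simp
    obtain T where T: "0 \<le> T" "passage (\<lambda>s. A s \<omega>) (b + t) = ennreal T" "A T \<omega> = ennreal (b + t)"
      "\<And>s. 0 \<le> s \<Longrightarrow> ennreal (b + t) < A s \<omega> \<longleftrightarrow> T < s"
      by (rule C.passage_finite[OF bt s1]) blast
    have "\<not> T < q" using T(4)[OF q] b t by (simp add: b(2) ennreal_less_iff)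
    then have Tq: "q \<le> T" by simp
    have *: "T' < s \<longleftrightarrow> T - q < s" if "0 \<le> s" for s
      using T'(4)[OF that] iff[OF that] T(4)[of "q + s"] q that by auto
    have "T' = T - q" using *[OF T'(1)] *[of "T - q"] Tq by force
    then show ?thesis using T(2) T'(2) Tq q T'(1) by (simp flip: ennreal_plus)
  qed
  then show ?thesis
    using tc_path_good[OF g' t u] tc_path_good[OF g _ u, of "b + t"] b t
    by (simp add: pos_shift[OF good_paths[OF g]])
qed

text \<open>Discretising the time change from the right reduces the strong Markov property at
  \<open>\<tau>\<^sub>r\<close> to the Markov property at deterministic times.\<close>

lemma tc_mean_resolvent:
  assumes u: "u \<in> C0" and w: "w \<in> C0" and \<gamma>: "0 < \<gamma>" and r: "0 \<le> r"
    and w_eq: "\<And>y. apply_bcontfun w y = tc_resolvent Y A \<gamma> (apply_bcontfun u) y"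
  shows "tc_mean x w r = (\<integral>t. indicator {0..} t * (exp (- \<gamma> * t) * tc_mean x u (r + t)) \<partial>lborel)"
proof -
  interpret P: prob_space "law Y (Some x)" by (rule prob_law)
  \<comment> \<open>\<open>g1\<close> and \<open>g2\<close> are the two quantities compared at a
    grid time \<open>s\<close>: the value of the resolvent function at the current position, and the
    discounted future of the path from its current clock value on.\<close>
  define g1 where "g1 s \<omega> = ext0 (apply_bcontfun w) (pos Y (ennreal s) \<omega>)" for s \<omega>
  define g2 where "g2 s \<omega> = discounted \<gamma> u (enn2real (A s \<omega>)) \<omega>" for s \<omega>
  \<comment> \<open>The event that the passage time falls into the k-th cell is decided by the right
    end of the cell, hence lies in the history at that time; this is why rounding goes upwards. The
    clock must be finite there because \<open>g2\<close> uses its real value.\<close>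
  define Ev where "Ev n k = {\<omega>\<in>paths. (A (real (k - 1) / real (Suc n)) \<omega> \<le> ennreal r \<and>
     ennreal r < A (real k / real (Suc n)) \<omega>) \<and> A (real k / real (Suc n)) \<omega> < \<infinity>}" for n k
  define Z where "Z g n \<omega> = step_sum (\<lambda>s. A s \<omega>) n r
     (\<lambda>k. if A (real k / real (Suc n)) \<omega> < \<infinity> then g (real k / real (Suc n)) \<omega> else 0)" for g n \<omega>
  have Z_eq: "Z g n \<omega> = (\<Sum>k\<in>{1..Suc n * Suc n}. indicator (Ev n k) \<omega> * g (real k / real (Suc n)) \<omega>)"
    if "\<omega> \<in> paths" for g n \<omega>
    unfolding Z_def step_sum_def by (rule sum.cong) (use that in \<open>auto simp: Ev_def\<close>)
  have g1m: "g1 s \<in> borel_measurable (law Y (Some x))" for s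
    unfolding g1_def[abs_def] by (rule measurable_compose[OF pos_law ext0_measurable[OF w]])
  have g2m: "g2 s \<in> borel_measurable (law Y (Some x))" if "0 \<le> s" for s
    unfolding g2_def[abs_def]
    by (rule nat_hist_law[OF discounted_measurable[OF u]]) (use A_measurable[OF that] in measurable)
  have Ev_hist: "Ev n k \<in> sets (hist Y (ennreal (real k / real (Suc n))))" for n k
  proof -
    have [measurable]: "A (real (k - 1) / real (Suc n)) \<in> borel_measurable (hist Y (ennreal (real k / real (Suc n))))"
      "A (real k / real (Suc n)) \<in> borel_measurable (hist Y (ennreal (real k / real (Suc n))))"
      by (intro A_hist divide_right_mono; simp)+
    have "{\<omega>\<in>space (hist Y (ennreal (real k / real (Suc n)))). (A (real (k - 1) / real (Suc n)) \<omega> \<le> ennreal r \<and>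
     ennreal r < A (real k / real (Suc n)) \<omega>) \<and> A (real k / real (Suc n)) \<omega> < \<infinity>} \<in> sets (hist Y (ennreal (real k / real (Suc n))))"
      by measurable
    then show ?thesis by (simp add: Ev_def)
  qed
  have Ev_law: "Ev n k \<in> sets (law Y (Some x))" for n k by (rule indicator_hist_law[OF Ev_hist])
  have b1: "\<bar>g1 s \<omega>\<bar> \<le> norm w" for s \<omega> unfolding g1_def by (rule abs_ext0_le)
  have b2: "\<bar>g2 s \<omega>\<bar> \<le> norm u / \<gamma>" for s \<omega> unfolding g2_def by (rule abs_discounted_le[OF \<gamma>])
  \<comment> \<open>This is the Markov property at the grid time. On the event,
    \<open>tc_path_shift\<close> identifies the discounted integral of the translated path with
    \<open>g2\<close>, and by \<open>w_eq\<close> its mean from a starting point is \<open>w\<close>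
    there; from the cemetery both are 0.\<close>
  have term_eq: "(\<integral>\<omega>. indicator (Ev n k) \<omega> * g1 (real k / real (Suc n)) \<omega> \<partial>law Y (Some x))
      = (\<integral>\<omega>. indicator (Ev n k) \<omega> * g2 (real k / real (Suc n)) \<omega> \<partial>law Y (Some x))" for n k
  proof -
    define q where "q = real k / real (Suc n)"
    have q: "0 \<le> q" by (simp add: q_def)
    have "(\<integral>\<omega>. indicator (Ev n k) \<omega> * g2 q \<omega> \<partial>law Y (Some x))
       = (\<integral>\<omega>. indicator (Ev n k) \<omega> * ext0 (apply_bcontfun w) (pos Y (ennreal q) \<omega>) \<partial>law Y (Some x))"
    proof (rule markov_bounded[where F="discounted \<gamma> u 0" and B="norm u / \<gamma>"])
      show "Ev n k \<in> sets (hist Y (ennreal q))" using Ev_hist by (simp add: q_def)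
      show "discounted \<gamma> u 0 \<in> borel_measurable (nat_hist Y \<infinity>)"
        using discounted_measurable[OF u, of "\<lambda>_. 0" \<gamma>] by simp
      show "\<bar>discounted \<gamma> u 0 \<omega>\<bar> \<le> norm u / \<gamma>" for \<omega> by (rule abs_discounted_le[OF \<gamma>])
      show "g2 q \<in> borel_measurable (law Y (Some x))" by (rule g2m[OF q])
      show "AE \<omega> in law Y (Some x). \<omega> \<in> Ev n k \<longrightarrow> discounted \<gamma> u 0 (shift Y (ennreal q) \<omega>) = g2 q \<omega>"
        using AE_good[of x]
      proof eventually_elim
        case (elim \<omega>)
        show ?case
        proof
          assume "\<omega> \<in> Ev n k"
          then have fin: "A q \<omega> < \<infinity>" by (simp add: Ev_def q_def)
          define b where "b = enn2real (A q \<omega>)"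
          have b: "0 \<le> b" "A q \<omega> = ennreal b" using fin by (simp_all add: b_def ennreal_enn2real)
          show "discounted \<gamma> u 0 (shift Y (ennreal q) \<omega>) = g2 q \<omega>"
            unfolding discounted_def g2_def b_def[symmetric]
            by (rule Bochner_Integration.integral_cong)
              (auto simp: indicator_def tc_path_shift[OF elim q _ b u])
        qed
      qed
      show "ext0 (apply_bcontfun w) \<in> borel_measurable borel_opc" by (rule ext0_measurable[OF w])
      show "(\<integral>\<omega>. discounted \<gamma> u 0 \<omega> \<partial>law Y y) = ext0 (apply_bcontfun w) y" for y
      proof (cases y)
        case None
        have "AE \<omega> in law Y None. discounted \<gamma> u 0 \<omega> = 0"
          using AE_pos_0[of None] AE_space
          by eventually_elim (auto simp: discounted_def tc_path_dead)
        then have "(\<integral>\<omega>. discounted \<gamma> u 0 \<omega> \<partial>law Y None) = 0" by (rule integral_eq_zero_AE)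
        then show ?thesis by (simp add: None)
      next
        case (Some z)
        then show ?thesis using tc_resolvent_eq_discounted[OF u, of \<gamma> z] w_eq[of z] by simp
      qed
    qed
    then show ?thesis by (simp add: g1_def q_def)
  qed
  have int: "integrable (law Y (Some x)) (\<lambda>\<omega>. indicator (Ev n k) \<omega> * h \<omega>)"
    if "h \<in> borel_measurable (law Y (Some x))" "\<And>\<omega>. \<bar>h \<omega>\<bar> \<le> B" for h :: "'w \<Rightarrow> real" and B n k
    using that Ev_law
    by (intro P.integrable_const_bound[of _ "max 0 B"]) (auto simp: indicator_def le_max_iff_disj)
  have Z_int: "(\<integral>\<omega>. Z g1 n \<omega> \<partial>law Y (Some x)) = (\<integral>\<omega>. Z g2 n \<omega> \<partial>law Y (Some x))" for n
  proof -
    have "(\<integral>\<omega>. Z g1 n \<omega> \<partial>law Y (Some x)) = (\<Sum>k\<in>{1..Suc n * Suc n}. \<integral>\<omega>. indicator (Ev n k) \<omega> * g1 (real k / real (Suc n)) \<omega> \<partial>law Y (Some x))"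
      by (subst Bochner_Integration.integral_sum[symmetric, OF int[OF g1m b1]])
        (rule Bochner_Integration.integral_cong, simp_all add: Z_eq del: of_nat_Suc)
    also have "\<dots> = (\<Sum>k\<in>{1..Suc n * Suc n}. \<integral>\<omega>. indicator (Ev n k) \<omega> * g2 (real k / real (Suc n)) \<omega> \<partial>law Y (Some x))"
      by (simp only: term_eq)
    also have "\<dots> = (\<integral>\<omega>. Z g2 n \<omega> \<partial>law Y (Some x))"
      by (subst Bochner_Integration.integral_sum[symmetric, OF int[OF g2m b2]])
        (simp, rule Bochner_Integration.integral_cong, simp_all add: Z_eq del: of_nat_Suc)
    finally show ?thesis .
  qed
  have Zm: "Z g n \<in> borel_measurable (law Y (Some x))" if "\<And>k. g (real k / real (Suc n)) \<in> borel_measurable (law Y (Some x))" for g n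
  proof -
    have "(\<lambda>\<omega>. \<Sum>k\<in>{1..Suc n * Suc n}. indicator (Ev n k) \<omega> * g (real k / real (Suc n)) \<omega>) \<in> borel_measurable (law Y (Some x))"
      using that Ev_law by (intro borel_measurable_sum borel_measurable_times borel_measurable_indicator) auto
    then show ?thesis by (rule measurable_cong[THEN iffD1, rotated]) (simp add: Z_eq)
  qed
  have Zb: "\<bar>Z g n \<omega>\<bar> \<le> B" if "good \<omega>" "0 \<le> B" "\<And>s. \<bar>g s \<omega>\<bar> \<le> B" for g n \<omega> B
  proof -
    interpret clock "\<lambda>t. A t \<omega>" by (rule good_clock[OF that(1)])
    show ?thesis unfolding Z_def by (rule abs_step_sum_le[OF r that(2)]) (use that in auto)
  qed
  have lims: "(\<lambda>n. Z g1 n \<omega>) \<longlonglongrightarrow> tc_path w r \<omega>" "(\<lambda>n. Z g2 n \<omega>) \<longlonglongrightarrow> discounted \<gamma> u r \<omega>" if g: "good \<omega>" for \<omega>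
  proof -
    interpret clock "\<lambda>t. A t \<omega>" by (rule good_clock[OF g])
    have *: "(\<lambda>n. Z g1 n \<omega>) \<longlonglongrightarrow> tc_path w r \<omega> \<and> (\<lambda>n. Z g2 n \<omega>) \<longlonglongrightarrow> discounted \<gamma> u r \<omega>"
    proof (cases "\<exists>s\<ge>0. ennreal r < A s \<omega>")
      case False
      have "\<not> (\<exists>s\<ge>0. ennreal (r + t) < A s \<omega>)" if "0 \<le> t" for t
        using False ennreal_leI[of r "r + t"] that by (auto dest: le_less_trans)
      then have "tc_path u (r + t) \<omega> = 0" if "0 \<le> t" for t
        using that r pos_infinity[OF good_paths[OF g]] by (simp add: tc_path_good[OF g _ u] passage_top)
      then have "discounted \<gamma> u r \<omega> = 0"
        unfolding discounted_def by (intro integral_eq_zero_AE AE_I2) (auto simp: indicator_def)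
      moreover have "tc_path w r \<omega> = 0"
        using r False pos_infinity[OF good_paths[OF g]] by (simp add: tc_path_good[OF g _ w] passage_top)
      ultimately show ?thesis using False by (simp add: Z_def step_sum_zero)
    next
      case True
      then obtain s0 where s0: "0 \<le> s0" "ennreal r < A s0 \<omega>" by blast
      obtain T where T: "0 \<le> T" "passage (\<lambda>s. A s \<omega>) r = ennreal T" "A T \<omega> = ennreal r"
        "\<And>s. 0 \<le> s \<Longrightarrow> ennreal r < A s \<omega> \<longleftrightarrow> T < s"
        by (rule passage_finite[OF r s0]) blast
      have "((\<lambda>s. A s \<omega>) \<longlongrightarrow> A T \<omega>) (at T within {0..})"
        using cont T(1) by (auto simp: continuous_on_def)
      \<comment> \<open>As the rounded times decrease to \<open>T\<close>, the clock tends to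
        \<open>r\<close> by continuity and is eventually finite, so the side condition in
        \<open>Z\<close> disappears and \<open>isCont_discounted\<close> carries the limit through
        \<open>g2\<close>.\<close>
      then have AT: "((\<lambda>s. A s \<omega>) \<longlongrightarrow> ennreal r) (at_right T)"
        unfolding T(3) by (rule tendsto_within_subset) (use T(1) in auto)
      have fin: "\<forall>\<^sub>F s in at_right T. A s \<omega> < \<infinity>"
        using order_tendstoD(2)[OF AT, of \<infinity>] by simp
      have lim: "(\<lambda>n. Z g n \<omega>) \<longlonglongrightarrow> l" if "((\<lambda>s. g s \<omega>) \<longlongrightarrow> l) (at_right T)" for g l
      proof -
        have "((\<lambda>s. if A s \<omega> < \<infinity> then g s \<omega> else 0) \<longlongrightarrow> l) (at_right T)"
          by (rule Lim_transform_eventually[OF that]) (use fin in \<open>auto elim: eventually_mono\<close>)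
        from step_sum_tendsto[OF T(1,4) this] show ?thesis by (simp add: Z_def)
      qed
      have "((\<lambda>s. g1 s \<omega>) \<longlongrightarrow> tc_path w r \<omega>) (at_right T)"
        unfolding g1_def tc_path_good[OF g r w] T(2) by (rule good_right_continuous[OF g w T(1)])
      moreover have "((\<lambda>s. enn2real (A s \<omega>)) \<longlongrightarrow> r) (at_right T)"
        using tendsto_enn2real[OF AT] r by simp
      then have "((\<lambda>s. g2 s \<omega>) \<longlongrightarrow> discounted \<gamma> u r \<omega>) (at_right T)"
        unfolding g2_def by (rule isCont_tendsto_compose[OF isCont_discounted[OF u good_paths[OF g] \<gamma>]])
      ultimately show ?thesis using lim by blast
    qed
    then show "(\<lambda>n. Z g1 n \<omega>) \<longlonglongrightarrow> tc_path w r \<omega>" "(\<lambda>n. Z g2 n \<omega>) \<longlonglongrightarrow> discounted \<gamma> u r \<omega>" by auto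
  qed
  have D: "discounted \<gamma> u r \<in> borel_measurable (law Y (Some x))"
    using nat_hist_law[OF discounted_measurable[OF u, of "\<lambda>_. r" \<gamma>]] by simp
  have "(\<lambda>n. \<integral>\<omega>. Z g1 n \<omega> \<partial>law Y (Some x)) \<longlonglongrightarrow> (\<integral>\<omega>. tc_path w r \<omega> \<partial>law Y (Some x))"
  proof (rule integral_dominated_convergence[where w="\<lambda>_. norm w"])
    show "AE \<omega> in law Y (Some x). (\<lambda>n. Z g1 n \<omega>) \<longlonglongrightarrow> tc_path w r \<omega>"
      using AE_good[of x] by eventually_elim (rule lims)
    show "AE \<omega> in law Y (Some x). norm (Z g1 n \<omega>) \<le> norm w" for n
      using AE_good[of x] by eventually_elim (use Zb[of _ "norm w" g1 n] b1 in auto)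
  qed (use Zm[of g1] g1m tc_path_law[OF w] in auto)
  moreover have "(\<lambda>n. \<integral>\<omega>. Z g2 n \<omega> \<partial>law Y (Some x)) \<longlonglongrightarrow> (\<integral>\<omega>. discounted \<gamma> u r \<omega> \<partial>law Y (Some x))"
  proof (rule integral_dominated_convergence[where w="\<lambda>_. norm u / \<gamma>"])
    show "AE \<omega> in law Y (Some x). (\<lambda>n. Z g2 n \<omega>) \<longlonglongrightarrow> discounted \<gamma> u r \<omega>"
      using AE_good[of x] by eventually_elim (rule lims)
    show "AE \<omega> in law Y (Some x). norm (Z g2 n \<omega>) \<le> norm u / \<gamma>" for n
      using AE_good[of x] by eventually_elim (use Zb[of _ "norm u / \<gamma>" g2 n] b2 \<gamma> in auto)
  qed (use Zm[of g2] g2m D in auto)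
  ultimately have "(\<integral>\<omega>. tc_path w r \<omega> \<partial>law Y (Some x)) = (\<integral>\<omega>. discounted \<gamma> u r \<omega> \<partial>law Y (Some x))"
    unfolding Z_int by (rule LIMSEQ_unique)
  then show ?thesis using integral_discounted[OF u \<gamma>, where b=r and x=x] by (simp add: tc_mean_def)
qed


section \<open>Total mass of the time-changed semigroup and potentials\<close>

text \<open>The mean of this indicator plays the role of T_t applied to the constant 1, which is not
  in \<open>C0\<close> unless the state space is compact. Integer times suffice because the clock is
  monotone on good paths, and they make measurability evident.\<close>

definition alive :: "real \<Rightarrow> 'w \<Rightarrow> real" where
  "alive t \<omega> = (if \<exists>n::nat. ennreal t < A (real n) \<omega> then 1 else 0)"

definition tc_alive :: "'a \<Rightarrow> real \<Rightarrow> real" where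
  "tc_alive x t = (\<integral>\<omega>. alive t \<omega> \<partial>law Y (Some x))"

lemma alive_measurable: "(\<lambda>(t, \<omega>). alive t \<omega>) \<in> borel_measurable (borel \<Otimes>\<^sub>M nat_hist Y \<infinity>)"
proof -
  have [measurable]: "A (real n) \<in> borel_measurable (nat_hist Y \<infinity>)" for n
    by (rule A_measurable) simp
  show ?thesis unfolding alive_def by measurable
qed

lemma alive_law: "alive t \<in> borel_measurable (law Y y)"
proof (rule nat_hist_law)
  have "(\<lambda>\<omega>. (t, \<omega>)) \<in> nat_hist Y \<infinity> \<rightarrow>\<^sub>M borel \<Otimes>\<^sub>M nat_hist Y \<infinity>" by simp
  from measurable_compose[OF this alive_measurable]
  show "alive t \<in> borel_measurable (nat_hist Y \<infinity>)" by simp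
qed

lemma alive_bounds: "0 \<le> alive t \<omega>" "alive t \<omega> \<le> 1"
  by (auto simp: alive_def)

lemma alive_integrable: "integrable (law Y y) (alive t)"
proof -
  interpret prob_space "law Y y" by (rule prob_law)
  show ?thesis by (rule integrable_const_bound[of _ 1]) (use alive_law alive_bounds in auto)
qed

lemma tc_alive_bounds: "0 \<le> tc_alive x t" "tc_alive x t \<le> 1"
proof -
  interpret prob_space "law Y (Some x)" by (rule prob_law)
  show "0 \<le> tc_alive x t" unfolding tc_alive_def by (rule integral_nonneg_AE) (simp add: alive_bounds)
  have "tc_alive x t \<le> (\<integral>\<omega>. 1 \<partial>law Y (Some x))"
    unfolding tc_alive_def by (rule integral_mono) (auto simp: alive_bounds alive_integrable)
  then show "tc_alive x t \<le> 1" using prob_space by simp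
qed

lemma tc_alive_measurable: "tc_alive x \<in> borel_measurable borel"
proof -
  interpret prob_space "law Y (Some x)" by (rule prob_law)
  have "tc_alive x \<in> borel_measurable lborel"
    unfolding tc_alive_def[abs_def]
    by (rule borel_measurable_lebesgue_integral[OF nat_hist_law_pair[OF alive_measurable]])
  then show ?thesis by simp
qed

lemma alive_good:
  assumes g: "good \<omega>" and t: "0 \<le> t"
  shows "alive t \<omega> = indicator (clock.range_clock (\<lambda>s. A s \<omega>)) t"
proof -
  interpret clock "\<lambda>t. A t \<omega>" by (rule good_clock[OF g])
  have "(\<exists>n::nat. ennreal t < A (real n) \<omega>) \<longleftrightarrow> (\<exists>s\<ge>0. ennreal t < A s \<omega>)"
  proof
    assume "\<exists>s\<ge>0. ennreal t < A s \<omega>"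
    then obtain s where s: "0 \<le> s" "ennreal t < A s \<omega>" by blast
    obtain n where "s \<le> real n" using real_arch_simple by blast
    with s mono[of s "real n"] show "\<exists>n::nat. ennreal t < A (real n) \<omega>" by (auto intro: less_le_trans)
  next
    assume "\<exists>n::nat. ennreal t < A (real n) \<omega>"
    then obtain n :: nat where "ennreal t < A (real n) \<omega>" by blast
    then show "\<exists>s\<ge>0. ennreal t < A s \<omega>" by (intro exI[of _ "real n"]) simp
  qed
  with t show ?thesis by (auto simp: alive_def range_clock_def)
qed

text \<open>A right-continuous function is the pointwise limit of its values at the rounded times,
  each of which depends on \<open>s\<close> only through an integer.\<close>

lemma path_measurable:
  assumes g: "good \<omega>" and u: "u \<in> C0"
  shows "(\<lambda>s. indicator {0..} s * ext0 (apply_bcontfun u) (pos Y (ennreal s) \<omega>)) \<in> borel_measurable borel"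
proof (rule borel_measurable_LIMSEQ_real)
  define r where "r s n = (of_int \<lfloor>s * real (Suc n)\<rfloor> + 1) / real (Suc n)" for s and n :: nat
  let ?h = "\<lambda>n s. indicator {0..} s * ext0 (apply_bcontfun u) (pos Y (ennreal (r s n)) \<omega>)"
  show "?h n \<in> borel_measurable borel" for n
  proof -
    have "(\<lambda>s::real. \<lfloor>s * real (Suc n)\<rfloor>) \<in> borel \<rightarrow>\<^sub>M count_space UNIV" by measurable
    then have "(\<lambda>s. (\<lambda>i. ext0 (apply_bcontfun u) (pos Y (ennreal ((of_int i + 1) / real (Suc n))) \<omega>)) \<lfloor>s * real (Suc n)\<rfloor>) \<in> borel_measurable borel"
      by (rule measurable_compose) simp
    then show ?thesis unfolding r_def by (intro borel_measurable_times borel_measurable_indicator) simp_all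
  qed
  fix s :: real
  show "(\<lambda>n. ?h n s) \<longlonglongrightarrow> indicator {0..} s * ext0 (apply_bcontfun u) (pos Y (ennreal s) \<omega>)"
  proof (cases "0 \<le> s")
    case True
    have "filterlim (r s) (at_right s) sequentially" unfolding r_def by (rule filterlim_grid_at_right)
    from filterlim_compose[OF good_right_continuous[OF g u True] this] show ?thesis
      by (intro tendsto_mult tendsto_const)
  qed simp
qed

text \<open>The clock stands still after the lifetime, whereas it exceeds \<open>t\<close>
  immediately after the passage time of a level \<open>t\<close> in its range; so the passage time
  precedes the lifetime.\<close>

lemma pos_passage_not_None:
  assumes g: "good \<omega>" and t: "t \<in> clock.range_clock (\<lambda>s. A s \<omega>)"
  shows "pos Y (passage (\<lambda>s. A s \<omega>) t) \<omega> \<noteq> None"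
proof
  interpret clock "\<lambda>t. A t \<omega>" by (rule good_clock[OF g])
  assume N: "pos Y (passage (\<lambda>s. A s \<omega>) t) \<omega> = None"
  define T where "T = position t"
  note T = position[OF t, folded T_def]
  have "lifetime Y \<omega> \<le> ennreal T"
    unfolding lifetime_def by (rule Inf_lower) (use N T(2) in simp)
  then have "A s \<omega> = A T \<omega>" if "T \<le> s" for s
    using good_A(3)[OF g T(1)] good_A(3)[OF g, of s] that T(1) by (auto intro: order_trans ennreal_leI)
  from this[of "T + 1"] have "A (T + 1) \<omega> = ennreal t" using T(3) by simp
  with T(4)[of "T + 1"] T(1) show False by simp
qed

text \<open>Substitute the inverse clock for the time. Before the lifetime the integrand is
  \<open>c + u\<close> at the current position, which splits into \<open>c * alive\<close> and the
  time-changed path; \<open>c\<close> bounds the norm so that everything stays nonnegative. The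
  factor \<open>exp (- 0 * s)\<close> keeps the shape of \<open>potential_formula\<close> at
  parameter 0.\<close>

lemma path_stieltjes:
  assumes g: "good \<omega>" and u: "u \<in> C0" and c: "norm u \<le> c"
  shows "(\<integral>\<^sup>+s\<in>{0..}. ennreal (exp (- 0 * s)) * ext0 (\<lambda>y. ennreal (c + apply_bcontfun u y)) (pos Y (ennreal s) \<omega>)
       \<partial>stieltjes (\<lambda>r. A r \<omega>)) = (\<integral>\<^sup>+t. ennreal (indicator {0..} t * (c * alive t \<omega> + tc_path u t \<omega>)) \<partial>lborel)"
proof -
  interpret clock "\<lambda>t. A t \<omega>" by (rule good_clock[OF g])
  define f where "f s = ennreal (c * (indicator {0..} s * (1 - (if pos Y (ennreal s) \<omega> = None then 1 else 0)))
     + indicator {0..} s * ext0 (apply_bcontfun u) (pos Y (ennreal s) \<omega>))" for s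
  have f_eq: "ennreal (exp (- 0 * s)) * ext0 (\<lambda>y. ennreal (c + apply_bcontfun u y)) (pos Y (ennreal s) \<omega>) * indicator {0..} s = f s" for s
    by (auto simp: f_def indicator_def split: option.splits)
  \<comment> \<open>The cemetery is absorbing, so being dead is monotone in time and the constant
    part of the integrand is Borel.\<close>
  have "mono (\<lambda>s::real. if pos Y (ennreal s) \<omega> = None then 1 else 0 :: real)"
  proof (rule monoI)
    fix s t :: real assume "s \<le> t"
    then show "(if pos Y (ennreal s) \<omega> = None then 1 else 0 :: real) \<le> (if pos Y (ennreal t) \<omega> = None then 1 else 0)"
      using pos_absorb[OF good_paths[OF g], of "ennreal s" "ennreal t"] by (auto simp: ennreal_leI)
  qed
  then have [measurable]: "(\<lambda>s::real. if pos Y (ennreal s) \<omega> = None then 1 else 0 :: real) \<in> borel_measurable borel"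
    by (rule borel_measurable_mono)
  note [measurable] = path_measurable[OF g u]
  have [measurable]: "f \<in> borel_measurable borel" unfolding f_def[abs_def] by measurable
  have "(\<integral>\<^sup>+s\<in>{0..}. ennreal (exp (- 0 * s)) * ext0 (\<lambda>y. ennreal (c + apply_bcontfun u y)) (pos Y (ennreal s) \<omega>) \<partial>stieltjes (\<lambda>r. A r \<omega>))
      = (\<integral>\<^sup>+s. f s \<partial>stieltjes (\<lambda>r. A r \<omega>))" by (simp only: f_eq)
  also have "\<dots> = (\<integral>\<^sup>+t. indicator range_clock t * f (position t) \<partial>lborel)"
    by (rule nn_integral_stieltjes) simp
  also have "\<dots> = (\<integral>\<^sup>+t. ennreal (indicator {0..} t * (c * alive t \<omega> + tc_path u t \<omega>)) \<partial>lborel)"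
  proof (rule nn_integral_cong)
    fix t :: real
    consider "t < 0" | "0 \<le> t" "t \<notin> range_clock" | "t \<in> range_clock" by fastforce
    then show "indicator range_clock t * f (position t) = ennreal (indicator {0..} t * (c * alive t \<omega> + tc_path u t \<omega>))"
    proof cases
      case 1
      then show ?thesis by (simp add: range_clock_def)
    next
      case 2
      then have "tc_path u t \<omega> = 0"
        using pos_infinity[OF good_paths[OF g]] by (simp add: tc_path_good[OF g 2(1) u] passage_top range_clock_def)
      with 2 show ?thesis by (simp add: alive_good[OF g])
    next
      case 3
      then have t: "0 \<le> t" by (simp add: range_clock_def)
      have "pos Y (ennreal (position t)) \<omega> \<noteq> None"
        using pos_passage_not_None[OF g 3] position(2)[OF 3] by simp
      then obtain y where "pos Y (ennreal (position t)) \<omega> = Some y" by blast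
      then show ?thesis
        using 3 t position(1,2)[OF 3] by (simp add: alive_good[OF g] tc_path_good[OF g t u] f_def)
    qed
  qed
  finally show ?thesis .
qed

lemma abs_tc_path_le_alive:
  assumes g: "good \<omega>" and t: "0 \<le> t" and u: "u \<in> C0"
  shows "\<bar>tc_path u t \<omega>\<bar> \<le> norm u * alive t \<omega>"
proof -
  interpret clock "\<lambda>t. A t \<omega>" by (rule good_clock[OF g])
  show ?thesis
  proof (cases "t \<in> range_clock")
    case False
    then have "tc_path u t \<omega> = 0"
      using t pos_infinity[OF good_paths[OF g]] by (simp add: tc_path_good[OF g t u] passage_top range_clock_def)
    then show ?thesis by (simp add: alive_bounds)
  qed (use abs_tc_path_le[of u t \<omega>] in \<open>simp add: alive_good[OF g t]\<close>)
qed

lemma abs_tc_mean_le_alive: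
  assumes t: "0 \<le> t" and u: "u \<in> C0"
  shows "\<bar>tc_mean x u t\<bar> \<le> norm u * tc_alive x t"
proof -
  have "\<bar>tc_mean x u t\<bar> \<le> (\<integral>\<omega>. norm u * alive t \<omega> \<partial>law Y (Some x))"
    unfolding tc_mean_def
  proof (rule order_trans[OF integral_abs_bound integral_mono_AE])
    show "AE \<omega> in law Y (Some x). \<bar>tc_path u t \<omega>\<bar> \<le> norm u * alive t \<omega>"
      using AE_good[of x] by eventually_elim (rule abs_tc_path_le_alive[OF _ t u])
  qed (use tc_path_integrable[OF u] alive_integrable in auto)
  then show ?thesis by (simp add: tc_alive_def)
qed

text \<open>Expectation of \<open>path_stieltjes\<close>, followed by Tonelli: the potential of
  \<mu> is the time integral of the means of the time-changed process. This is the bridge from the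
  kernel to the resolvents.\<close>

lemma potential_eq:
  assumes pot: "potential_formula Y p A \<mu>" and u: "u \<in> C0" and c: "norm u \<le> c"
  shows "(\<integral>\<^sup>+y. green p 0 x y * ennreal (c + apply_bcontfun u y) \<partial>\<mu>)
    = (\<integral>\<^sup>+t. ennreal (indicator {0..} t * (c * tc_alive x t + tc_mean x u t)) \<partial>lborel)"
proof -
  interpret Q: prob_space "law Y (Some x)" by (rule prob_law)
  interpret pair_sigma_finite lborel "law Y (Some x)" ..
  note [measurable] = nat_hist_law_pair[OF alive_measurable, of "Some x"] nat_hist_law_pair[OF tc_path_measurable[OF u], of "Some x"]
  have "(\<lambda>y. ennreal (c + apply_bcontfun u y)) \<in> borel_measurable borel"
    by (intro measurable_compose[OF _ measurable_ennreal] borel_measurable_continuous_onI continuous_intros continuous_on_apply_bcontfun)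
  then have "(\<integral>\<^sup>+y. green p 0 x y * ennreal (c + apply_bcontfun u y) \<partial>\<mu>)
    = (\<integral>\<^sup>+\<omega>. (\<integral>\<^sup>+s\<in>{0..}. ennreal (exp (- 0 * s)) * ext0 (\<lambda>y. ennreal (c + apply_bcontfun u y)) (pos Y (ennreal s) \<omega>)
       \<partial>stieltjes (\<lambda>r. A r \<omega>)) \<partial>law Y (Some x))"
    using pot[unfolded potential_formula_def, rule_format, of 0] by simp
  also have "\<dots> = (\<integral>\<^sup>+\<omega>. \<integral>\<^sup>+t. ennreal (indicator {0..} t * (c * alive t \<omega> + tc_path u t \<omega>)) \<partial>lborel \<partial>law Y (Some x))"
    by (rule nn_integral_cong_AE, use AE_good[of x] in eventually_elim) (rule path_stieltjes[OF _ u c])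
  also have "\<dots> = (\<integral>\<^sup>+t. \<integral>\<^sup>+\<omega>. ennreal (indicator {0..} t * (c * alive t \<omega> + tc_path u t \<omega>)) \<partial>law Y (Some x) \<partial>lborel)"
    by (rule Fubini') measurable
  also have "\<dots> = (\<integral>\<^sup>+t. ennreal (indicator {0..} t * (c * tc_alive x t + tc_mean x u t)) \<partial>lborel)"
  proof (rule nn_integral_cong)
    fix t :: real
    show "(\<integral>\<^sup>+\<omega>. ennreal (indicator {0..} t * (c * alive t \<omega> + tc_path u t \<omega>)) \<partial>law Y (Some x))
       = ennreal (indicator {0..} t * (c * tc_alive x t + tc_mean x u t))"
    proof (cases "0 \<le> t")
      case True
      have "(\<integral>\<^sup>+\<omega>. ennreal (c * alive t \<omega> + tc_path u t \<omega>) \<partial>law Y (Some x)) = ennreal (\<integral>\<omega>. c * alive t \<omega> + tc_path u t \<omega> \<partial>law Y (Some x))"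
      proof (rule nn_integral_eq_integral)
        show "AE \<omega> in law Y (Some x). 0 \<le> c * alive t \<omega> + tc_path u t \<omega>"
          using AE_good[of x]
        proof eventually_elim
          case (elim \<omega>)
          have "norm u * alive t \<omega> \<le> c * alive t \<omega>" by (intro mult_right_mono c alive_bounds)
          with abs_tc_path_le_alive[OF elim True u] show ?case by linarith
        qed
      qed (use alive_integrable tc_path_integrable[OF u] in auto)
      then show ?thesis
        using True alive_integrable[of "Some x" t] tc_path_integrable[OF u, of "Some x" t]
        by (simp add: tc_alive_def tc_mean_def)
    qed simp
  qed
  finally show ?thesis .
qed

end


section \<open>Uniform convergence of potentials\<close>

text \<open>Inf-convolution of the truncation of \<open>G\<close> at \<open>k\<close> with
  \<open>k\<close> times the distance. It is the largest \<open>k\<close>-Lipschitz function below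
  the truncation, and lower semicontinuity makes these functions increase to
  \<open>G\<close>.\<close>

lemma lipschitz_minorants:
  fixes G :: "'z::metric_space \<Rightarrow> ennreal"
  assumes lsc: "lower_semicontinuous G"
  obtains L :: "nat \<Rightarrow> 'z \<Rightarrow> real" where
    "\<And>k z. 0 \<le> L k z" "\<And>k z. L k z \<le> real k" "\<And>k z. ennreal (L k z) \<le> G z"
    "\<And>k z z'. L k z \<le> L k z' + real k * dist z z'"
    "\<And>z. incseq (\<lambda>k. L k z)" "\<And>z. (SUP k. ennreal (L k z)) = G z"
proof
  define m where "m k z = enn2real (min (G z) (of_nat k))" for k :: nat and z
  define L where "L k z = (INF z'. m k z' + real k * dist z z')" for k z
  have fin: "min (G z) (of_nat k) < top" for z k by (simp add: min_less_iff_disj of_nat_less_top)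
  have m: "ennreal (m k z) = min (G z) (of_nat k)" for k z
    using fin by (simp add: m_def ennreal_enn2real)
  have m0: "0 \<le> m k z" for k z by (simp add: m_def)
  have bdd: "bdd_below (range (\<lambda>z'. m k z' + real k * dist z z'))" for k z
    by (rule bdd_belowI[of _ 0]) (use m0 in \<open>auto intro!: add_nonneg_nonneg\<close>)
  have le: "L k z \<le> m k z' + real k * dist z z'" for k z z'
    unfolding L_def by (rule cINF_lower[OF bdd]) simp
  have ge: "c \<le> L k z" if "\<And>z'. c \<le> m k z' + real k * dist z z'" for c k z
    unfolding L_def by (rule cINF_greatest) (use that in auto)
  show L0: "0 \<le> L k z" for k z by (rule ge) (use m0 in \<open>auto intro!: add_nonneg_nonneg\<close>)
  have Lm: "L k z \<le> m k z" for k z using le[of k z z] by simp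
  have mk: "m k z \<le> real k" for k z
  proof -
    have "ennreal (m k z) \<le> ennreal (real k)" unfolding m by (simp add: ennreal_of_nat_eq_real_of_nat)
    then show ?thesis by simp
  qed
  show "L k z \<le> real k" for k z using Lm mk order_trans by blast
  show LG: "ennreal (L k z) \<le> G z" for k z
  proof -
    have "ennreal (L k z) \<le> ennreal (m k z)" by (rule ennreal_leI[OF Lm])
    also have "\<dots> \<le> G z" by (simp add: m)
    finally show ?thesis .
  qed
  show "L k z \<le> L k z' + real k * dist z z'" for k z z'
  proof -
    have "L k z - real k * dist z z' \<le> L k z'"
    proof (rule ge)
      fix y
      have "real k * dist z y \<le> real k * (dist z z' + dist z' y)"
        by (intro mult_left_mono dist_triangle) simp
      then show "L k z - real k * dist z z' \<le> m k y + real k * dist z' y"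
        using le[of k z y] by (simp add: distrib_left)
    qed
    then show ?thesis by simp
  qed
  show inc: "incseq (\<lambda>k. L k z)" for z
  proof (rule incseq_SucI, rule ge)
    fix k z'
    have "ennreal (m k z') \<le> ennreal (m (Suc k) z')" unfolding m
      by (intro min.mono order_refl) (simp add: ennreal_of_nat_eq_real_of_nat ennreal_leI)
    then have "m k z' \<le> m (Suc k) z'" using m0 by simp
    moreover have "real k * dist z z' \<le> real (Suc k) * dist z z'" by (intro mult_right_mono) auto
    ultimately show "L k z \<le> m (Suc k) z' + real (Suc k) * dist z z'" using le[of k z z'] by linarith
  qed
  show "(SUP k. ennreal (L k z)) = G z" for z
  proof (rule antisym)
    show "(SUP k. ennreal (L k z)) \<le> G z" by (rule SUP_least) (rule LG)
    show "G z \<le> (SUP k. ennreal (L k z))"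
    proof (rule dense_le)
      fix c assume c: "c < G z"
      then have "c < top" by (rule less_le_trans) simp
      then obtain c' where c': "c = ennreal c'" "0 \<le> c'" by (cases c) auto
      have "open {z. c < G z}" using lsc by (simp add: lower_semicontinuous_def)
      then obtain d where d: "0 < d" "\<And>z'. dist z' z < d \<Longrightarrow> c < G z'"
        using c unfolding open_dist by blast
      \<comment> \<open>The first bound makes the truncation at least \<open>c'\<close> near
        \<open>z\<close>, where \<open>G\<close> exceeds \<open>c\<close>; the second makes the
        penalty at least \<open>c'\<close> at distance \<open>d\<close> or more.\<close>
      obtain k :: nat where k: "c' \<le> real k" "c' / d \<le> real k"
        using real_arch_simple[of "max c' (c' / d)"] by auto
      have "c' \<le> L k z"
      proof (rule ge)
        fix z'
        show "c' \<le> m k z' + real k * dist z z'"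
        proof (cases "dist z' z < d")
          case True
          have "ennreal c' \<le> ennreal (m k z')"
            unfolding m using d(2)[OF True] k(1) c' by (simp add: ennreal_of_nat_eq_real_of_nat ennreal_leI)
          then have "c' \<le> m k z'" using m0 by simp
          then show ?thesis by (simp add: add_increasing2)
        next
          case False
          have "c' \<le> real k * d" using k(2) d(1) by (simp add: divide_le_eq)
          also have "\<dots> \<le> real k * dist z z'" using False by (intro mult_left_mono) (auto simp: dist_commute)
          finally show ?thesis using m0[of k z'] by linarith
        qed
      qed
      then have "c \<le> ennreal (L k z)" using c' by (simp add: ennreal_leI)
      then show "c \<le> (SUP k. ennreal (L k z))" by (rule order_trans) (rule SUP_upper, simp)
    qed
  qed
qed

lemma locally_compact_neighbourhood:
  assumes "locally_compact_space (euclidean :: 'a::topological_space topology)"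
  obtains U K where "open U" "compact K" "(x::'a::topological_space) \<in> U" "U \<subseteq> K"
proof -
  have "\<exists>U K. open U \<and> compact K \<and> x \<in> U \<and> U \<subseteq> K"
    using assms unfolding locally_compact_space_def by simp
  then show thesis using that by blast
qed

text \<open>Countably many open sets with compact hulls cover the space by the Lindelof property;
  finite unions of the hulls give an increasing sequence.\<close>

lemma compact_exhaustion:
  assumes lc: "locally_compact_space (euclidean :: 'a::{metric_space, second_countable_topology} topology)"
  obtains C :: "nat \<Rightarrow> 'a::{metric_space, second_countable_topology} set" where "\<And>n. compact (C n)" "incseq C" "(\<Union>n. C n) = UNIV"
proof -
  define F where "F = {U::'a set. open U \<and> (\<exists>K. compact K \<and> U \<subseteq> K)}"
  have "\<Union>F = UNIV"
  proof -
    have "x \<in> \<Union>F" for x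
    proof -
      obtain U K where "open U" "compact K" "x \<in> U" "U \<subseteq> K" by (rule locally_compact_neighbourhood[OF lc])
      then show ?thesis by (auto simp: F_def)
    qed
    then show ?thesis by blast
  qed
  moreover obtain F' where F': "F' \<subseteq> F" "countable F'" "\<Union>F' = \<Union>F"
    by (rule Lindelof[of F]) (auto simp: F_def)
  ultimately have U: "\<Union>F' = UNIV" by simp
  then have "F' \<noteq> {}" by auto
  define V where "V = from_nat_into F'"
  have V: "range V = F'" unfolding V_def by (rule range_from_nat_into[OF \<open>F' \<noteq> {}\<close> F'(2)])
  have "\<forall>n. \<exists>K. compact K \<and> V n \<subseteq> K" using V F'(1) by (auto simp: F_def)
  from choice[OF this] obtain K where K: "compact (K n)" "V n \<subseteq> K n" for n by blast
  show thesis
  proof (rule that[of "\<lambda>n. \<Union>i\<le>n. K i"])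
    show "compact (\<Union>i\<le>n. K i)" for n using K(1) by (intro compact_UN) auto
    show "incseq (\<lambda>n. \<Union>i\<le>n. K i)" by (auto simp: incseq_def intro: order_trans)
    show "(\<Union>n. \<Union>i\<le>n. K i) = UNIV"
    proof (rule UNIV_eq_I[symmetric])
      fix x
      obtain n where "x \<in> V n" using U V by blast
      then have "x \<in> K n" using K(2) by blast
      then show "x \<in> (\<Union>n. \<Union>i\<le>n. K i)" by blast
    qed
  qed
qed

lemma compact_cutoff:
  fixes C :: "'a::metric_space set"
  assumes lc: "locally_compact_space (euclidean :: 'a topology)" and C: "compact C"
  obtains \<eta> :: "'a \<Rightarrow> real" and K where "continuous_on UNIV \<eta>" "\<And>x. 0 \<le> \<eta> x" "\<And>x. \<eta> x \<le> 1" "\<And>x. x \<in> C \<Longrightarrow> \<eta> x = 1"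
    "compact K" "\<And>x. x \<notin> K \<Longrightarrow> \<eta> x = 0"
proof -
  have "\<forall>x::'a. \<exists>p. open (fst p) \<and> compact (snd p) \<and> x \<in> fst p \<and> fst p \<subseteq> snd p"
  proof
    fix x :: 'a
    obtain U K where "open U" "compact K" "x \<in> U" "U \<subseteq> K" by (rule locally_compact_neighbourhood[OF lc])
    then show "\<exists>p. open (fst p) \<and> compact (snd p) \<and> x \<in> fst p \<and> fst p \<subseteq> snd p"
      by (intro exI[of _ "(U, K)"]) simp
  qed
  from choice[OF this] obtain p where
    p: "\<forall>x::'a. open (fst (p x)) \<and> compact (snd (p x)) \<and> x \<in> fst (p x) \<and> fst (p x) \<subseteq> snd (p x)" by blast
  define U where "U x = fst (p x)" for x
  define K where "K x = snd (p x)" for x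
  have UK: "open (U x)" "compact (K x)" "x \<in> U x" "U x \<subseteq> K x" for x
    using p by (simp_all add: U_def K_def)
  have "C \<subseteq> (\<Union>x\<in>C. U x)" using UK(3) by blast
  then obtain D where D: "D \<subseteq> C" "finite D" "C \<subseteq> (\<Union>x\<in>D. U x)"
    by (rule compactE_image[OF C UK(1)])
  define V where "V = (\<Union>x\<in>D. U x)"
  define K' where "K' = (\<Union>x\<in>D. K x)"
  have V1: "open V" unfolding V_def by (rule open_UN) (rule ballI, rule UK(1))
  have V2: "C \<subseteq> V" unfolding V_def by (rule D(3))
  have V3: "V \<subseteq> K'" unfolding V_def K'_def by (rule UN_mono[OF order_refl UK(4)])
  note V = V1 V2 V3
  have K': "compact K'" unfolding K'_def using UK(2) D(2) by (intro compact_UN) auto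
  show thesis
  \<comment> \<open>\<open>infdist\<close> to the empty set is 0 by convention, so the quotient of
    distances below is a cut-off only if both sets are nonempty.\<close>
  proof (cases "V = UNIV \<or> C = {}")
    case True
    then show thesis
    proof
      assume "V = UNIV"
      then have "K' = UNIV" using V by auto
      then show thesis using that[of "\<lambda>_. 1" K'] K' by auto
    next
      assume "C = {}"
      then show thesis using that[of "\<lambda>_. 0" "{}"] by auto
    qed
  next
    case False
    define \<eta> where "\<eta> y = infdist y (- V) / (infdist y (- V) + infdist y C)" for y
    have ne: "- V \<noteq> {}" "C \<noteq> {}" using False by auto
    have cl: "closed (- V)" "closed C" using V(1) C by (auto intro: compact_imp_closed)
    have z1: "infdist y (- V) = 0 \<longleftrightarrow> y \<notin> V" for y
      using in_closed_iff_infdist_zero[OF cl(1) ne(1), of y] by simp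
    have z2: "infdist y C = 0 \<longleftrightarrow> y \<in> C" for y
      using in_closed_iff_infdist_zero[OF cl(2) ne(2), of y] by simp
    have pos: "0 < infdist y (- V) + infdist y C" for y
      using z1[of y] z2[of y] V(2) infdist_nonneg[of y "- V"] infdist_nonneg[of y C] by force
    show thesis
    proof (rule that[of \<eta> K'])
      show "continuous_on UNIV \<eta>" unfolding \<eta>_def[abs_def]
        by (intro continuous_intros) (use pos in \<open>simp add: less_imp_neq[symmetric] order_less_imp_not_eq2\<close>)
      show "0 \<le> \<eta> x" for x using pos[of x] infdist_nonneg[of x "- V"] by (simp add: \<eta>_def)
      show "\<eta> x \<le> 1" for x using pos[of x] infdist_nonneg[of x C] by (simp add: \<eta>_def divide_le_eq)
      show "\<eta> x = 1" if "x \<in> C" for x using pos[of x] z2[of x] that by (simp add: \<eta>_def)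
      show "\<eta> x = 0" if "x \<notin> K'" for x using z1[of x] that V(3) by (auto simp: \<eta>_def)
    qed (rule K')
  qed
qed

lemma lower_semicontinuous_section:
  fixes G :: "'a::topological_space \<Rightarrow> 'b::topological_space \<Rightarrow> ennreal"
  assumes "lower_semicontinuous (\<lambda>(x, y). G x y)"
  shows "G x \<in> borel_measurable borel"
proof (rule borel_measurableI_greater)
  fix c
  have "open {z. c < (case z of (x, y) \<Rightarrow> G x y)}" using assms by (simp add: lower_semicontinuous_def)
  from open_vimage[OF this, of "Pair x"] have "open (Pair x -` {z. c < (case z of (x, y) \<Rightarrow> G x y)})"
    by (simp add: continuous_on_Pair)
  moreover have "Pair x -` {z. c < (case z of (x, y) \<Rightarrow> G x y)} = {y. c < G x y}" by auto
  ultimately show "{y \<in> space borel. c < G x y} \<in> sets borel" by simp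
qed

text \<open>A single test function serves all \<open>x'\<close> near \<open>x\<close>: for
  \<open>x'\<close> in the ball of radius \<open>d\<close>, the Lipschitz minorant at
  \<open>x\<close> lowered by \<open>real k * d\<close> is still below the minorant at
  \<open>x'\<close>, hence below \<open>G x'\<close>. Multiplied by a cut-off and by
  \<open>f\<close> it is continuous with compact support, so vague convergence applies to
  it.\<close>

lemma vague_limit_kernel_liminf:
  fixes G :: "'a::{metric_space, second_countable_topology} \<Rightarrow> 'a \<Rightarrow> ennreal" and f :: "'a \<Rightarrow> real"
  assumes lc: "locally_compact_space (euclidean :: 'a topology)"
    and lsc: "lower_semicontinuous (\<lambda>(x, y). G x y)"
    and N: "radon N" and M: "\<And>n. radon (M n)" and vague: "vague_limit M N"
    and f: "continuous_on UNIV f" "\<And>y. 0 \<le> f y" "\<And>y. f y \<le> B"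
    and c: "0 \<le> c" "ennreal c < (\<integral>\<^sup>+y. G x y * ennreal (f y) \<partial>N)"
  obtains U where "open U" "x \<in> U"
    "\<forall>\<^sub>F n in sequentially. \<forall>x'\<in>U. ennreal c < (\<integral>\<^sup>+y. G x' y * ennreal (f y) \<partial>M n)"
proof -
  obtain L :: "nat \<Rightarrow> 'a \<times> 'a \<Rightarrow> real" where
    L: "\<And>k z. 0 \<le> L k z" "\<And>k z. L k z \<le> real k" "\<And>k z. ennreal (L k z) \<le> (case z of (x, y) \<Rightarrow> G x y)"
    "\<And>k z z'. L k z \<le> L k z' + real k * dist z z'"
    "\<And>z. incseq (\<lambda>k. L k z)" "\<And>z. (SUP k. ennreal (L k z)) = (case z of (x, y) \<Rightarrow> G x y)"
    using lipschitz_minorants[OF lsc] by blast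
  obtain C :: "nat \<Rightarrow> 'a set" where C: "\<And>n. compact (C n)" "incseq C" "(\<Union>n. C n) = UNIV"
    using compact_exhaustion[OF lc] by blast
  have setsN: "sets N = sets borel" using N by (simp add: radon_def)
  have setsM: "sets (M n) = sets borel" for n using M[of n] by (simp add: radon_def)
  have Lc: "continuous_on UNIV (\<lambda>y. L k (x, y))" for k
  proof -
    have "k-lipschitz_on UNIV (\<lambda>y. L k (x, y))"
    proof (rule lipschitz_onI)
      fix y z
      have "L k (x, y) \<le> L k (x, z) + real k * dist y z" "L k (x, z) \<le> L k (x, y) + real k * dist y z"
        using L(4)[of k "(x, y)" "(x, z)"] L(4)[of k "(x, z)" "(x, y)"] by (simp_all add: dist_Pair_Pair dist_commute)
      then show "dist (L k (x, y)) (L k (x, z)) \<le> real k * dist y z" by (simp add: dist_real_def abs_le_iff)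
    qed simp
    then show ?thesis by (rule lipschitz_on_continuous_on)
  qed
  have [measurable]: "(\<lambda>y. L k (x, y)) \<in> borel_measurable N" for k
    using borel_measurable_continuous_onI[OF Lc] setsN by (simp cong: measurable_cong_sets)
  have [measurable]: "f \<in> borel_measurable N"
    using borel_measurable_continuous_onI[OF f(1)] setsN by (simp cong: measurable_cong_sets)
  have [measurable]: "C k \<in> sets N" for k
    using C(1) setsN by (simp add: borel_compact)
  \<comment> \<open>The same index drives the compact exhaustion and the minorants, so one
    application of monotone convergence yields one \<open>k\<close> for which the integral still
    exceeds \<open>c\<close>.\<close>
  define h where "h k y = indicator (C k) y * ennreal (L k (x, y)) * ennreal (f y)" for k y
  have [measurable]: "h k \<in> borel_measurable N" for k unfolding h_def[abs_def] by measurable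
  have h_inc: "h k y \<le> h l y" if "k \<le> l" for k l y
    unfolding h_def using that C(2) L(5)[of "(x, y)"]
    by (intro mult_mono ennreal_leI) (auto simp: indicator_def incseq_def)
  have h_SUP: "(SUP k. h k y) = G x y * ennreal (f y)" for y
  proof -
    obtain k0 where k0: "y \<in> C k0" using C(3) by blast
    have "(SUP k. h k y) = (SUP k. ennreal (L k (x, y)) * ennreal (f y))"
    proof (rule antisym; rule SUP_least)
      fix k
      show "h k y \<le> (SUP k. ennreal (L k (x, y)) * ennreal (f y))"
        by (rule order_trans[OF _ SUP_upper[of k]]) (auto simp: h_def indicator_def)
      have "ennreal (L k (x, y)) * ennreal (f y) \<le> h (max k k0) y"
      proof -
        have "y \<in> C (max k k0)" using k0 incseqD[OF C(2), of k0 "max k k0"] by auto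
        then have "h (max k k0) y = ennreal (L (max k k0) (x, y)) * ennreal (f y)" by (simp add: h_def)
        moreover have "L k (x, y) \<le> L (max k k0) (x, y)" using L(5)[of "(x, y)"] by (auto simp: incseq_def)
        ultimately show ?thesis by (auto intro!: mult_right_mono ennreal_leI)
      qed
      then show "ennreal (L k (x, y)) * ennreal (f y) \<le> (SUP k. h k y)" by (rule order_trans) (rule SUP_upper, simp)
    qed
    also have "\<dots> = (SUP k. ennreal (L k (x, y))) * ennreal (f y)" by (rule SUP_mult_right_ennreal[symmetric])
    also have "\<dots> = G x y * ennreal (f y)" using L(6)[of "(x, y)"] by simp
    finally show ?thesis .
  qed
  have "(\<integral>\<^sup>+y. G x y * ennreal (f y) \<partial>N) = (SUP k. \<integral>\<^sup>+y. h k y \<partial>N)"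
    unfolding h_SUP[symmetric]
    by (rule nn_integral_monotone_convergence_SUP) (auto simp: incseq_def le_fun_def h_inc)
  with c(2) obtain k where k: "ennreal c < (\<integral>\<^sup>+y. h k y \<partial>N)" by (auto simp: less_SUP_iff)
  obtain \<eta> :: "'a \<Rightarrow> real" and K where \<eta>: "continuous_on UNIV \<eta>" "\<And>x. 0 \<le> \<eta> x" "\<And>x. \<eta> x \<le> 1" "\<And>x. x \<in> C k \<Longrightarrow> \<eta> x = 1"
    "compact K" "\<And>x. x \<notin> K \<Longrightarrow> \<eta> x = 0"
    using compact_cutoff[OF lc C(1)[of k]] by blast
  define \<phi> where "\<phi> d y = \<eta> y * max 0 (L k (x, y) - real k * d) * f y" for d y
  have \<phi>0: "0 \<le> \<phi> d y" for d y by (simp add: \<phi>_def \<eta>(2) f(2))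
  have \<phi>c: "continuous_on UNIV (\<phi> d)" for d
    unfolding \<phi>_def[abs_def] by (intro continuous_intros \<eta> Lc f)
  have \<phi>m: "\<phi> d \<in> borel_measurable M'" if "sets M' = sets borel" for d and M' :: "'a measure"
    using borel_measurable_continuous_onI[OF \<phi>c] that by (simp cong: measurable_cong_sets)
  have B: "0 \<le> B" using f(2,3) order_trans by blast
  have NC: "emeasure N (C k) < \<infinity>" using N C(1) by (simp add: radon_def)
  define R where "R = measure N (C k)"
  have R: "emeasure N (C k) = ennreal R" using NC by (simp add: R_def emeasure_eq_ennreal_measure)
  have R0: "0 \<le> R" by (simp add: R_def)
  have hle: "(\<integral>\<^sup>+y. h k y \<partial>N) \<le> (\<integral>\<^sup>+y. ennreal (\<phi> d y) \<partial>N) + ennreal (real k * d * B * R)" if d: "0 \<le> d" for d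
  proof -
    have "(\<integral>\<^sup>+y. h k y \<partial>N) \<le> (\<integral>\<^sup>+y. ennreal (\<phi> d y) + ennreal (real k * d * B) * indicator (C k) y \<partial>N)"
    proof (rule nn_integral_mono)
      fix y
      show "h k y \<le> ennreal (\<phi> d y) + ennreal (real k * d * B) * indicator (C k) y"
      proof (cases "y \<in> C k")
        case True
        have "L k (x, y) * f y \<le> (max 0 (L k (x, y) - real k * d) + real k * d) * f y"
          by (rule mult_right_mono[OF _ f(2)]) simp
        also have "\<dots> \<le> \<phi> d y + real k * d * B"
          using mult_left_mono[OF f(3)[of y], of "real k * d"] d True by (simp add: \<phi>_def \<eta>(4) distrib_right)
        finally have "ennreal (L k (x, y) * f y) \<le> ennreal (\<phi> d y + real k * d * B)" by (rule ennreal_leI)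
        then show ?thesis using True L(1)[of k "(x, y)"] \<phi>0[of d y] d B by (simp add: h_def ennreal_mult' ennreal_plus)
      qed (simp add: h_def)
    qed
    also have "\<dots> = (\<integral>\<^sup>+y. ennreal (\<phi> d y) \<partial>N) + ennreal (real k * d * B) * emeasure N (C k)"
      using \<phi>m[OF setsN] by (subst nn_integral_add) (auto simp: nn_integral_cmult_indicator)
    also have "ennreal (real k * d * B) * emeasure N (C k) = ennreal (real k * d * B * R)"
      using d B R0 by (simp add: R ennreal_mult')
    finally show ?thesis .
  qed
  have int_le: "ennreal (\<integral>y. \<phi> d y \<partial>M') \<le> (\<integral>\<^sup>+y. ennreal (\<phi> d y) \<partial>M')" if "sets M' = sets borel" for d and M' :: "'a measure"
    using \<phi>m[OF that, of d] by (subst integral_eq_nn_integral) (auto simp: \<phi>0 ennreal_enn2real_if)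
  obtain d where d: "0 < d" "ennreal c < (\<integral>\<^sup>+y. ennreal (\<phi> d y) \<partial>N)"
  proof -
    obtain c2 where c2: "ennreal c < c2" "c2 < (\<integral>\<^sup>+y. h k y \<partial>N)" using k dense by blast
    then have "c2 < top" by (auto intro: less_le_trans)
    then obtain c3 where c3: "c2 = ennreal c3" "0 \<le> c3" by (cases c2) auto
    have cc: "c < c3" using c2(1) c3 c(1) by (simp add: ennreal_less_iff)
    \<comment> \<open>Lowering the minorant by \<open>real k * d\<close> costs at most
      \<open>real k * d * B * R\<close> on \<open>C k\<close>, which must not exceed the available
      margin \<open>c3 - c\<close>; the added 1 keeps the denominator positive.\<close>
    define d where "d = (c3 - c) / (real k * B * R + 1)"
    have den: "0 < real k * B * R + 1" using B R0 by (simp add: add_nonneg_pos)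
    have d: "0 < d" using cc den by (simp add: d_def)
    have "real k * d * B * R = d * (real k * B * R + 1) - d" by (simp add: algebra_simps)
    also have "\<dots> \<le> c3 - c" using den d by (simp add: d_def)
    finally have le: "real k * d * B * R \<le> c3 - c" .
    have "\<not> (\<integral>\<^sup>+y. ennreal (\<phi> d y) \<partial>N) \<le> ennreal c"
    proof
      assume "(\<integral>\<^sup>+y. ennreal (\<phi> d y) \<partial>N) \<le> ennreal c"
      then have "(\<integral>\<^sup>+y. h k y \<partial>N) \<le> ennreal c + ennreal (c3 - c)"
        using hle[of d] d le by (auto intro: order_trans[OF _ add_mono] ennreal_leI)
      also have "\<dots> = ennreal c3" using c(1) cc by (simp flip: ennreal_plus)
      finally show False using c2(2) c3 by simp
    qed
    then show thesis using that[OF d] by (simp add: not_le)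
  qed
  have "(\<integral>y. \<phi> d y \<partial>N) > c"
  proof -
    have "(\<integral>\<^sup>+y. ennreal (\<phi> d y) \<partial>N) < \<infinity>"
    proof -
      have "(\<integral>\<^sup>+y. ennreal (\<phi> d y) \<partial>N) \<le> (\<integral>\<^sup>+y. ennreal (real k * B) * indicator K y \<partial>N)"
      proof (rule nn_integral_mono)
        fix y
        show "ennreal (\<phi> d y) \<le> ennreal (real k * B) * indicator K y"
        proof (cases "y \<in> K")
          case True
          have "real k * d \<ge> 0" using d by simp
          then have "max 0 (L k (x, y) - real k * d) \<le> real k" using L(2)[of k "(x, y)"] by simp
          then have "\<eta> y * max 0 (L k (x, y) - real k * d) * f y \<le> 1 * real k * B"
            by (intro mult_mono \<eta> f) (auto simp: \<eta>(2) B f(2))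
          then show ?thesis using True by (simp add: \<phi>_def ennreal_leI)
        qed (simp add: \<phi>_def \<eta>(6))
      qed
      also have "\<dots> = ennreal (real k * B) * emeasure N K"
        by (rule nn_integral_cmult_indicator) (use \<eta>(5) setsN in \<open>simp add: borel_compact\<close>)
      also have "\<dots> < \<infinity>" using N \<eta>(5) by (simp add: radon_def ennreal_mult_less_top)
      finally show ?thesis .
    qed
    then have "ennreal (\<integral>y. \<phi> d y \<partial>N) = (\<integral>\<^sup>+y. ennreal (\<phi> d y) \<partial>N)"
      using \<phi>m[OF setsN, of d] by (subst integral_eq_nn_integral) (auto simp: \<phi>0 ennreal_enn2real)
    with d(2) c(1) show ?thesis by (metis ennreal_less_iff)
  qed
  moreover have "(\<lambda>n. \<integral>y. \<phi> d y \<partial>M n) \<longlonglongrightarrow> (\<integral>y. \<phi> d y \<partial>N)"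
  proof -
    have "\<exists>K. compact K \<and> (\<forall>x. x \<notin> K \<longrightarrow> \<phi> d x = 0)"
      using \<eta>(5,6) by (intro exI[of _ K]) (simp add: \<phi>_def)
    with \<phi>c vague show ?thesis unfolding vague_limit_def by blast
  qed
  ultimately have ev: "\<forall>\<^sub>F n in sequentially. c < (\<integral>y. \<phi> d y \<partial>M n)" by (simp add: order_tendstoD(1))
  show thesis
  proof (rule that[of "ball x d"])
    show "\<forall>\<^sub>F n in sequentially. \<forall>x'\<in>ball x d. ennreal c < (\<integral>\<^sup>+y. G x' y * ennreal (f y) \<partial>M n)"
      using ev
    proof eventually_elim
      case (elim n)
      show ?case
      proof
        fix x' assume x': "x' \<in> ball x d"
        have "ennreal c < ennreal (\<integral>y. \<phi> d y \<partial>M n)" using elim c(1) by (simp add: ennreal_less_iff)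
        also have "\<dots> \<le> (\<integral>\<^sup>+y. ennreal (\<phi> d y) \<partial>M n)" by (rule int_le[OF setsM])
        also have "\<dots> \<le> (\<integral>\<^sup>+y. G x' y * ennreal (f y) \<partial>M n)"
        proof (rule nn_integral_mono)
          fix y
          have "L k (x, y) \<le> L k (x', y) + real k * dist x x'"
            using L(4)[of k "(x, y)" "(x', y)"] by (simp add: dist_Pair_Pair)
          moreover have "real k * dist x x' \<le> real k * d" using x' by (intro mult_left_mono) auto
          ultimately have "max 0 (L k (x, y) - real k * d) \<le> L k (x', y)" using L(1)[of k "(x', y)"] by simp
          then have "\<eta> y * max 0 (L k (x, y) - real k * d) * f y \<le> 1 * L k (x', y) * f y"
            by (intro mult_mono \<eta> f) (auto simp: \<eta>(2) f(2) L(1))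
          then have "ennreal (\<phi> d y) \<le> ennreal (L k (x', y)) * ennreal (f y)"
            using L(1) by (simp add: \<phi>_def ennreal_leI flip: ennreal_mult')
          also have "\<dots> \<le> G x' y * ennreal (f y)" using L(3)[of k "(x', y)"] by (intro mult_right_mono) auto
          finally show "ennreal (\<phi> d y) \<le> G x' y * ennreal (f y)" .
        qed
        finally show "ennreal c < (\<integral>\<^sup>+y. G x' y * ennreal (f y) \<partial>M n)" .
      qed
    qed
  qed (use d in auto)
qed

lemma eventually_ball_compact:
  assumes K: "compact K"
    and loc: "\<And>x. x \<in> K \<Longrightarrow> \<exists>U. open U \<and> x \<in> U \<and> (\<forall>\<^sub>F n in F. \<forall>x'\<in>U. P n x')"
  shows "\<forall>\<^sub>F n in F. \<forall>x\<in>K. P n x"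
proof -
  have "\<forall>x\<in>K. \<exists>U. open U \<and> x \<in> U \<and> (\<forall>\<^sub>F n in F. \<forall>x'\<in>U. P n x')" using loc by blast
  from bchoice[OF this] obtain U where
    U: "\<forall>x\<in>K. open (U x) \<and> x \<in> U x \<and> (\<forall>\<^sub>F n in F. \<forall>x'\<in>U x. P n x')" by blast
  have U': "open (U x)" if "x \<in> K" for x using U that by blast
  have cov: "K \<subseteq> (\<Union>x\<in>K. U x)" using U by blast
  show ?thesis
  proof (rule compactE_image[OF K U' cov])
    fix D assume D: "D \<subseteq> K" "finite D" "K \<subseteq> (\<Union>x\<in>D. U x)"
    have "\<forall>\<^sub>F n in F. \<forall>x\<in>D. \<forall>x'\<in>U x. P n x'"
      using U D by (intro eventually_ball_finite) auto
    then show ?thesis by eventually_elim (use D(3) in blast)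
  qed
qed

text \<open>Lower semicontinuity bounds the potentials of \<open>c + u\<close> and of \<open>c - u\<close> from below; the potentials
  of their sum \<open>2 c\<close> converge by hypothesis, so the lower bounds are also upper bounds.\<close>

lemma uniform_potential_convergence:
  fixes G :: "'a::{metric_space, second_countable_topology} \<Rightarrow> 'a \<Rightarrow> ennreal" and u :: "'a \<Rightarrow> real"
  assumes lc: "locally_compact_space (euclidean :: 'a topology)"
    and lsc: "lower_semicontinuous (\<lambda>(x, y). G x y)"
    and N: "kato G N" and M: "\<And>n. kato G (M n)" and vague: "vague_limit M N"
    and unif: "uniform_limit UNIV (\<lambda>n x. enn2real (potential1 G (M n) x)) (\<lambda>x. enn2real (potential1 G N x)) sequentially"
    and u: "continuous_on UNIV u" "\<And>y. \<bar>u y\<bar> \<le> c" and \<epsilon>: "0 < \<epsilon>"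
  shows "\<forall>\<^sub>F n in sequentially. \<forall>x. \<bar>enn2real (\<integral>\<^sup>+y. G x y * ennreal (c + u y) \<partial>M n)
     - enn2real (\<integral>\<^sup>+y. G x y * ennreal (c + u y) \<partial>N)\<bar> < \<epsilon>"
proof -
  define P where "P \<nu> f x = enn2real (\<integral>\<^sup>+y. G x y * ennreal (f y) \<partial>\<nu>)" for \<nu> :: "'a measure" and f :: "'a \<Rightarrow> real" and x
  define g where "g \<nu> x = enn2real (potential1 G \<nu> x)" for \<nu> x
  define a where "a y = c + u y" for y
  define b where "b y = c - u y" for y
  have c0: "0 \<le> c" using u(2) abs_ge_zero order_trans by blast
  have ab: "0 \<le> a y" "a y \<le> 2 * c" "0 \<le> b y" "b y \<le> 2 * c" for y
    using u(2)[of y] by (auto simp: a_def b_def abs_le_iff)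
  have abc: "continuous_on UNIV a" "continuous_on UNIV b"
    unfolding a_def[abs_def] b_def[abs_def] by (intro continuous_intros u)+
  have Gm: "G x \<in> borel_measurable \<nu>" if "kato G \<nu>" for x \<nu>
    using lower_semicontinuous_section[OF lsc] that by (simp add: kato_def radon_def cong: measurable_cong_sets)
  have cm: "f \<in> borel_measurable \<nu>" if "kato G \<nu>" "continuous_on UNIV f" for f :: "'a \<Rightarrow> real" and \<nu>
    using borel_measurable_continuous_onI[OF that(2)] that(1) by (simp add: kato_def radon_def cong: measurable_cong_sets)
  have g: "potential1 G \<nu> x = ennreal (g \<nu> x)" if "kato G \<nu>" for \<nu> x
    using that by (simp add: g_def kato_def ennreal_enn2real)
  have g0: "0 \<le> g \<nu> x" for \<nu> x by (simp add: g_def)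
  have Ple: "(\<integral>\<^sup>+y. G x y * ennreal (f y) \<partial>\<nu>) \<le> ennreal (2 * c * g \<nu> x)"
    if "kato G \<nu>" "\<And>y. 0 \<le> f y" "\<And>y. f y \<le> 2 * c" for f \<nu> x
  proof -
    have "(\<integral>\<^sup>+y. G x y * ennreal (f y) \<partial>\<nu>) \<le> (\<integral>\<^sup>+y. G x y * ennreal (2 * c) \<partial>\<nu>)"
      by (intro nn_integral_mono mult_left_mono ennreal_leI that) simp
    also have "\<dots> = potential1 G \<nu> x * ennreal (2 * c)"
      unfolding potential1_def by (rule nn_integral_multc[OF Gm[OF that(1)]])
    finally show ?thesis using g[OF that(1)] c0 g0[of \<nu> x] by (simp add: ennreal_mult'[symmetric] mult.commute)
  qed
  have P: "(\<integral>\<^sup>+y. G x y * ennreal (f y) \<partial>\<nu>) = ennreal (P \<nu> f x)" "P \<nu> f x \<le> 2 * c * g \<nu> x" "0 \<le> P \<nu> f x"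
    if "kato G \<nu>" "\<And>y. 0 \<le> f y" "\<And>y. f y \<le> 2 * c" for f \<nu> x
  proof -
    have "(\<integral>\<^sup>+y. G x y * ennreal (f y) \<partial>\<nu>) < top" using Ple[OF that, of x] by (rule le_less_trans) simp
    then show 1: "(\<integral>\<^sup>+y. G x y * ennreal (f y) \<partial>\<nu>) = ennreal (P \<nu> f x)" by (simp add: P_def ennreal_enn2real)
    have "ennreal (P \<nu> f x) \<le> ennreal (2 * c * g \<nu> x)"
      unfolding 1[symmetric] by (rule Ple[OF that])
    then show "P \<nu> f x \<le> 2 * c * g \<nu> x" using c0 g0[of \<nu> x] by simp
  qed (simp add: P_def)
  have sum: "P \<nu> a x + P \<nu> b x = 2 * c * g \<nu> x" if \<nu>: "kato G \<nu>" for \<nu> x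
  proof -
    note [measurable] = Gm[OF \<nu>, of x] cm[OF \<nu> abc(1)] cm[OF \<nu> abc(2)]
    have "ennreal (P \<nu> a x + P \<nu> b x) = (\<integral>\<^sup>+y. G x y * ennreal (a y) \<partial>\<nu>) + (\<integral>\<^sup>+y. G x y * ennreal (b y) \<partial>\<nu>)"
      using P[where f=a and x=x, OF \<nu> ab(1,2)] P[where f=b and x=x, OF \<nu> ab(3,4)] by (simp add: ennreal_plus)
    also have "\<dots> = (\<integral>\<^sup>+y. G x y * ennreal (a y) + G x y * ennreal (b y) \<partial>\<nu>)"
      by (rule nn_integral_add[symmetric]) measurable
    also have "\<dots> = (\<integral>\<^sup>+y. G x y * ennreal (2 * c) \<partial>\<nu>)"
      using ab by (intro nn_integral_cong) (simp add: distrib_left[symmetric] ennreal_plus[symmetric] a_def b_def del: ennreal_plus)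
    also have "\<dots> = potential1 G \<nu> x * ennreal (2 * c)"
      unfolding potential1_def by (rule nn_integral_multc[OF Gm[OF \<nu>]])
    also have "\<dots> = ennreal (2 * c * g \<nu> x)"
      using g[OF \<nu>] c0 g0[of \<nu> x] by (simp add: ennreal_mult'[symmetric] mult.commute)
    finally have "ennreal (P \<nu> a x + P \<nu> b x) = ennreal (2 * c * g \<nu> x)" .
    moreover have "0 \<le> P \<nu> a x + P \<nu> b x"
      by (intro add_nonneg_nonneg P(3)[where f=a, OF \<nu> ab(1,2)] P(3)[where f=b, OF \<nu> ab(3,4)])
    moreover have "0 \<le> 2 * c * g \<nu> x" using c0 g0[of \<nu> x] by simp
    ultimately show ?thesis by (simp only: ennreal_inj)
  qed
  have low: "\<exists>U. open U \<and> x \<in> U \<and> (\<forall>\<^sub>F n in sequentially. \<forall>x'\<in>U. P N f x - d < P (M' n) f x')"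
    if M': "\<And>n. kato G (M' n)" "vague_limit M' N" and f: "continuous_on UNIV f" "\<And>y. 0 \<le> f y" "\<And>y. f y \<le> 2 * c" and d: "0 < d"
    for M' f x and d :: real
  proof (cases "0 \<le> P N f x - d")
    case True
    have rM: "radon (M' n)" for n using M'(1)[of n] by (simp add: kato_def)
    have rN: "radon N" using N by (simp add: kato_def)
    have "ennreal (P N f x - d) < (\<integral>\<^sup>+y. G x y * ennreal (f y) \<partial>N)"
      unfolding P(1)[where f=f, OF N f(2,3)] using True d by (simp add: ennreal_less_iff)
    then obtain U where U: "open U" "x \<in> U"
      "\<forall>\<^sub>F n in sequentially. \<forall>x'\<in>U. ennreal (P N f x - d) < (\<integral>\<^sup>+y. G x' y * ennreal (f y) \<partial>M' n)"
      by (rule vague_limit_kernel_liminf[OF lc lsc rN rM M'(2) f True])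
    from U(3) have "\<forall>\<^sub>F n in sequentially. \<forall>x'\<in>U. P N f x - d < P (M' n) f x'"
    proof eventually_elim
      case (elim n)
      then show ?case unfolding P(1)[where f=f, OF M'(1) f(2,3)] using True by (simp add: ennreal_less_iff)
    qed
    with U(1,2) show ?thesis by blast
  next
    case False
    have "\<forall>x'\<in>UNIV. P N f x - d < P (M' n) f x'" for n
    proof
      fix x'
      show "P N f x - d < P (M' n) f x'"
        using False P(3)[where f=f and x=x', OF M'(1)[of n] f(2,3)] by linarith
    qed
    then show ?thesis by (intro exI[of _ UNIV]) simp
  qed
  \<comment> \<open>The upper bound for \<open>a\<close> is \<open>2 * c\<close> times a bound for
    the potential of 1, minus the lower bound for \<open>b\<close>. Near \<open>x\<close> the
    potential of 1 exceeds its value at \<open>x\<close> by less than \<open>2 * d\<close>, which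
    costs \<open>4 * c * d\<close>; the lower bounds for \<open>b\<close> and for \<open>a\<close>
    cost another \<open>d\<close> each.\<close>
  define d where "d = \<epsilon> / (4 * c + 2)"
  have d: "0 < d" "(4 * c + 2) * d = \<epsilon>" using \<epsilon> c0 by (simp_all add: d_def)
  \<comment> \<open>For the constant sequence the liminf lemma is lower semicontinuity of the limit
    potentials. It allows comparison at \<open>x'\<close> through the value at \<open>x\<close>,
    although the continuity of the limit potential of \<open>a\<close> is not known in
    advance.\<close>
  have vN: "vague_limit (\<lambda>_. N) N" by (simp add: vague_limit_def)
  have unif': "\<forall>\<^sub>F n in sequentially. \<forall>x. \<bar>g (M n) x - g N x\<bar> < d"
    using uniform_limitD[OF unif d(1)] by (simp add: g_def dist_real_def)
  obtain K where K: "compact K" "\<And>x. x \<notin> K \<Longrightarrow> \<bar>g N x\<bar> < d"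
    using N d(1) unfolding kato_def vanishing_at_infinity_def g_def by blast
  have inside: "\<forall>\<^sub>F n in sequentially. \<forall>x\<in>K. \<bar>P (M n) a x - P N a x\<bar> < \<epsilon>"
  proof (rule eventually_ball_compact[OF K(1)])
    fix x
    obtain U1 where U1: "open U1" "x \<in> U1" "\<forall>\<^sub>F n in sequentially. \<forall>x'\<in>U1. P N a x - d < P (M n) a x'"
      using low[OF M vague abc(1) ab(1,2) d(1)] by blast
    obtain U2 where U2: "open U2" "x \<in> U2" "\<forall>\<^sub>F n in sequentially. \<forall>x'\<in>U2. P N b x - d < P (M n) b x'"
      using low[OF M vague abc(2) ab(3,4) d(1)] by blast
    obtain U3 where U3: "open U3" "x \<in> U3" "\<forall>\<^sub>F n in sequentially. \<forall>x'\<in>U3. P N a x - d < P N a x'"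
      using low[OF N vN abc(1) ab(1,2) d(1)] by blast
    obtain U4 where U4: "open U4" "x \<in> U4" "\<forall>\<^sub>F n in sequentially. \<forall>x'\<in>U4. P N b x - d < P N b x'"
      using low[OF N vN abc(2) ab(3,4) d(1)] by blast
    have "continuous_on UNIV (g N)" using N by (simp add: kato_def g_def[abs_def])
    then have "open (g N -` ball (g N x) d)" by (intro open_vimage) auto
    define U where "U = U1 \<inter> U2 \<inter> U3 \<inter> U4 \<inter> g N -` ball (g N x) d"
    have "open U" "x \<in> U"
      using U1 U2 U3 U4 d(1) \<open>open (g N -` ball (g N x) d)\<close> by (auto simp: U_def)
    moreover have "\<forall>\<^sub>F n in sequentially. \<forall>x'\<in>U. \<bar>P (M n) a x' - P N a x'\<bar> < \<epsilon>"
      using U1(3) U2(3) U3(3) U4(3) unif'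
    proof eventually_elim
      case (elim n)
      show ?case
      proof
        fix x' assume x': "x' \<in> U"
        have 1: "P N a x - d < P (M n) a x'" "P N b x - d < P (M n) b x'" "P N a x - d < P N a x'" "P N b x - d < P N b x'"
          using elim x' by (auto simp: U_def)
        have gx: "\<bar>g (M n) x' - g N x'\<bar> < d" "\<bar>g N x' - g N x\<bar> < d"
          using elim x' by (auto simp: U_def dist_real_def abs_minus_commute)
        have "2 * c * g (M n) x' \<le> 2 * c * (g N x + 2 * d)" "2 * c * g N x' \<le> 2 * c * (g N x + 2 * d)"
          using gx d(1) c0 by (intro mult_left_mono; simp)+
        with 1 sum[OF M, of n x'] sum[OF N, of x'] sum[OF N, of x]
        have "P (M n) a x' < P N a x + (4 * c + 1) * d" "P N a x' < P N a x + (4 * c + 1) * d"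
          by (simp_all add: algebra_simps)
        moreover have "(4 * c + 1) * d + d = \<epsilon>" using d(2) by (simp add: algebra_simps)
        ultimately show "\<bar>P (M n) a x' - P N a x'\<bar> < \<epsilon>" using 1 by linarith
      qed
    qed
    ultimately show "\<exists>U. open U \<and> x \<in> U \<and> (\<forall>\<^sub>F n in sequentially. \<forall>x'\<in>U. \<bar>P (M n) a x' - P N a x'\<bar> < \<epsilon>)" by blast
  qed
  have "\<forall>\<^sub>F n in sequentially. \<forall>x. \<bar>P (M n) a x - P N a x\<bar> < \<epsilon>"
    using inside unif'
  proof eventually_elim
    case (elim n)
    show ?case
    proof
      fix x
      show "\<bar>P (M n) a x - P N a x\<bar> < \<epsilon>"
      proof (cases "x \<in> K")
        \<comment> \<open>Outside \<open>K\<close> the potential of 1 is small for the limit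
          measure, hence for the approximating ones too, and it dominates both potentials up to the
          factor \<open>2 * c\<close>.\<close>
        case False
        have "g N x < d" using K(2)[OF False] by simp
        moreover have "g (M n) x < 2 * d" using spec[OF elim(2), of x] K(2)[OF False] by simp
        ultimately have "2 * c * g N x \<le> 2 * c * (2 * d)" "2 * c * g (M n) x \<le> 2 * c * (2 * d)"
          using c0 d(1) by (intro mult_left_mono; simp)+
        moreover have "2 * c * (2 * d) < \<epsilon>" using d by (simp add: algebra_simps)
        ultimately show ?thesis
          using P(2,3)[where f=a and x=x, OF M[of n] ab(1,2)] P(2,3)[where f=a and x=x, OF N ab(1,2)] by linarith
      qed (use elim(1) in blast)
    qed
  qed
  then show ?thesis by (simp add: P_def a_def)
qed


section \<open>The integrated semigroup\<close>

instance bcontfun :: (metric_space, banach) banach ..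

lemma bounded_linear_apply_bcontfun: "bounded_linear (\<lambda>f::'a::topological_space \<Rightarrow>\<^sub>C real. apply_bcontfun f x)"
proof (rule bounded_linear_intro[where K=1])
  fix f :: "'a \<Rightarrow>\<^sub>C real"
  show "norm (apply_bcontfun f x) \<le> norm f * 1" using norm_bounded[of f x] by simp
qed (simp_all add: plus_bcontfun.rep_eq scaleR_bcontfun.rep_eq)

lemma subspace_C0: "subspace (C0 :: ('a::topological_space \<Rightarrow>\<^sub>C real) set)"
proof (rule subspaceI)
  show "0 \<in> (C0 :: ('a \<Rightarrow>\<^sub>C real) set)"
    by (auto simp: C0_def vanishing_at_infinity_def zero_bcontfun.rep_eq)
next
  fix u w :: "'a \<Rightarrow>\<^sub>C real" assume u: "u \<in> C0" and w: "w \<in> C0"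
  show "u + w \<in> C0" unfolding C0_def vanishing_at_infinity_def
  proof (intro CollectI allI impI)
    fix e :: real assume "0 < e"
    then have e: "0 < e / 2" by simp
    obtain K where K: "compact K" "\<forall>x. x \<notin> K \<longrightarrow> \<bar>u x\<bar> < e / 2" using u e unfolding C0_def vanishing_at_infinity_def by blast
    obtain L where L: "compact L" "\<forall>x. x \<notin> L \<longrightarrow> \<bar>w x\<bar> < e / 2" using w e unfolding C0_def vanishing_at_infinity_def by blast
    have "\<bar>(u + w) x\<bar> < e" if "x \<notin> K \<union> L" for x
    proof -
      have "\<bar>u x\<bar> < e / 2" "\<bar>w x\<bar> < e / 2" using K(2) L(2) that by auto
      then show ?thesis by (simp add: plus_bcontfun.rep_eq)
    qed
    then show "\<exists>K. compact K \<and> (\<forall>x. x \<notin> K \<longrightarrow> \<bar>(u + w) x\<bar> < e)"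
      using compact_Un[OF K(1) L(1)] by blast
  qed
next
  fix c :: real and u :: "'a \<Rightarrow>\<^sub>C real" assume u: "u \<in> C0"
  show "c *\<^sub>R u \<in> C0" unfolding C0_def vanishing_at_infinity_def
  proof (intro CollectI allI impI)
    fix e :: real assume e: "0 < e"
    then have "0 < e / (\<bar>c\<bar> + 1)" by simp
    then obtain K where K: "compact K" "\<forall>x. x \<notin> K \<longrightarrow> \<bar>u x\<bar> < e / (\<bar>c\<bar> + 1)"
      using u unfolding C0_def vanishing_at_infinity_def by blast
    have "\<bar>(c *\<^sub>R u) x\<bar> < e" if "x \<notin> K" for x
    proof -
      have "\<bar>c\<bar> * \<bar>u x\<bar> \<le> (\<bar>c\<bar> + 1) * \<bar>u x\<bar>" by (intro mult_right_mono) auto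
      also have "\<dots> < e" using K(2) that by (simp add: less_divide_eq mult.commute add_nonneg_pos)
      finally show ?thesis by (simp add: scaleR_bcontfun.rep_eq abs_mult)
    qed
    then show "\<exists>K. compact K \<and> (\<forall>x. x \<notin> K \<longrightarrow> \<bar>(c *\<^sub>R u) x\<bar> < e)" using K(1) by blast
  qed
qed

lemma closed_C0: "closed (C0 :: ('a::topological_space \<Rightarrow>\<^sub>C real) set)"
proof -
  have "u \<in> C0" if u: "u \<in> closure C0" for u :: "'a \<Rightarrow>\<^sub>C real"
    unfolding C0_def vanishing_at_infinity_def
  proof (intro CollectI allI impI)
    fix e :: real assume "0 < e"
    then have e: "0 < e / 2" by simp
    then obtain w where w: "w \<in> C0" "dist w u < e / 2" using u unfolding closure_approachable by blast
    obtain K where K: "compact K" "\<forall>x. x \<notin> K \<longrightarrow> \<bar>w x\<bar> < e / 2" using w(1) e unfolding C0_def vanishing_at_infinity_def by blast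
    have "\<bar>u x\<bar> < e" if "x \<notin> K" for x
    proof -
      have "dist (w x) (u x) < e / 2" using dist_bounded[of w x u] w(2) by simp
      moreover have "\<bar>w x\<bar> < e / 2" using K(2) that by blast
      ultimately show ?thesis unfolding dist_real_def by linarith
    qed
    then show "\<exists>K. compact K \<and> (\<forall>x. x \<notin> K \<longrightarrow> \<bar>u x\<bar> < e)" using K(1) by blast
  qed
  then show ?thesis using closure_subset_eq[of C0] by blast
qed

lemma norm_bcontfun_le:
  fixes f :: "'a::topological_space \<Rightarrow>\<^sub>C real"
  shows "(\<And>x. \<bar>f x\<bar> \<le> b) \<Longrightarrow> norm f \<le> b"
  by (rule norm_bound) simp

lemma tendsto_power_mult_exp: "0 < c \<Longrightarrow> ((\<lambda>x::real. x ^ j * exp (- c * x)) \<longlongrightarrow> 0) at_top"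
proof -
  assume c: "0 < c"
  have "filterlim (\<lambda>x. c * x) at_top at_top"
    by (rule filterlim_tendsto_pos_mult_at_top[OF tendsto_const c filterlim_ident])
  from filterlim_compose[OF tendsto_power_div_exp_0[of j] this]
  have "((\<lambda>x. (c * x) ^ j / exp (c * x) / c ^ j) \<longlongrightarrow> 0 / c ^ j) at_top" by (intro tendsto_divide tendsto_const) (use c in auto)
  moreover have "(c * x) ^ j / exp (c * x) / c ^ j = x ^ j * exp (- c * x)" for x
    using c by (simp add: power_mult_distrib exp_minus field_simps)
  ultimately show ?thesis by simp
qed

text \<open>At most linear growth of \<open>f\<close> gives at most quadratic growth of its
  primitive, so the exponential kills the boundary term in the integration by parts. Linear growth
  is what the integrated semigroup has.\<close>

lemma laplace_primitive:
  fixes f :: "real \<Rightarrow> real"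
  assumes f: "continuous_on {0..} f" and k: "0 < k"
    and growth: "\<And>t. 0 \<le> t \<Longrightarrow> \<bar>f t\<bar> \<le> a + b * t" and b: "0 \<le> b"
    and L: "((\<lambda>N. integral {0..N} (\<lambda>t. exp (- k * t) * f t)) \<longlongrightarrow> y) at_top"
  shows "((\<lambda>N. integral {0..N} (\<lambda>t. exp (- k * t) * integral {0..t} f)) \<longlongrightarrow> y / k) at_top"
proof -
  define F where "F = (\<lambda>t. integral {0..t} f)"
  have cf: "continuous_on {0..N} f" for N by (rule continuous_on_subset[OF f]) auto
  have parts: "integral {0..N} (\<lambda>t. exp (- k * t) * F t) = (integral {0..N} (\<lambda>t. exp (- k * t) * f t) - exp (- k * N) * F N) / k"
    if "0 \<le> N" for N
    unfolding F_def by (rule integral_exp_mult_primitive_parts[OF f that]) (use k in simp)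
  have bound: "\<bar>F N\<bar> \<le> (a + b * N) * N" if N: "0 \<le> N" for N
  proof -
    have "norm (integral {0..N} f) \<le> (a + b * N) * (N - 0)"
    proof (rule integral_bound[OF N cf])
      fix t assume "t \<in> {0..N}"
      then show "norm (f t) \<le> a + b * N" using growth[of t] mult_left_mono[OF _ b, of t N] by auto
    qed
    then show ?thesis by (simp add: F_def)
  qed
  have "((\<lambda>N. exp (- k * N) * F N) \<longlongrightarrow> 0) at_top"
  proof (rule Lim_null_comparison)
    show "\<forall>\<^sub>F N in at_top. norm (exp (- k * N) * F N) \<le> a * (N ^ 1 * exp (- k * N)) + b * (N ^ 2 * exp (- k * N))"
      using eventually_ge_at_top[of 0]
    proof eventually_elim
      case (elim N)
      have "exp (- k * N) * \<bar>F N\<bar> \<le> exp (- k * N) * ((a + b * N) * N)"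
        by (rule mult_left_mono[OF bound[OF elim]]) simp
      then show ?case by (simp add: abs_mult algebra_simps power2_eq_square)
    qed
    have "((\<lambda>N. a * (N ^ 1 * exp (- k * N)) + b * (N ^ 2 * exp (- k * N))) \<longlongrightarrow> a * 0 + b * 0) at_top"
      by (intro tendsto_intros tendsto_power_mult_exp k)
    then show "((\<lambda>N. a * (N ^ 1 * exp (- k * N)) + b * (N ^ 2 * exp (- k * N))) \<longlongrightarrow> 0) at_top" by simp
  qed
  from tendsto_divide[OF tendsto_diff[OF L this] tendsto_const[of k]]
  have "((\<lambda>N. (integral {0..N} (\<lambda>t. exp (- k * t) * f t) - exp (- k * N) * F N) / k) \<longlongrightarrow> y / k) at_top" using k by simp
  moreover have "\<forall>\<^sub>F N in at_top. (integral {0..N} (\<lambda>t. exp (- k * t) * f t) - exp (- k * N) * F N) / k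
      = integral {0..N} (\<lambda>t. exp (- k * t) * F t)"
    using eventually_ge_at_top[of 0] by eventually_elim (rule parts[symmetric])
  ultimately have "((\<lambda>N. integral {0..N} (\<lambda>t. exp (- k * t) * F t)) \<longlongrightarrow> y / k) at_top"
    by (rule Lim_transform_eventually)
  then show ?thesis unfolding F_def .
qed

section \<open>Resolvent and integrated semigroup as operators on \<open>C0\<close>\<close>

locale tc_integrated = time_change Y A for Y :: "('w, 'a::metric_space) process" and A +
  fixes S :: "real \<Rightarrow> ('a \<Rightarrow>\<^sub>C real) \<Rightarrow> ('a \<Rightarrow>\<^sub>C real)"
  assumes S: "integrated_semigroup (tc_resolvent Y A) S"
begin

lemma S_C0: "0 \<le> t \<Longrightarrow> u \<in> C0 \<Longrightarrow> S t u \<in> C0"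
  and S_add: "0 \<le> t \<Longrightarrow> u \<in> C0 \<Longrightarrow> w \<in> C0 \<Longrightarrow> S t (u + w) = S t u + S t w"
  and S_scale: "0 \<le> t \<Longrightarrow> u \<in> C0 \<Longrightarrow> S t (c *\<^sub>R u) = c *\<^sub>R S t u"
  and S_cont: "u \<in> C0 \<Longrightarrow> continuous_on {0..} (\<lambda>t. S t u)"
  and S_laplace: "0 < \<alpha> \<Longrightarrow> u \<in> C0 \<Longrightarrow> \<exists>w. ((\<lambda>t. exp (- \<alpha> * t) *\<^sub>R S t u) has_integral w) {0..} \<and>
        tc_resolvent Y A \<alpha> (apply_bcontfun u) = apply_bcontfun (\<alpha> *\<^sub>R w)"
  using S unfolding integrated_semigroup_def by (auto simp: Pi_iff)

lemma S_diff: "0 \<le> t \<Longrightarrow> u \<in> C0 \<Longrightarrow> w \<in> C0 \<Longrightarrow> S t (u - w) = S t u - S t w"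
  using S_add[of t u "- w"] S_scale[of t w "- 1"] subspace_neg[OF subspace_C0, of w] by simp

text \<open>The resolvent function as an element of the Banach space. That it is bounded and
  continuous, so that \<open>Bcontfun\<close> is meaningful, comes from the Laplace integral of
  \<open>S\<close>.\<close>

definition res :: "real \<Rightarrow> ('a \<Rightarrow>\<^sub>C real) \<Rightarrow> ('a \<Rightarrow>\<^sub>C real)" where
  "res \<alpha> u = Bcontfun (tc_resolvent Y A \<alpha> (apply_bcontfun u))"

lemma res:
  assumes \<alpha>: "0 < \<alpha>" and u: "u \<in> C0"
  shows "res \<alpha> u \<in> C0" "apply_bcontfun (res \<alpha> u) = tc_resolvent Y A \<alpha> (apply_bcontfun u)"
    "((\<lambda>t. exp (- \<alpha> * t) *\<^sub>R S t u) has_integral (1 / \<alpha>) *\<^sub>R res \<alpha> u) {0..}"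
proof -
  obtain w where w: "((\<lambda>t. exp (- \<alpha> * t) *\<^sub>R S t u) has_integral w) {0..}"
    "tc_resolvent Y A \<alpha> (apply_bcontfun u) = apply_bcontfun (\<alpha> *\<^sub>R w)"
    using S_laplace[OF \<alpha> u] by blast
  have r: "res \<alpha> u = \<alpha> *\<^sub>R w" unfolding res_def w(2) by (rule apply_bcontfun_inverse)
  show "apply_bcontfun (res \<alpha> u) = tc_resolvent Y A \<alpha> (apply_bcontfun u)" by (simp add: r w(2))
  have "w \<in> C0"
    by (rule has_integral_in_closed_subspace[OF subspace_C0 closed_C0 w(1)])
      (auto intro!: subspace_scale[OF subspace_C0] S_C0 u)
  then show "res \<alpha> u \<in> C0" unfolding r by (rule subspace_scale[OF subspace_C0])
  show "((\<lambda>t. exp (- \<alpha> * t) *\<^sub>R S t u) has_integral (1 / \<alpha>) *\<^sub>R res \<alpha> u) {0..}"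
    using w(1) \<alpha> by (simp add: r)
qed

lemma res_laplace:
  assumes "0 < \<alpha>" "u \<in> C0"
  shows "apply_bcontfun (res \<alpha> u) x = (\<integral>t. indicator {0..} t * (exp (- \<alpha> * t) * tc_mean x u t) \<partial>lborel)"
  using res(2)[OF assms] tc_resolvent_eq_laplace[OF assms(2,1)] by simp

text \<open>Linearity is inherited from \<open>S\<close> through uniqueness of the Laplace
  integral.\<close>

lemma res_add:
  assumes \<alpha>: "0 < \<alpha>" and u: "u \<in> C0" and w: "w \<in> C0"
  shows "res \<alpha> (u + w) = res \<alpha> u + res \<alpha> w"
proof -
  have "((\<lambda>t. exp (- \<alpha> * t) *\<^sub>R S t u + exp (- \<alpha> * t) *\<^sub>R S t w) has_integral (1 / \<alpha>) *\<^sub>R res \<alpha> u + (1 / \<alpha>) *\<^sub>R res \<alpha> w) {0..}"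
    by (intro has_integral_add res \<alpha> u w)
  then have "((\<lambda>t. exp (- \<alpha> * t) *\<^sub>R S t (u + w)) has_integral (1 / \<alpha>) *\<^sub>R (res \<alpha> u + res \<alpha> w)) {0..}"
    using has_integral_eq[of "{0..}" "\<lambda>t. exp (- \<alpha> * t) *\<^sub>R S t u + exp (- \<alpha> * t) *\<^sub>R S t w" "\<lambda>t. exp (- \<alpha> * t) *\<^sub>R S t (u + w)"]
    by (simp add: S_add[OF _ u w] scaleR_right_distrib)
  from has_integral_unique[OF res(3)[OF \<alpha> subspace_add[OF subspace_C0 u w]] this] show ?thesis using \<alpha> by simp
qed

lemma res_scale:
  assumes \<alpha>: "0 < \<alpha>" and u: "u \<in> C0"
  shows "res \<alpha> (c *\<^sub>R u) = c *\<^sub>R res \<alpha> u"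
proof -
  have "((\<lambda>t. c *\<^sub>R (exp (- \<alpha> * t) *\<^sub>R S t u)) has_integral c *\<^sub>R ((1 / \<alpha>) *\<^sub>R res \<alpha> u)) {0..}"
    by (intro has_integral_cmul res \<alpha> u)
  then have "((\<lambda>t. exp (- \<alpha> * t) *\<^sub>R S t (c *\<^sub>R u)) has_integral (1 / \<alpha>) *\<^sub>R (c *\<^sub>R res \<alpha> u)) {0..}"
    using has_integral_eq[of "{0..}" "\<lambda>t. c *\<^sub>R (exp (- \<alpha> * t) *\<^sub>R S t u)" "\<lambda>t. exp (- \<alpha> * t) *\<^sub>R S t (c *\<^sub>R u)"]
    by (simp add: S_scale[OF _ u] mult.commute)
  from has_integral_unique[OF res(3)[OF \<alpha> subspace_scale[OF subspace_C0 u]] this]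
  have "\<alpha> *\<^sub>R ((1 / \<alpha>) *\<^sub>R res \<alpha> (c *\<^sub>R u)) = \<alpha> *\<^sub>R ((1 / \<alpha>) *\<^sub>R (c *\<^sub>R res \<alpha> u))" by (rule arg_cong)
  then show ?thesis using \<alpha> by simp
qed

lemma res_diff:
  assumes \<alpha>: "0 < \<alpha>" and u: "u \<in> C0" and w: "w \<in> C0"
  shows "res \<alpha> (u - w) = res \<alpha> u - res \<alpha> w"
  using res_add[OF \<alpha> u subspace_neg[OF subspace_C0 w]] res_scale[OF \<alpha> w, of "- 1"] by simp

lemma abs_laplace_le:
  assumes \<alpha>: "0 < \<alpha>" and u: "u \<in> C0"
  shows "\<bar>\<integral>t. indicator {0..} t * (exp (- \<alpha> * t) * tc_mean x u t) \<partial>lborel\<bar> \<le> norm u / \<alpha>"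
    "integrable lborel (\<lambda>t. indicator {0..} t * (exp (- \<alpha> * t) * tc_mean x u t))"
proof -
  note [measurable] = tc_mean_measurable[OF u]
  have b: "\<bar>indicator {0..} t * (exp (- \<alpha> * t) * tc_mean x u t)\<bar> \<le> norm u * (indicator {0..} t * exp (- \<alpha> * t))" for t
    using abs_tc_mean_le[of x u t] by (auto simp: indicator_def abs_mult mult.commute)
  have i: "integrable lborel (\<lambda>t. norm u * (indicator {0..} t * exp (- \<alpha> * t)))"
    by (intro integrable_mult_right integrable_exp_half_line \<alpha>)
  show int: "integrable lborel (\<lambda>t. indicator {0..} t * (exp (- \<alpha> * t) * tc_mean x u t))"
    by (rule Bochner_Integration.integrable_bound[OF i]) (use b in \<open>auto intro!: AE_I2 order_trans[OF b]\<close>)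
  have "\<bar>\<integral>t. indicator {0..} t * (exp (- \<alpha> * t) * tc_mean x u t) \<partial>lborel\<bar> \<le> (\<integral>t. norm u * (indicator {0..} t * exp (- \<alpha> * t)) \<partial>lborel)"
    by (rule order_trans[OF integral_abs_bound integral_mono]) (use int i b in auto)
  also have "\<dots> = norm u / \<alpha>" by (simp only: integral_mult_right_zero integral_exp_half_line[OF \<alpha>]) simp
  finally show "\<bar>\<integral>t. indicator {0..} t * (exp (- \<alpha> * t) * tc_mean x u t) \<partial>lborel\<bar> \<le> norm u / \<alpha>" .
qed

lemma norm_res_le:
  assumes "0 < \<alpha>" "u \<in> C0" shows "norm (res \<alpha> u) \<le> norm u / \<alpha>"
  by (rule norm_bcontfun_le) (use abs_laplace_le(1)[OF assms] res_laplace[OF assms] in simp)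

text \<open>Inside the Laplace transform at \<alpha>, \<open>tc_mean_resolvent\<close> rewrites the
  mean of the \<beta>-resolvent as the discounted mean of the later path;
  \<open>integral_exp_mult_shift\<close> evaluates the resulting double integral.\<close>

lemma resolvent_equation:
  assumes a: "0 < \<alpha>" and b: "0 < \<beta>" and u: "u \<in> C0"
  shows "(\<alpha> - \<beta>) *\<^sub>R res \<alpha> (res \<beta> u) = res \<beta> u - res \<alpha> u"
proof (cases "\<alpha> = \<beta>")
  case False
  have w: "res \<beta> u \<in> C0" by (rule res(1)[OF b u])
  show ?thesis
  proof (rule bcontfun_eqI)
    fix x
    have "apply_bcontfun (res \<alpha> (res \<beta> u)) x
      = (\<integral>r. indicator {0..} r * (exp (- \<alpha> * r) * (\<integral>t. indicator {0..} t * (exp (- \<beta> * t) * tc_mean x u (r + t)) \<partial>lborel)) \<partial>lborel)"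
      unfolding res_laplace[OF a w]
      by (rule Bochner_Integration.integral_cong)
        (auto simp: indicator_def tc_mean_resolvent[OF u w b _ fun_cong[OF res(2)[OF b u]]])
    also have "\<dots> = (apply_bcontfun (res \<beta> u) x - apply_bcontfun (res \<alpha> u) x) / (\<alpha> - \<beta>)"
      unfolding res_laplace[OF a u] res_laplace[OF b u]
      by (rule integral_exp_mult_shift[OF a b False tc_mean_measurable[OF u] abs_tc_mean_le])
    finally show "apply_bcontfun ((\<alpha> - \<beta>) *\<^sub>R res \<alpha> (res \<beta> u)) x = apply_bcontfun (res \<beta> u - res \<alpha> u) x"
      using False by (simp add: scaleR_bcontfun.rep_eq minus_bcontfun.rep_eq)
  qed
qed simp

lemma S_laplace_tendsto:
  assumes k: "0 < k" and u: "u \<in> C0"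
  shows "((\<lambda>N. integral {0..N} (\<lambda>t. exp (- k * t) * apply_bcontfun (S t u) x)) \<longlongrightarrow> apply_bcontfun (res k u) x / k) at_top"
  using has_integral_half_line_tendsto[OF has_integral_linear[OF res(3)[OF k u] bounded_linear_apply_bcontfun[of x]]]
  by (simp add: o_def scaleR_bcontfun.rep_eq)

lemma S_apply_continuous: "u \<in> C0 \<Longrightarrow> continuous_on {0..} (\<lambda>t. apply_bcontfun (S t u) x)"
  by (rule bounded_linear.continuous_on[OF bounded_linear_apply_bcontfun S_cont])

lemma integrable_tc_mean_Icc:
  assumes u: "u \<in> C0"
  shows "integrable lborel (\<lambda>s. indicator {a..b} s * tc_mean x u s)"
proof (rule Bochner_Integration.integrable_bound)
  show "integrable lborel (\<lambda>s. norm u * indicator {a..b} s :: real)"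
    by (intro integrable_mult_right integrable_real_indicator) (auto simp: emeasure_lborel_Icc_eq)
  show "(\<lambda>s. indicator {a..b} s * tc_mean x u s) \<in> borel_measurable lborel"
    using tc_mean_measurable[OF u] by simp
  show "AE s in lborel. norm (indicator {a..b} s * tc_mean x u s) \<le> norm (norm u * indicator {a..b} s :: real)"
    using abs_tc_mean_le[of x u] by (auto intro!: AE_I2 simp: indicator_def)
qed

lemma abs_integral_tc_mean_Icc:
  assumes u: "u \<in> C0" and ab: "a \<le> b"
  shows "\<bar>\<integral>s. indicator {a..b} s * tc_mean x u s \<partial>lborel\<bar> \<le> (b - a) * norm u"
proof -
  have i: "integrable lborel (\<lambda>s. norm u * indicator {a..b} s :: real)"
    by (intro integrable_mult_right integrable_real_indicator) (auto simp: emeasure_lborel_Icc_eq)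
  have "\<bar>\<integral>s. indicator {a..b} s * tc_mean x u s \<partial>lborel\<bar> \<le> (\<integral>s. norm u * indicator {a..b} s \<partial>lborel)"
    by (rule order_trans[OF integral_abs_bound integral_mono])
      (use integrable_tc_mean_Icc[OF u] i abs_tc_mean_le[of x u] in \<open>auto simp: indicator_def\<close>)
  also have "\<dots> = (b - a) * norm u" using ab by simp
  finally show ?thesis .
qed

lemma integral_tc_mean_split:
  assumes u: "u \<in> C0" and st: "0 \<le> s" "s \<le> t"
  shows "(\<integral>r. indicator {0..t} r * tc_mean x u r \<partial>lborel)
    = (\<integral>r. indicator {0..s} r * tc_mean x u r \<partial>lborel) + (\<integral>r. indicator {s..t} r * tc_mean x u r \<partial>lborel)"
proof -
  have "(\<integral>r. indicator {0..t} r * tc_mean x u r \<partial>lborel)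
     = (\<integral>r. indicator {0..s} r * tc_mean x u r + indicator {s..t} r * tc_mean x u r \<partial>lborel)"
  proof (rule integral_cong_AE)
    have "AE r in lborel. r \<noteq> s" by (rule AE_lborel_singleton)
    then show "AE r in lborel. indicator {0..t} r * tc_mean x u r = indicator {0..s} r * tc_mean x u r + indicator {s..t} r * tc_mean x u r"
      by eventually_elim (use st in \<open>auto simp: indicator_def\<close>)
  qed (use tc_mean_measurable[OF u] in auto)
  also have "\<dots> = (\<integral>r. indicator {0..s} r * tc_mean x u r \<partial>lborel) + (\<integral>r. indicator {s..t} r * tc_mean x u r \<partial>lborel)"
    by (intro Bochner_Integration.integral_add integrable_tc_mean_Icc u)
  finally show ?thesis .
qed

text \<open>Both sides are continuous in \<open>t\<close> and have the Laplace transform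
  \<open>res k u\<close> at \<open>x\<close> divided by \<open>k\<close>, so the uniqueness theorem
  for Laplace transforms applies pointwise in \<open>x\<close>. The right side is continuous because
  it is Lipschitz.\<close>

lemma S_eq:
  assumes u: "u \<in> C0" and t: "0 \<le> t"
  shows "apply_bcontfun (S t u) x = (\<integral>s. indicator {0..t} s * tc_mean x u s \<partial>lborel)"
proof -
  define \<sigma> where "\<sigma> t = (\<integral>s. indicator {0..t} s * tc_mean x u s \<partial>lborel)" for t
  have lip: "\<bar>\<sigma> t - \<sigma> s\<bar> \<le> norm u * \<bar>t - s\<bar>" if "0 \<le> s" "s \<le> t" for s t
    using integral_tc_mean_split[OF u that, of x] abs_integral_tc_mean_Icc[OF u that(2), of x] that by (simp add: \<sigma>_def mult.commute)
  have "(norm u)-lipschitz_on {0..} \<sigma>"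
  proof (rule lipschitz_onI)
    fix s t :: real assume "s \<in> {0..}" "t \<in> {0..}"
    then show "dist (\<sigma> s) (\<sigma> t) \<le> norm u * dist s t"
      using lip[of s t] lip[of t s] by (cases "s \<le> t") (auto simp: dist_real_def abs_minus_commute)
  qed simp
  then have \<sigma>c: "continuous_on {0..} \<sigma>" by (rule lipschitz_on_continuous_on)
  have \<sigma>m: "(\<lambda>t. indicator {0..} t * \<sigma> t) \<in> borel_measurable borel"
    using borel_measurable_continuous_on_indicator[OF _ \<sigma>c] by simp
  have \<sigma>_lap: "((\<lambda>N. integral {0..N} (\<lambda>t. exp (- k * t) * \<sigma> t)) \<longlongrightarrow> apply_bcontfun (res k u) x / k) at_top" if k: "0 < k" for k
  proof -
    have eq: "(\<integral>t. indicator {0..} t * (exp (- k * t) * \<sigma> t) \<partial>lborel) = apply_bcontfun (res k u) x / k"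
      unfolding \<sigma>_def res_laplace[OF k u]
      by (rule integral_exp_mult_primitive[OF k tc_mean_measurable[OF u] abs_laplace_le(2)[OF k u]])
    have "integrable lborel (\<lambda>t. indicator {0..} t * (exp (- k * t) * \<sigma> t))"
    proof (rule Bochner_Integration.integrable_bound)
      show "integrable lborel (\<lambda>t. (2 / k * norm u) * (indicator {0..} t * exp (- (k / 2) * t)))"
        by (intro integrable_mult_right integrable_exp_half_line) (use k in simp)
      have "(\<lambda>t. exp (- k * t) * (indicator {0..} t * \<sigma> t)) \<in> borel_measurable lborel" using \<sigma>m by simp
      then show "(\<lambda>t. indicator {0..} t * (exp (- k * t) * \<sigma> t)) \<in> borel_measurable lborel" by (simp add: mult.left_commute)
      show "AE t in lborel. norm (indicator {0..} t * (exp (- k * t) * \<sigma> t)) \<le> norm ((2 / k * norm u) * (indicator {0..} t * exp (- (k / 2) * t)))"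
      proof (rule AE_I2)
        fix t
        show "norm (indicator {0..} t * (exp (- k * t) * \<sigma> t)) \<le> norm ((2 / k * norm u) * (indicator {0..} t * exp (- (k / 2) * t)))"
        proof (cases "0 \<le> t")
          case True
          have "\<bar>\<sigma> t\<bar> \<le> t * norm u" using abs_integral_tc_mean_Icc[OF u True, of x] by (simp add: \<sigma>_def)
          \<comment> \<open>Half of the exponential decay is spent on the linear growth of \<sigma>;
            the other half keeps the integrand integrable.\<close>
          also have "t \<le> 2 / k * exp (k / 2 * t)"
            using exp_ge_add_one_self[of "k / 2 * t"] k by (simp add: field_simps)
          finally have "\<bar>\<sigma> t\<bar> \<le> 2 / k * exp (k / 2 * t) * norm u" by (simp add: mult_right_mono)
          then have "exp (- k * t) * \<bar>\<sigma> t\<bar> \<le> exp (- k * t) * (2 / k * exp (k / 2 * t) * norm u)"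
            by (rule mult_left_mono) simp
          also have "\<dots> = 2 / k * norm u * (exp (- k * t) * exp (k / 2 * t))" by simp
          also have "exp (- k * t) * exp (k / 2 * t) = exp (- (k / 2) * t)"
            by (simp add: exp_add[symmetric] field_simps)
          finally show ?thesis using True k by (simp add: abs_mult)
        qed simp
      qed
    qed
    from has_integral_integral_lborel[OF this]
    have "((\<lambda>t. if t \<in> {0..} then exp (- k * t) * \<sigma> t else 0) has_integral apply_bcontfun (res k u) x / k) UNIV"
      unfolding eq by (rule has_integral_eq[rotated]) (simp add: indicator_def)
    then have "((\<lambda>t. exp (- k * t) * \<sigma> t) has_integral apply_bcontfun (res k u) x / k) {0..}"
      by (simp only: has_integral_restrict_UNIV)
    then show ?thesis by (rule has_integral_half_line_tendsto)
  qed
  have "apply_bcontfun (S t u) x - \<sigma> t = 0"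
  proof (rule laplace_transform_zero[OF _ _ t])
    show "continuous_on {0..} (\<lambda>t. apply_bcontfun (S t u) x - \<sigma> t)"
      by (intro continuous_on_diff S_apply_continuous u \<sigma>c)
    fix k :: nat assume "0 < k"
    then have k: "0 < real k" by simp
    have "((\<lambda>N. integral {0..N} (\<lambda>t. exp (- real k * t) * apply_bcontfun (S t u) x) - integral {0..N} (\<lambda>t. exp (- real k * t) * \<sigma> t))
       \<longlongrightarrow> apply_bcontfun (res k u) x / k - apply_bcontfun (res k u) x / k) at_top"
      by (intro tendsto_diff S_laplace_tendsto \<sigma>_lap k u)
    moreover have "integral {0..N} (\<lambda>t. exp (- real k * t) * (apply_bcontfun (S t u) x - \<sigma> t))
       = integral {0..N} (\<lambda>t. exp (- real k * t) * apply_bcontfun (S t u) x) - integral {0..N} (\<lambda>t. exp (- real k * t) * \<sigma> t)" for N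
    proof -
      have c: "continuous_on {0..N} (\<lambda>t. apply_bcontfun (S t u) x)" "continuous_on {0..N} \<sigma>"
        by (auto intro: continuous_on_subset[OF S_apply_continuous[OF u]] continuous_on_subset[OF \<sigma>c])
      show ?thesis unfolding right_diff_distrib
        by (intro integral_diff integrable_continuous_interval continuous_intros c)
    qed
    ultimately show "((\<lambda>N. integral {0..N} (\<lambda>t. exp (- real k * t) * (apply_bcontfun (S t u) x - \<sigma> t))) \<longlongrightarrow> 0) at_top" by simp
  qed
  then show ?thesis by (simp add: \<sigma>_def)
qed

text \<open>The mean of the time-changed path is bounded by \<open>norm u\<close>. The resulting
  constant does not depend on the clock, whereas the bounds in \<open>integrated_semigroup\<close>
  may depend on the time and on the operator family.\<close>

lemma norm_S_diff_le:
  assumes u: "u \<in> C0" and st: "0 \<le> s" "0 \<le> t"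
  shows "norm (S t u - S s u) \<le> \<bar>t - s\<bar> * norm u"
proof -
  have *: "norm (S t u - S s u) \<le> (t - s) * norm u" if "0 \<le> s" "s \<le> t" for s t
  proof (rule norm_bcontfun_le)
    fix x show "\<bar>apply_bcontfun (S t u - S s u) x\<bar> \<le> (t - s) * norm u"
      using integral_tc_mean_split[OF u that, of x] abs_integral_tc_mean_Icc[OF u that(2), of x] that
      by (simp add: minus_bcontfun.rep_eq S_eq[OF u])
  qed
  show ?thesis
    using *[of s t] *[of t s] st by (cases "s \<le> t") (auto simp: norm_minus_commute)
qed

lemma S_0: "u \<in> C0 \<Longrightarrow> S 0 u = 0"
proof (rule bcontfun_eqI)
  fix x assume u: "u \<in> C0"
  show "apply_bcontfun (S 0 u) x = apply_bcontfun 0 x"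
    using abs_integral_tc_mean_Icc[OF u order_refl, of 0 x] by (simp add: S_eq[OF u] zero_bcontfun.rep_eq)
qed

lemma norm_S_le: "u \<in> C0 \<Longrightarrow> 0 \<le> t \<Longrightarrow> norm (S t u) \<le> t * norm u"
  using norm_S_diff_le[of u 0 t] by (simp add: S_0)

text \<open>On the range of the resolvent the integrated semigroup is differentiable: formally the
  integrand is T_r w, computed from \<open>(w, g - w / 2)\<close> in the linear relation. Pointwise,
  both sides are continuous in time, and equality of their Laplace transforms reduces to the
  resolvent equation. The value 1/2 is just one fixed positive resolvent parameter.\<close>

lemma S_res:
  assumes g: "g \<in> C0" and t: "0 \<le> t"
  defines "w \<equiv> res (1/2) g"
  shows "S t w = integral {0..t} (\<lambda>r. w + (1/2) *\<^sub>R S r w - S r g)"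
proof (rule bcontfun_eqI)
  fix x
  have w: "w \<in> C0" unfolding w_def by (rule res(1)[OF _ g]) simp
  let ?P = "\<lambda>r. w + (1/2) *\<^sub>R S r w - S r g"
  define P where "P r = apply_bcontfun (?P r) x" for r
  have P_eq: "P r = apply_bcontfun w x + (1/2) * apply_bcontfun (S r w) x - apply_bcontfun (S r g) x" for r
    by (simp add: P_def plus_bcontfun.rep_eq minus_bcontfun.rep_eq scaleR_bcontfun.rep_eq)
  have Pc: "continuous_on {0..} ?P" by (intro continuous_intros S_cont w g)
  have pc: "continuous_on {0..} P"
    unfolding P_eq[abs_def] by (intro continuous_intros S_apply_continuous w g)
  have "apply_bcontfun (S t w) x - integral {0..t} P = 0"
  proof (rule laplace_transform_zero[OF _ _ t])
    show "continuous_on {0..} (\<lambda>t. apply_bcontfun (S t w) x - integral {0..t} P)"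
      by (intro continuous_on_diff S_apply_continuous w continuous_on_integral_half_line pc)
    fix k :: nat assume "0 < k"
    then have k: "0 < real k" by simp
    let ?r = "\<lambda>u. apply_bcontfun (res (real k) u) x"
    have const: "((\<lambda>N. integral {0..N} (\<lambda>t. exp (- real k * t) * c)) \<longlongrightarrow> c / real k) at_top" for c
    proof -
      have "((\<lambda>t. exp (- real k * t) * c) has_integral exp (- real k * 0) / real k * c) {0..}"
        by (intro has_integral_mult_left has_integral_exp_minus_to_infinity k)
      from has_integral_half_line_tendsto[OF this] show ?thesis by simp
    qed
    have cS: "continuous_on {0..N} (\<lambda>t. apply_bcontfun (S t u) x)" if "u \<in> C0" for u N
      by (rule continuous_on_subset[OF S_apply_continuous[OF that]]) auto
    have "((\<lambda>N. integral {0..N} (\<lambda>t. exp (- real k * t) * apply_bcontfun w x)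
        + (1/2) * integral {0..N} (\<lambda>t. exp (- real k * t) * apply_bcontfun (S t w) x)
        - integral {0..N} (\<lambda>t. exp (- real k * t) * apply_bcontfun (S t g) x)) \<longlongrightarrow>
       apply_bcontfun w x / real k + (1/2) * (?r w / real k) - ?r g / real k) at_top"
      by (intro tendsto_intros const S_laplace_tendsto k w g)
    moreover have "integral {0..N} (\<lambda>t. exp (- real k * t) * P t) = integral {0..N} (\<lambda>t. exp (- real k * t) * apply_bcontfun w x)
        + (1/2) * integral {0..N} (\<lambda>t. exp (- real k * t) * apply_bcontfun (S t w) x)
        - integral {0..N} (\<lambda>t. exp (- real k * t) * apply_bcontfun (S t g) x)" for N
    proof -
      have "integral {0..N} (\<lambda>t. exp (- real k * t) * P t)
        = integral {0..N} (\<lambda>t. (exp (- real k * t) * apply_bcontfun w x + (1/2) * (exp (- real k * t) * apply_bcontfun (S t w) x))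
            - exp (- real k * t) * apply_bcontfun (S t g) x)"
        by (rule integral_cong) (simp add: P_eq algebra_simps)
      also have "\<dots> = integral {0..N} (\<lambda>t. exp (- real k * t) * apply_bcontfun w x + (1/2) * (exp (- real k * t) * apply_bcontfun (S t w) x))
            - integral {0..N} (\<lambda>t. exp (- real k * t) * apply_bcontfun (S t g) x)"
        by (intro integral_diff integrable_continuous_interval continuous_intros cS w g)
      also have "integral {0..N} (\<lambda>t. exp (- real k * t) * apply_bcontfun w x + (1/2) * (exp (- real k * t) * apply_bcontfun (S t w) x))
         = integral {0..N} (\<lambda>t. exp (- real k * t) * apply_bcontfun w x) + integral {0..N} (\<lambda>t. (1/2) * (exp (- real k * t) * apply_bcontfun (S t w) x))"
        by (intro Henstock_Kurzweil_Integration.integral_add integrable_continuous_interval continuous_intros cS w g)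
      finally show ?thesis by simp
    qed
    ultimately have "((\<lambda>N. integral {0..N} (\<lambda>t. exp (- real k * t) * P t)) \<longlongrightarrow>
       apply_bcontfun w x / real k + (1/2) * (?r w / real k) - ?r g / real k) at_top" by simp
    moreover have "apply_bcontfun w x / real k + (1/2) * (?r w / real k) - ?r g / real k = ?r w"
    proof -
      have "(real k - 1/2) *\<^sub>R res (real k) w = w - res (real k) g"
        unfolding w_def by (rule resolvent_equation[OF k _ g]) simp
      from arg_cong[OF this, of "\<lambda>f. apply_bcontfun f x"]
      have "(real k - 1/2) * ?r w = apply_bcontfun w x - ?r g" by (simp add: scaleR_bcontfun.rep_eq minus_bcontfun.rep_eq)
      then have "apply_bcontfun w x - ?r g + ?r w / 2 = real k * ?r w" by (simp add: algebra_simps)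
      then have "(apply_bcontfun w x - ?r g + ?r w / 2) / real k = ?r w" using k by simp
      then show ?thesis by (simp add: add_divide_distrib diff_divide_distrib)
    qed
    ultimately have Plim: "((\<lambda>N. integral {0..N} (\<lambda>t. exp (- real k * t) * P t)) \<longlongrightarrow> ?r w) at_top" by simp
    have growth: "\<bar>P t\<bar> \<le> norm w + (norm w + norm g) * t" if "0 \<le> t" for t
    proof -
      have b1: "\<bar>apply_bcontfun w x\<bar> \<le> norm w" using norm_bounded[of w x] by simp
      have b2: "\<bar>apply_bcontfun (S t w) x\<bar> \<le> t * norm w" using norm_bounded[of "S t w" x] norm_S_le[OF w that] by simp
      have b3: "\<bar>apply_bcontfun (S t g) x\<bar> \<le> t * norm g" using norm_bounded[of "S t g" x] norm_S_le[OF g that] by simp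
      have "0 \<le> t * norm w" using that by simp
      with b1 b2 b3 show ?thesis unfolding P_eq by (simp add: algebra_simps abs_le_iff)
    qed
    have "((\<lambda>N. integral {0..N} (\<lambda>t. exp (- real k * t) * apply_bcontfun (S t w) x)
         - integral {0..N} (\<lambda>t. exp (- real k * t) * integral {0..t} P)) \<longlongrightarrow> ?r w / real k - ?r w / real k) at_top"
      by (intro tendsto_diff S_laplace_tendsto k w laplace_primitive[OF pc k growth _ Plim]) auto
    moreover have "integral {0..N} (\<lambda>t. exp (- real k * t) * (apply_bcontfun (S t w) x - integral {0..t} P))
      = integral {0..N} (\<lambda>t. exp (- real k * t) * apply_bcontfun (S t w) x) - integral {0..N} (\<lambda>t. exp (- real k * t) * integral {0..t} P)" for N
    proof -
      have "continuous_on {0..N} (\<lambda>t. integral {0..t} P)"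
        by (rule continuous_on_subset[OF continuous_on_integral_half_line[OF pc]]) auto
      then show ?thesis unfolding right_diff_distrib
        by (intro integral_diff integrable_continuous_interval continuous_intros cS w)
    qed
    ultimately show "((\<lambda>N. integral {0..N} (\<lambda>t. exp (- real k * t) * (apply_bcontfun (S t w) x - integral {0..t} P))) \<longlongrightarrow> 0) at_top" by simp
  qed
  moreover have "apply_bcontfun (integral {0..t} ?P) x = integral {0..t} P"
  proof -
    have "?P integrable_on {0..t}"
      by (rule integrable_continuous_interval[OF continuous_on_subset[OF Pc]]) auto
    from integral_linear[OF this bounded_linear_apply_bcontfun[of x]] show ?thesis
      unfolding o_def P_def[abs_def] by (rule sym)
  qed
  ultimately show "apply_bcontfun (S t w) x = apply_bcontfun (integral {0..t} ?P) x" by simp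
qed

lemma S_res_derivative:
  assumes g: "g \<in> C0" and w: "w = res (1/2) g" and t: "0 < t"
  shows "((\<lambda>t. S t w) has_vector_derivative (w + (1/2) *\<^sub>R S t w - S t g)) (at t)"
proof -
  have wC: "w \<in> C0" unfolding w by (rule res(1)[OF _ g]) simp
  have "continuous_on {0..} (\<lambda>r. w + (1/2) *\<^sub>R S r w - S r g)" by (intro continuous_intros S_cont wC g)
  from has_vector_derivative_integral_half_line[OF this t] show ?thesis
    by (rule has_vector_derivative_transform_within_open[where S="{0<..}"]) (use t S_res[OF g] w in auto)
qed

end

section \<open>Classical solutions\<close>

context tc_integrated
begin

text \<open>A product rule without differentiability of the operator family. The increment
  \<open>u y - u s\<close> vanishes at \<open>y = s\<close>, so Lipschitz continuity of
  \<open>S\<close> in time suffices: it makes the change of the operator contribute only to second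
  order.\<close>

lemma moving_operator_derivative:
  assumes t: "0 < s" "s < t" and uC: "\<And>y. 0 \<le> y \<Longrightarrow> u y \<in> C0" and u'C: "u' \<in> C0"
    and du: "(u has_vector_derivative u') (at s)"
  shows "((\<lambda>y. S (t - y) (u y - u s)) has_vector_derivative S (t - s) u') (at s)"
  unfolding has_vector_derivative_def has_derivative_within
proof
  show "bounded_linear (\<lambda>x. x *\<^sub>R S (t - s) u')" by (rule bounded_linear_scaleR_left)
  define E where "E y = (1 / norm (y - s)) *\<^sub>R (u y - (u s + (y - s) *\<^sub>R u'))" for y
  have E: "(E \<longlongrightarrow> 0) (at s)"
    using du unfolding has_vector_derivative_def has_derivative_within E_def by blast
  show "((\<lambda>y. (1 / norm (y - s)) *\<^sub>R (S (t - y) (u y - u s) - (S (t - s) (u s - u s) + (y - s) *\<^sub>R S (t - s) u'))) \<longlongrightarrow> 0) (at s)"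
  proof (rule Lim_null_comparison)
    have "\<forall>\<^sub>F y in at s. y \<in> {0<..<t}" by (rule eventually_at_in_open') (use t in auto)
    then show "\<forall>\<^sub>F y in at s. norm ((1 / norm (y - s)) *\<^sub>R (S (t - y) (u y - u s) - (S (t - s) (u s - u s) + (y - s) *\<^sub>R S (t - s) u')))
        \<le> t * norm (E y) + \<bar>y - s\<bar> * norm u'"
      using eventually_neq_at_within[of s]
    proof eventually_elim
      case (elim y)
      then have y: "0 < y" "y < t" "y \<noteq> s" by auto
      define d where "d = u y - (u s + (y - s) *\<^sub>R u')"
      have dC: "d \<in> C0" unfolding d_def
        by (intro subspace_diff[OF subspace_C0] subspace_add[OF subspace_C0] subspace_scale[OF subspace_C0] uC u'C) (use y t in auto)
      have "u y - u s = d + (y - s) *\<^sub>R u'" by (simp add: d_def)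
      then have 1: "S (t - y) (u y - u s) = S (t - y) d + (y - s) *\<^sub>R S (t - y) u'"
        using y dC u'C by (simp add: S_add S_scale subspace_scale[OF subspace_C0])
      have 0: "S (t - s) (u s - u s) = 0"
        using S_scale[of "t - s" 0 0] t subspace_0[OF subspace_C0] by simp
      have "S (t - y) (u y - u s) - (S (t - s) (u s - u s) + (y - s) *\<^sub>R S (t - s) u')
         = S (t - y) d + (y - s) *\<^sub>R (S (t - y) u' - S (t - s) u')"
        unfolding 1 0 by (simp add: algebra_simps)
      also have "norm \<dots> \<le> norm (S (t - y) d) + \<bar>y - s\<bar> * norm (S (t - y) u' - S (t - s) u')"
        by (rule order_trans[OF norm_triangle_ineq]) simp
      also have "\<dots> \<le> t * norm d + \<bar>y - s\<bar> * (\<bar>y - s\<bar> * norm u')"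
      proof (intro add_mono mult_left_mono)
        have "norm (S (t - y) d) \<le> (t - y) * norm d" using norm_S_le[OF dC] y by simp
        also have "\<dots> \<le> t * norm d" by (rule mult_right_mono) (use y in auto)
        finally show "norm (S (t - y) d) \<le> t * norm d" .
        show "norm (S (t - y) u' - S (t - s) u') \<le> \<bar>y - s\<bar> * norm u'"
          using norm_S_diff_le[OF u'C, of "t - s" "t - y"] y t by (simp add: abs_minus_commute)
      qed simp
      finally have "norm (S (t - y) (u y - u s) - (S (t - s) (u s - u s) + (y - s) *\<^sub>R S (t - s) u'))
         \<le> t * norm d + \<bar>y - s\<bar> * (\<bar>y - s\<bar> * norm u')" .
      then have "norm ((1 / norm (y - s)) *\<^sub>R (S (t - y) (u y - u s) - (S (t - s) (u s - u s) + (y - s) *\<^sub>R S (t - s) u')))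
         \<le> (t * norm d + \<bar>y - s\<bar> * (\<bar>y - s\<bar> * norm u')) / \<bar>y - s\<bar>"
        using y by (simp add: divide_right_mono)
      also have "\<dots> = t * norm (E y) + \<bar>y - s\<bar> * norm u'"
        using y by (simp add: E_def d_def add_divide_distrib)
      finally show ?case .
    qed
    have "((\<lambda>y. t * norm (E y) + \<bar>y - s\<bar> * norm u') \<longlongrightarrow> t * norm (0::'a \<Rightarrow>\<^sub>C real) + \<bar>s - s\<bar> * norm u') (at s)"
      by (intro tendsto_intros E)
    then show "((\<lambda>y. t * norm (E y) + \<bar>y - s\<bar> * norm u') \<longlongrightarrow> 0) (at s)" by simp
  qed
qed

text \<open>For a classical solution \<open>u\<close>, the function \<open>s \<mapsto> S\<^sub>t\<^sub>-\<^sub>s u(s)\<close> has derivative \<open>S\<^sub>t\<^sub>-\<^sub>s v - u(s)\<close>;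
  integrating over \<open>[0,t]\<close> gives \<open>\<integral>\<^sub>0\<^sup>t u = \<integral>\<^sub>0\<^sup>t S v\<close>.\<close>

lemma classical_solution_eq:
  assumes v: "v \<in> C0" and sol: "classical_solution (lin_rel (tc_resolvent Y A)) v u" and t0: "0 \<le> t"
  shows "u t = S t v"
proof -
  have uC: "u s \<in> C0" if "0 \<le> s" for s using sol that by (simp add: classical_solution_def)
  have uc: "continuous_on {0..} u" and u0: "u 0 = 0" using sol by (simp_all add: classical_solution_def)
  obtain u' where u': "\<And>s. 0 < s \<Longrightarrow> u' s \<in> C0" "\<And>s. 0 < s \<Longrightarrow> (u has_vector_derivative u' s) (at s)"
    "\<And>s. 0 < s \<Longrightarrow> (u s, - u' s) \<in> rel_minus (lin_rel (tc_resolvent Y A)) v"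
    using sol unfolding classical_solution_def by blast
  \<comment> \<open>The inclusion says that \<open>v - u' s\<close> is an image of
    \<open>u s\<close> under the relation; adding \<open>(1/2) *\<^sub>R u s\<close> turns this into
    \<open>u s = res (1/2) (g s)\<close>, so \<open>S r (u s)\<close> is differentiable in
    \<open>r\<close>.\<close>
  define g where "g s = v - u' s + (1/2) *\<^sub>R u s" for s
  have gC: "g s \<in> C0" if "0 < s" for s
    unfolding g_def using that
    by (intro subspace_diff[OF subspace_C0] subspace_add[OF subspace_C0] subspace_scale[OF subspace_C0] v uC u') auto
  have u_res: "u s = res (1/2) (g s)" if s: "0 < s" for s
  proof -
    obtain x1 x2 where x: "u s = x1" "- u' s = x2 - v" "(x1, x2) \<in> lin_rel (tc_resolvent Y A)"
      using u'(3)[OF s] by (auto simp: rel_minus_def)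
    have "x2 = v - u' s" using x(2) by (simp add: algebra_simps)
    then have gs: "g s = x2 + (1/2) *\<^sub>R x1" by (simp add: g_def x(1))
    have "\<forall>\<alpha>>0. tc_resolvent Y A \<alpha> (apply_bcontfun (x2 + \<alpha> *\<^sub>R x1)) = apply_bcontfun x1"
      using x(3) unfolding lin_rel_def mem_Collect_eq prod.case by (elim conjE)
    from this[rule_format, of "1/2"]
    have "tc_resolvent Y A (1/2) (apply_bcontfun (g s)) = apply_bcontfun (u s)"
      unfolding gs x(1) by (simp only: half_gt_zero_iff zero_less_one)
    then have "apply_bcontfun (res (1/2) (g s)) = apply_bcontfun (u s)"
      using res(2)[OF _ gC[OF s], of "1/2"] by simp
    then show ?thesis by (simp add: apply_bcontfun_inject)
  qed
  have int_eq: "integral {0..t} u = integral {0..t} (\<lambda>r. S r v)" if t: "0 < t" for t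
  proof -
    define W where "W r = integral {0..r} (\<lambda>r. S r v)" for r
    have Wc: "continuous_on {0..} W" unfolding W_def by (rule continuous_on_integral_half_line[OF S_cont[OF v]])
    \<comment> \<open>The term with \<open>W\<close> contributes the derivative
      \<open>- S (t - s) v\<close>, which cancels the unwanted part of the derivative of
      \<open>S (t - s) (u s)\<close> and leaves \<open>- u s\<close>.\<close>
    define G where "G s = S (t - s) (u s) + W (t - s)" for s
    have refl: "((\<lambda>y. t - y) has_vector_derivative -1) (at s)" for s
      by (auto intro!: derivative_eq_intros)
    have dG: "(G has_vector_derivative - u s) (at s)" if s: "0 < s" "s < t" for s
    proof -
      have ts: "0 < t - s" using s by simp
      have "((\<lambda>r. S r (u s)) has_vector_derivative (u s + (1/2) *\<^sub>R S (t - s) (u s) - S (t - s) (g s))) (at (t - s))"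
        by (rule S_res_derivative[OF gC[OF s(1)] u_res[OF s(1)] ts])
      from vector_diff_chain_at[OF refl this]
      have d1: "((\<lambda>y. S (t - y) (u s)) has_vector_derivative - (u s + (1/2) *\<^sub>R S (t - s) (u s) - S (t - s) (g s))) (at s)"
        by (simp add: o_def)
      have Sg: "S (t - s) (g s) = S (t - s) v - S (t - s) (u' s) + (1/2) *\<^sub>R S (t - s) (u s)"
        unfolding g_def using ts s u'(1)[OF s(1)] uC[of s] v
        by (simp add: S_add S_diff S_scale subspace_diff[OF subspace_C0] subspace_scale[OF subspace_C0])
      have d2: "((\<lambda>y. S (t - y) (u y - u s)) has_vector_derivative S (t - s) (u' s)) (at s)"
        by (rule moving_operator_derivative[OF s uC u'(1)[OF s(1)] u'(2)[OF s(1)]])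
      have "(W has_vector_derivative S (t - s) v) (at (t - s))"
        unfolding W_def[abs_def] by (rule has_vector_derivative_integral_half_line[OF S_cont[OF v] ts])
      from vector_diff_chain_at[OF refl this]
      have d3: "((\<lambda>y. W (t - y)) has_vector_derivative - S (t - s) v) (at s)" by (simp add: o_def)
      have "((\<lambda>y. S (t - y) (u y - u s) + S (t - y) (u s) + W (t - y)) has_vector_derivative
          (S (t - s) (u' s) + - (u s + (1/2) *\<^sub>R S (t - s) (u s) - S (t - s) (g s)) + - S (t - s) v)) (at s)"
        by (intro has_vector_derivative_add d1 d2 d3)
      moreover have "S (t - s) (u' s) + - (u s + (1/2) *\<^sub>R S (t - s) (u s) - S (t - s) (g s)) + - S (t - s) v = - u s"
        unfolding Sg by (simp add: algebra_simps)
      ultimately have "((\<lambda>y. S (t - y) (u y - u s) + S (t - y) (u s) + W (t - y)) has_vector_derivative - u s) (at s)"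
        by (simp only:)
      then show ?thesis
      proof (rule has_vector_derivative_transform_within_open[where S="{0<..<t}"])
        fix y assume "y \<in> {0<..<t}"
        then have y: "0 < y" "y < t" by auto
        have "S (t - y) (u y - u s + u s) = S (t - y) (u y - u s) + S (t - y) (u s)"
          by (rule S_add) (use y s uC in \<open>auto intro!: subspace_diff[OF subspace_C0]\<close>)
        then show "S (t - y) (u y - u s) + S (t - y) (u s) + W (t - y) = G y" by (simp add: G_def)
      qed (use s in auto)
    qed
    have cSu: "continuous_on {0..t} (\<lambda>y. S (t - y) (u y))"
      unfolding continuous_on_def
    proof
      fix z assume z: "z \<in> {0..t}"
      have uz: "(u \<longlongrightarrow> u z) (at z within {0..t})"
        using continuous_on_subset[OF uc, of "{0..t}"] z by (auto simp: continuous_on_def)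
      have "((\<lambda>y. S (t - y) (u y) - S (t - z) (u z)) \<longlongrightarrow> 0) (at z within {0..t})"
      proof (rule Lim_null_comparison)
        show "\<forall>\<^sub>F y in at z within {0..t}. norm (S (t - y) (u y) - S (t - z) (u z)) \<le> t * norm (u y - u z) + \<bar>y - z\<bar> * norm (u z)"
          unfolding eventually_at_filter
        proof (rule always_eventually, intro allI impI)
          fix y assume y: "y \<in> {0..t}"
          have C: "u y \<in> C0" "u z \<in> C0" "u y - u z \<in> C0" using y z uC by (auto intro!: subspace_diff[OF subspace_C0])
          have "S (t - y) (u y) - S (t - z) (u z) = S (t - y) (u y - u z) + (S (t - y) (u z) - S (t - z) (u z))"
            using y C by (simp add: S_diff)
          also have "norm \<dots> \<le> norm (S (t - y) (u y - u z)) + norm (S (t - y) (u z) - S (t - z) (u z))"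
            by (rule norm_triangle_ineq)
          also have "\<dots> \<le> t * norm (u y - u z) + \<bar>y - z\<bar> * norm (u z)"
          proof (rule add_mono)
            have "norm (S (t - y) (u y - u z)) \<le> (t - y) * norm (u y - u z)" using norm_S_le[OF C(3)] y by simp
            also have "\<dots> \<le> t * norm (u y - u z)" by (rule mult_right_mono) (use y in auto)
            finally show "norm (S (t - y) (u y - u z)) \<le> t * norm (u y - u z)" .
            show "norm (S (t - y) (u z) - S (t - z) (u z)) \<le> \<bar>y - z\<bar> * norm (u z)"
              using norm_S_diff_le[OF C(2), of "t - z" "t - y"] y z by (simp add: abs_minus_commute)
          qed
          finally show "norm (S (t - y) (u y) - S (t - z) (u z)) \<le> t * norm (u y - u z) + \<bar>y - z\<bar> * norm (u z)" .
        qed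
        have "((\<lambda>y. t * norm (u y - u z) + \<bar>y - z\<bar> * norm (u z)) \<longlongrightarrow> t * norm (u z - u z) + \<bar>z - z\<bar> * norm (u z)) (at z within {0..t})"
          by (intro tendsto_intros uz)
        then show "((\<lambda>y. t * norm (u y - u z) + \<bar>y - z\<bar> * norm (u z)) \<longlongrightarrow> 0) (at z within {0..t})" by simp
      qed
      then show "((\<lambda>y. S (t - y) (u y)) \<longlongrightarrow> S (t - z) (u z)) (at z within {0..t})" by (rule LIM_zero_cancel)
    qed
    have "continuous_on {0..t} G" unfolding G_def
      by (intro continuous_on_add cSu continuous_on_compose2[OF Wc] continuous_intros) auto
    then have "((\<lambda>s. - u s) has_integral G t - G 0) {0..t}"
      using t dG by (intro fundamental_theorem_of_calculus_interior) auto
    \<comment> \<open>At \<open>t\<close> both terms vanish, since \<open>S 0\<close> is zero and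
      the integral is over one point; at 0 the first term vanishes because the solution starts at
      0.\<close>
    moreover have "G t - G 0 = - W t"
      using t S_0[OF uC[of t]] S_scale[of t 0 0] subspace_0[OF subspace_C0] by (simp add: G_def u0 W_def)
    ultimately have "((\<lambda>s. - u s) has_integral - W t) {0..t}" by simp
    from has_integral_neg[OF this] show ?thesis by (simp add: W_def integral_unique)
  qed
  show ?thesis by (rule integral_half_line_inj[OF uc S_cont[OF v] int_eq t0])
qed

section \<open>Approximation of the integrated semigroup by resolvents\<close>

text \<open>The difference is the mean of the time-changed path integrated against the error of the
  exponential approximation. That mean is at most \<open>norm u\<close> in modulus, and the two
  parts of the error bound have integral \<open>e\<close> each. The coefficients do not involve the
  clock, so they can be used for all processes at once.\<close>

lemma norm_S_minus_exp_sum: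
  assumes u: "u \<in> C0" and t: "0 \<le> t" and e: "0 < e"
    and approx: "\<And>s. 0 \<le> s \<Longrightarrow> \<bar>indicator {0..t} s - (\<Sum>i\<le>m. a i * exp (- real (Suc i) * s))\<bar> \<le> indicator {t..t + e} s + e * exp (- s)"
  shows "norm (S t u - (\<Sum>i\<le>m. a i *\<^sub>R res (real (Suc i)) u)) \<le> 2 * e * norm u"
proof (rule norm_bcontfun_le)
  fix x
  have app_sum: "apply_bcontfun (\<Sum>i\<le>m. a i *\<^sub>R res (real (Suc i)) u) x = (\<Sum>i\<le>m. a i * apply_bcontfun (res (real (Suc i)) u) x)"
    by (induction m) (simp_all add: plus_bcontfun.rep_eq scaleR_bcontfun.rep_eq)
  define h where "h i s = indicator {0..} s * (exp (- real (Suc i) * s) * tc_mean x u s)" for i s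
  have hi: "integrable lborel (h i)" for i unfolding h_def[abs_def] by (rule abs_laplace_le(2)[OF _ u]) simp
  have hr: "apply_bcontfun (res (real (Suc i)) u) x = (\<integral>s. h i s \<partial>lborel)" for i
    unfolding h_def by (rule res_laplace[OF _ u]) simp
  have int: "integrable lborel (\<lambda>s. indicator {0..t} s * tc_mean x u s - (\<Sum>i\<le>m. a i * h i s))"
    by (intro Bochner_Integration.integrable_diff Bochner_Integration.integrable_sum integrable_mult_right hi integrable_tc_mean_Icc u)
  have "apply_bcontfun (S t u - (\<Sum>i\<le>m. a i *\<^sub>R res (real (Suc i)) u)) x
    = (\<integral>s. indicator {0..t} s * tc_mean x u s - (\<Sum>i\<le>m. a i * h i s) \<partial>lborel)"
    using hi integrable_tc_mean_Icc[OF u, of 0 t x]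
    by (simp add: minus_bcontfun.rep_eq app_sum S_eq[OF u t] hr Bochner_Integration.integral_diff Bochner_Integration.integral_sum del: of_nat_Suc)
  also have "\<bar>\<dots>\<bar> \<le> (\<integral>s. norm u * (indicator {t..t + e} s + e * (indicator {0..} s * exp (- 1 * s))) \<partial>lborel)"
  proof (rule order_trans[OF integral_abs_bound integral_mono])
    show "integrable lborel (\<lambda>s. \<bar>indicator {0..t} s * tc_mean x u s - (\<Sum>i\<le>m. a i * h i s)\<bar>)" using int by (rule integrable_abs)
    show "integrable lborel (\<lambda>s. norm u * (indicator {t..t + e} s + e * (indicator {0..} s * exp (- 1 * s))))"
      by (intro integrable_mult_right Bochner_Integration.integrable_add integrable_exp_half_line integrable_real_indicator)
        (auto simp: emeasure_lborel_Icc_eq)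
    fix s :: real
    show "\<bar>indicator {0..t} s * tc_mean x u s - (\<Sum>i\<le>m. a i * h i s)\<bar> \<le> norm u * (indicator {t..t + e} s + e * (indicator {0..} s * exp (- 1 * s)))"
    proof (cases "0 \<le> s")
      case True
      have "(\<Sum>i\<le>m. a i * h i s) = (\<Sum>i\<le>m. a i * exp (- real (Suc i) * s)) * tc_mean x u s"
        using True by (simp add: h_def sum_distrib_right mult.assoc)
      then have "\<bar>indicator {0..t} s * tc_mean x u s - (\<Sum>i\<le>m. a i * h i s)\<bar>
         = \<bar>indicator {0..t} s - (\<Sum>i\<le>m. a i * exp (- real (Suc i) * s))\<bar> * \<bar>tc_mean x u s\<bar>"
        by (simp only: left_diff_distrib[symmetric] abs_mult)
      also have "\<dots> \<le> (indicator {t..t + e} s + e * exp (- s)) * norm u"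
        by (rule mult_mono[OF approx[OF True] abs_tc_mean_le]) (use e in auto)
      finally show ?thesis using True by (simp add: mult.commute)
    qed (use t in \<open>simp add: h_def\<close>)
  qed
  also have "\<dots> = 2 * e * norm u"
  proof -
    have "(\<integral>s. indicator {t..t + e} s + e * (indicator {0..} s * exp (- 1 * s)) \<partial>lborel)
       = (\<integral>s. indicator {t..t + e} s \<partial>lborel) + (\<integral>s. e * (indicator {0..} s * exp (- 1 * s)) \<partial>lborel)"
      by (intro Bochner_Integration.integral_add integrable_mult_right integrable_exp_half_line integrable_real_indicator)
        (auto simp: emeasure_lborel_Icc_eq)
    also have "(\<integral>s. e * (indicator {0..} s * exp (- 1 * s)) \<partial>lborel) = e"
      by (subst integral_mult_right_zero, subst integral_exp_half_line) auto
    also have "(\<integral>s. indicator {t..t + e} s \<partial>lborel) = e" using e by simp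
    finally show ?thesis by simp
  qed
  finally show "\<bar>apply_bcontfun (S t u - (\<Sum>i\<le>m. a i *\<^sub>R res (real (Suc i)) u)) x\<bar> \<le> 2 * e * norm u" .
qed

text \<open>The potential \<open>G\<^sup>\<mu> u\<close>, i.e. the resolvent at \<open>0\<close>.\<close>

definition pot :: "'a \<Rightarrow> ('a \<Rightarrow>\<^sub>C real) \<Rightarrow> real" where
  "pot x u = (\<integral>t. indicator {0..} t * tc_mean x u t \<partial>lborel)"

section \<open>Bounds in terms of the potential of 1\<close>

context
  fixes p \<mu>
  assumes formula: "potential_formula Y p A \<mu>" and fin: "\<And>x. potential1 (green p 0) \<mu> x < \<infinity>"
begin

text \<open>The case \<open>u = 0\<close>, \<open>c = 1\<close> of \<open>potential_eq\<close>: the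
  expected total clock value, which is the total level measure during which the time-changed process
  lives.\<close>

lemma nn_integral_tc_alive:
  "(\<integral>\<^sup>+t. ennreal (indicator {0..} t * tc_alive x t) \<partial>lborel) = potential1 (green p 0) \<mu> x"
proof -
  have 0: "(0 :: 'a \<Rightarrow>\<^sub>C real) \<in> C0" by (rule subspace_0[OF subspace_C0])
  have "tc_mean x 0 t = 0" for t using abs_tc_mean_le[of x 0 t] by simp
  with potential_eq[OF formula 0, of 1 x] show ?thesis by (simp add: potential1_def zero_bcontfun.rep_eq)
qed

lemma integrable_tc_alive: "integrable lborel (\<lambda>t. indicator {0..} t * tc_alive x t)"
  and integral_tc_alive: "(\<integral>t. indicator {0..} t * tc_alive x t \<partial>lborel) = enn2real (potential1 (green p 0) \<mu> x)"
proof -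
  have m: "(\<lambda>t. indicator {0..} t * tc_alive x t) \<in> borel_measurable lborel" using tc_alive_measurable by simp
  have n: "AE t in lborel. 0 \<le> indicator {0..} t * tc_alive x t" using tc_alive_bounds(1) by simp
  show "integrable lborel (\<lambda>t. indicator {0..} t * tc_alive x t)"
    by (rule integrableI_nonneg[OF m n]) (simp add: nn_integral_tc_alive fin[simplified])
  show "(\<integral>t. indicator {0..} t * tc_alive x t \<partial>lborel) = enn2real (potential1 (green p 0) \<mu> x)"
    by (subst integral_eq_nn_integral[OF m n]) (simp add: nn_integral_tc_alive)
qed

lemma integrable_tc_mean:
  assumes u: "u \<in> C0"
  shows "integrable lborel (\<lambda>t. indicator {0..} t * tc_mean x u t)"
proof (rule Bochner_Integration.integrable_bound[OF integrable_mult_right[OF integrable_tc_alive[of x], of "norm u"]])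
  show "AE t in lborel. norm (indicator {0..} t * tc_mean x u t) \<le> norm (norm u * (indicator {0..} t * tc_alive x t))"
    using abs_tc_mean_le_alive[OF _ u, of _ x] tc_alive_bounds(1) by (auto intro!: AE_I2 simp: indicator_def abs_mult)
qed (use tc_mean_measurable[OF u] in simp)

text \<open>Expresses the signed potential through potentials of nonnegative functions, to which
  \<open>uniform_potential_convergence\<close> applies.\<close>

lemma potential_eq_pot:
  assumes u: "u \<in> C0"
  shows "enn2real (\<integral>\<^sup>+y. green p 0 x y * ennreal (norm u + apply_bcontfun u y) \<partial>\<mu>)
    = norm u * enn2real (potential1 (green p 0) \<mu> x) + pot x u"
proof -
  have "enn2real (\<integral>\<^sup>+y. green p 0 x y * ennreal (norm u + apply_bcontfun u y) \<partial>\<mu>)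
    = enn2real (\<integral>\<^sup>+t. ennreal (indicator {0..} t * (norm u * tc_alive x t + tc_mean x u t)) \<partial>lborel)"
    by (simp only: potential_eq[OF formula u order_refl])
  also have "\<dots> = (\<integral>t. indicator {0..} t * (norm u * tc_alive x t + tc_mean x u t) \<partial>lborel)"
  proof (rule integral_eq_nn_integral[symmetric])
    show "AE t in lborel. 0 \<le> indicator {0..} t * (norm u * tc_alive x t + tc_mean x u t)"
    proof (rule AE_I2)
      fix t show "0 \<le> indicator {0..} t * (norm u * tc_alive x t + tc_mean x u t)"
        using abs_tc_mean_le_alive[OF _ u, of t x] by (auto simp: indicator_def abs_le_iff)
    qed
  qed (use tc_mean_measurable[OF u] tc_alive_measurable in simp)
  also have "\<dots> = (\<integral>t. norm u * (indicator {0..} t * tc_alive x t) + indicator {0..} t * tc_mean x u t \<partial>lborel)"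
    by (simp add: algebra_simps)
  also have "\<dots> = norm u * enn2real (potential1 (green p 0) \<mu> x) + pot x u"
    using integrable_tc_alive[of x] integrable_tc_mean[OF u, of x]
    by (simp add: Bochner_Integration.integral_add integral_tc_alive pot_def)
  finally show ?thesis .
qed

context
  fixes C :: real
  assumes C: "\<And>x. enn2real (potential1 (green p 0) \<mu> x) \<le> C"
begin

text \<open>In contrast to \<open>norm_res_le\<close> the bound does not deteriorate as \<alpha>
  tends to 0: the exponential is estimated by 1 and the mean by \<open>norm u\<close> times
  \<open>tc_alive\<close>, whose time integral is the potential of 1.\<close>

lemma norm_res_le_potential:
  assumes \<alpha>: "0 < \<alpha>" and u: "u \<in> C0"
  shows "norm (res \<alpha> u) \<le> C * norm u"
proof (rule norm_bcontfun_le)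
  fix x
  have "\<bar>apply_bcontfun (res \<alpha> u) x\<bar> \<le> (\<integral>t. norm u * (indicator {0..} t * tc_alive x t) \<partial>lborel)"
    unfolding res_laplace[OF \<alpha> u]
  proof (rule order_trans[OF integral_abs_bound integral_mono])
    fix t
    show "\<bar>indicator {0..} t * (exp (- \<alpha> * t) * tc_mean x u t)\<bar> \<le> norm u * (indicator {0..} t * tc_alive x t)"
    proof (cases "0 \<le> t")
      case True
      have "exp (- \<alpha> * t) * \<bar>tc_mean x u t\<bar> \<le> 1 * (norm u * tc_alive x t)"
        by (rule mult_mono[OF _ abs_tc_mean_le_alive[OF True u]]) (use True \<alpha> in auto)
      then show ?thesis using True by (simp add: abs_mult)
    qed simp
  qed (use abs_laplace_le(2)[OF \<alpha> u] integrable_tc_alive in auto)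
  also have "\<dots> = norm u * enn2real (potential1 (green p 0) \<mu> x)" by (simp add: integral_tc_alive)
  also have "\<dots> \<le> C * norm u" using mult_left_mono[OF C[of x], of "norm u"] by (simp add: mult.commute)
  finally show "\<bar>apply_bcontfun (res \<alpha> u) x\<bar> \<le> C * norm u" .
qed

lemma abs_res_minus_pot_le:
  assumes \<beta>: "0 < \<beta>" and u: "u \<in> C0"
  shows "\<bar>apply_bcontfun (res \<beta> u) x - pot x u\<bar> \<le> \<beta> * C\<^sup>2 * norm u"
proof -
  define \<gamma> where "\<gamma> n = \<beta> / real (Suc n)" for n
  have \<gamma>: "0 < \<gamma> n" "\<gamma> n \<le> \<beta>" for n using \<beta> by (simp_all add: \<gamma>_def divide_le_eq mult_le_cancel_left1)
  have C0': "0 \<le> C" using C[of x] enn2real_nonneg order_trans by blast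
  have "(\<lambda>n. \<beta> * (1 / real (Suc n))) \<longlonglongrightarrow> \<beta> * 0"
    by (intro tendsto_intros LIMSEQ_Suc[OF lim_1_over_n])
  then have \<gamma>0: "\<gamma> \<longlonglongrightarrow> 0" by (simp add: \<gamma>_def[abs_def])
  have "(\<lambda>n. \<integral>t. indicator {0..} t * (exp (- \<gamma> n * t) * tc_mean x u t) \<partial>lborel) \<longlonglongrightarrow> (\<integral>t. indicator {0..} t * (exp (- 0 * t) * tc_mean x u t) \<partial>lborel)"
  proof (rule integral_dominated_convergence[where w="\<lambda>t. norm (indicator {0..} t * tc_mean x u t)"])
    show "integrable lborel (\<lambda>t. norm (indicator {0..} t * tc_mean x u t))"
      by (rule integrable_norm[OF integrable_tc_mean[OF u]])
    show "AE t in lborel. (\<lambda>n. indicator {0..} t * (exp (- \<gamma> n * t) * tc_mean x u t)) \<longlonglongrightarrow> indicator {0..} t * (exp (- 0 * t) * tc_mean x u t)"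
      by (intro AE_I2 tendsto_intros \<gamma>0)
    show "AE t in lborel. norm (indicator {0..} t * (exp (- \<gamma> n * t) * tc_mean x u t)) \<le> norm (indicator {0..} t * tc_mean x u t)" for n
    proof (rule AE_I2)
      fix t
      show "norm (indicator {0..} t * (exp (- \<gamma> n * t) * tc_mean x u t)) \<le> norm (indicator {0..} t * tc_mean x u t)"
      proof (cases "0 \<le> t")
        case True
        have "exp (- \<gamma> n * t) \<le> 1" using True \<gamma>(1)[of n] by simp
        then have "exp (- \<gamma> n * t) * \<bar>tc_mean x u t\<bar> \<le> 1 * \<bar>tc_mean x u t\<bar>" by (rule mult_right_mono) simp
        then show ?thesis using True by (simp add: abs_mult)
      qed simp
    qed
  qed (use tc_mean_measurable[OF u] in simp_all)
  then have "(\<lambda>n. apply_bcontfun (res (\<gamma> n) u) x) \<longlonglongrightarrow> pot x u"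
    using res_laplace[OF \<gamma>(1) u] by (simp add: pot_def)
  then have "(\<lambda>n. \<bar>apply_bcontfun (res \<beta> u) x - apply_bcontfun (res (\<gamma> n) u) x\<bar>) \<longlonglongrightarrow> \<bar>apply_bcontfun (res \<beta> u) x - pot x u\<bar>"
    by (intro tendsto_intros)
  then show ?thesis
  proof (rule LIMSEQ_le_const2, intro exI[of _ 0] allI impI)
    fix n
    have r: "res \<beta> u \<in> C0" by (rule res(1)[OF \<beta> u])
    have "norm (res \<beta> u - res (\<gamma> n) u) = \<bar>\<gamma> n - \<beta>\<bar> * norm (res (\<gamma> n) (res \<beta> u))"
      unfolding resolvent_equation[OF \<gamma>(1) \<beta> u, symmetric] by simp
    also have "\<dots> \<le> \<beta> * (C * (C * norm u))"
    proof (rule mult_mono)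
      show "\<bar>\<gamma> n - \<beta>\<bar> \<le> \<beta>" using \<gamma>[of n] by simp
      show "norm (res (\<gamma> n) (res \<beta> u)) \<le> C * (C * norm u)"
        using norm_res_le_potential[OF \<gamma>(1) r, of n] mult_left_mono[OF norm_res_le_potential[OF \<beta> u] C0'] by (rule order_trans)
    qed (use \<beta> in auto)
    finally have "norm (res \<beta> u - res (\<gamma> n) u) \<le> \<beta> * C\<^sup>2 * norm u" by (simp add: power2_eq_square mult_ac)
    then show "\<bar>apply_bcontfun (res \<beta> u) x - apply_bcontfun (res (\<gamma> n) u) x\<bar> \<le> \<beta> * C\<^sup>2 * norm u"
      using norm_bounded[of "res \<beta> u - res (\<gamma> n) u" x] by (simp add: minus_bcontfun.rep_eq)
  qed
qed

end

end

end

lemma kato_bounded: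
  assumes "kato G \<nu>"
  obtains C where "0 \<le> C" "\<And>x. enn2real (potential1 G \<nu> x) \<le> C"
proof -
  let ?g = "\<lambda>x. enn2real (potential1 G \<nu> x)"
  have "vanishing_at_infinity ?g" using assms by (simp add: kato_def)
  then obtain K where K: "compact K" "\<forall>x. x \<notin> K \<longrightarrow> \<bar>?g x\<bar> < 1"
    unfolding vanishing_at_infinity_def by (metis zero_less_one)
  have "continuous_on K ?g" by (rule continuous_on_subset[of UNIV]) (use assms in \<open>auto simp: kato_def\<close>)
  then have "bounded (?g ` K)" by (intro compact_imp_bounded compact_continuous_image K)
  then obtain B where B: "\<forall>x\<in>K. \<bar>?g x\<bar> \<le> B" unfolding bounded_iff by auto
  show thesis
  proof (rule that[of "max 1 B"])
    fix x show "?g x \<le> max 1 B"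
      using K(2)[rule_format, of x] B by (cases "x \<in> K") force+
  qed simp
qed

text \<open>A common Lipschitz constant extends convergence at one time to a neighbourhood of that
  time, and finitely many neighbourhoods cover the interval.\<close>

lemma uniform_limit_time:
  fixes f :: "nat \<Rightarrow> real \<Rightarrow> 'b::real_normed_vector"
  assumes lim: "\<And>t e. 0 \<le> t \<Longrightarrow> 0 < e \<Longrightarrow> \<forall>\<^sub>F n in sequentially. norm (f n t - g t) < e"
    and lip: "\<And>n s t. 0 \<le> s \<Longrightarrow> 0 \<le> t \<Longrightarrow> norm (f n t - f n s) \<le> \<bar>t - s\<bar> * L"
    and lip': "\<And>s t. 0 \<le> s \<Longrightarrow> 0 \<le> t \<Longrightarrow> norm (g t - g s) \<le> \<bar>t - s\<bar> * L"
    and L: "0 \<le> L" and e: "0 < e"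
  shows "\<forall>\<^sub>F n in sequentially. \<forall>t\<in>{0..T}. norm (f n t - g t) < e"
proof -
  have "\<forall>\<^sub>F n in sequentially. \<forall>t\<in>{0..T}. 0 \<le> t \<longrightarrow> norm (f n t - g t) < e"
  proof (rule eventually_ball_compact)
    fix t :: real assume "t \<in> {0..T}"
    then have t: "0 \<le> t" by simp
    define d where "d = e / (4 * (L + 1))"
    have d: "0 < d" using e L by (simp add: d_def)
    have dL: "d * L \<le> e / 4" using e L by (simp add: d_def field_simps)
    have "\<forall>\<^sub>F n in sequentially. norm (f n t - g t) < e / 4" by (rule lim[OF t]) (use e in simp)
    then have "\<forall>\<^sub>F n in sequentially. \<forall>t'\<in>ball t d. 0 \<le> t' \<longrightarrow> norm (f n t' - g t') < e"
    proof eventually_elim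
      case (elim n)
      show ?case
      proof (intro ballI impI)
        fix t' assume t': "t' \<in> ball t d" "0 \<le> t'"
        have "\<bar>t' - t\<bar> * L \<le> d * L" by (rule mult_right_mono[OF _ L]) (use t' in \<open>auto simp: dist_real_def\<close>)
        then have 1: "norm (f n t' - f n t) \<le> e / 4" "norm (g t' - g t) \<le> e / 4"
          using lip[OF t t'(2), of n] lip'[OF t t'(2)] dL by linarith+
        have "norm (f n t' - g t') = norm ((f n t' - f n t) + (f n t - g t) - (g t' - g t))" by simp
        then have "norm (f n t' - g t') \<le> norm (f n t' - f n t) + norm (f n t - g t) + norm (g t' - g t)"
          using norm_triangle_ineq4[of "(f n t' - f n t) + (f n t - g t)" "g t' - g t"]
            norm_triangle_ineq[of "f n t' - f n t" "f n t - g t"] by linarith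
        with 1 elim e show "norm (f n t' - g t') < e" by linarith
      qed
    qed
      then show "\<exists>U. open U \<and> t \<in> U \<and> (\<forall>\<^sub>F n in sequentially. \<forall>t'\<in>U. 0 \<le> t' \<longrightarrow> norm (f n t' - g t') < e)"
      using d by (intro exI[of _ "ball t d"]) simp
  qed simp
  then show ?thesis by eventually_elim auto
qed


theorem theorem4p1:
  fixes m :: "'a::{metric_space, second_countable_topology} measure"
    and Y :: "('w, 'a) process"
    and Yhat :: "('v, 'a) process"
    and p :: "real \<Rightarrow> 'a \<Rightarrow> 'a \<Rightarrow> ennreal"
    and \<mu> :: "enat \<Rightarrow> 'a measure"
    and A :: "enat \<Rightarrow> real \<Rightarrow> 'w \<Rightarrow> ennreal"
    and S :: "enat \<Rightarrow> real \<Rightarrow> ('a \<Rightarrow>\<^sub>C real) \<Rightarrow> ('a \<Rightarrow>\<^sub>C real)"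
    and v :: "enat \<Rightarrow> 'a \<Rightarrow>\<^sub>C real"
  assumes "locally_compact_space (euclidean :: 'a topology)"
    and "radon m" and "full_support m"
    and "standard_process Y" and "transient Y"
    and "standard_process Yhat" and "transient Yhat" and "in_duality m Y Yhat"
    and "transition_density m Y p" and "\<And>t x y. t > 0 \<Longrightarrow> p t x y > 0"
    and "\<exists>x y. green p 0 x y \<noteq> \<infinity>"
    and "lower_semicontinuous (\<lambda>(x, y). green p 0 x y)"
    and "\<And>n. kato (green p 0) (\<mu> n)"
    and "\<And>n. pcaf Y (A n)"
    and "\<And>n. revuz_measure m Y (A n) (\<mu> n)"
    and "\<And>n. potential_formula Y p (A n) (\<mu> n)"
    and "\<And>n. integrated_semigroup (tc_resolvent Y (A n)) (S n)"
    and "vague_limit (\<lambda>n. \<mu> (enat n)) (\<mu> \<infinity>)"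
    and "uniform_limit UNIV (\<lambda>n x. enn2real (potential1 (green p 0) (\<mu> (enat n)) x))
           (\<lambda>x. enn2real (potential1 (green p 0) (\<mu> \<infinity>) x)) sequentially"
    and "\<And>n. v n \<in> C0"
    and "(\<lambda>n. norm (v (enat n) - v \<infinity>)) \<longlonglongrightarrow> 0"
  shows "(\<forall>n u. classical_solution (lin_rel (tc_resolvent Y (A n))) (v n) u \<longrightarrow>
            (\<forall>t\<ge>0. u t = S n t (v n))) \<and>
         (\<forall>T\<ge>0. uniform_limit {0..T} (\<lambda>n t. S (enat n) t (v (enat n)))
            (\<lambda>t. S \<infinity> t (v \<infinity>)) sequentially)"
proof -
  interpret I: tc_integrated Y "A n" "S n" for n
    by unfold_locales (use assms in auto)
  let ?G = "green p 0"
  have cancel: "N * (e / (k * N)) = e / k" if "0 < N" for N e k :: real using that by simp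
  have fin: "potential1 ?G (\<mu> n) x < \<infinity>" for n x using assms(13)[of n] by (simp add: kato_def)
  obtain C1 where C1: "0 \<le> C1" "\<And>x. enn2real (potential1 ?G (\<mu> \<infinity>) x) \<le> C1"
    by (rule kato_bounded[OF assms(13)[of \<infinity>]]) blast
  \<comment> \<open>A bound for the limit potential plus 1: by uniform convergence it eventually
    bounds the potentials of 1 for all later indices too, so the error in
    \<open>abs_res_minus_pot_le\<close> is uniform in \<open>n\<close>.\<close>
  define C where "C = C1 + 1"
  have Cinf: "enn2real (potential1 ?G (\<mu> \<infinity>) x) \<le> C" for x using C1(2)[of x] by (simp add: C_def)
  have evC: "\<forall>\<^sub>F n in sequentially. \<forall>x. enn2real (potential1 ?G (\<mu> (enat n)) x) \<le> C"
    using uniform_limitD[OF assms(19) zero_less_one]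
  proof eventually_elim
    case (elim n)
    show ?case
    proof
      fix x show "enn2real (potential1 ?G (\<mu> (enat n)) x) \<le> C"
        using elim C1(2)[of x] by (auto simp: C_def dist_real_def dest!: spec[of _ x])
    qed
  qed
  have pot_conv: "\<forall>\<^sub>F n in sequentially. \<forall>x. \<bar>I.pot (enat n) x u - I.pot \<infinity> x u\<bar> < e" if u: "u \<in> C0" and e: "0 < e" for u e
  proof -
    \<comment> \<open>The potential of \<open>u\<close> is the potential of
      \<open>norm u + u\<close> minus \<open>norm u\<close> times the potential of 1. Each part is
      allowed an error of \<open>e / 2\<close>; the added 1 covers the case
      \<open>u = 0\<close>.\<close>
    define d where "d = e / (2 * (norm u + 1))"
    have d: "0 < d" using e by (simp add: d_def add_nonneg_pos)
    have du: "norm u * d \<le> e / 2"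
    proof -
      have pos: "0 < norm u + 1" by (simp add: add_nonneg_pos)
      have "norm u * d \<le> (norm u + 1) * d" by (rule mult_right_mono) (use d in auto)
      also have "\<dots> = e / 2" using cancel[OF pos, of e 2] by (simp only: d_def)
      finally show ?thesis .
    qed
    have "\<forall>\<^sub>F n in sequentially. \<forall>x. \<bar>enn2real (\<integral>\<^sup>+y. ?G x y * ennreal (norm u + apply_bcontfun u y) \<partial>\<mu> (enat n))
       - enn2real (\<integral>\<^sup>+y. ?G x y * ennreal (norm u + apply_bcontfun u y) \<partial>\<mu> \<infinity>)\<bar> < e / 2"
      by (rule uniform_potential_convergence[OF assms(1,12) assms(13) assms(13) assms(18,19)])
        (use e norm_bounded[of u] in auto)
    moreover have "\<forall>\<^sub>F n in sequentially. \<forall>x. dist (enn2real (potential1 ?G (\<mu> (enat n)) x)) (enn2real (potential1 ?G (\<mu> \<infinity>) x)) < d"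
      using uniform_limitD[OF assms(19) d] by simp
    ultimately show ?thesis
    proof eventually_elim
      case (elim n)
      show ?case
      proof
        fix x
        let ?g = "\<lambda>n. enn2real (potential1 ?G (\<mu> n) x)"
        have 1: "\<bar>(norm u * ?g (enat n) + I.pot (enat n) x u) - (norm u * ?g \<infinity> + I.pot \<infinity> x u)\<bar> < e / 2"
          using spec[OF elim(1), of x]
          by (simp only: I.potential_eq_pot[OF assms(16) fin u])
        have "\<bar>norm u * ?g (enat n) - norm u * ?g \<infinity>\<bar> = norm u * dist (?g (enat n)) (?g \<infinity>)"
          by (simp only: right_diff_distrib[symmetric] abs_mult abs_norm_cancel dist_real_def)
        also have "\<dots> \<le> norm u * d" by (rule mult_left_mono) (use spec[OF elim(2), of x] in auto)
        finally have "\<bar>norm u * ?g (enat n) - norm u * ?g \<infinity>\<bar> \<le> e / 2" using du by linarith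
        with 1 show "\<bar>I.pot (enat n) x u - I.pot \<infinity> x u\<bar> < e" by linarith
      qed
    qed
  qed
  \<comment> \<open>The resolvents are compared through the potentials. The detour costs an error of
    order \<beta> on each side, which does not vanish as n grows; this is why \<beta> has to be
    chosen small afterwards.\<close>
  have res_conv0: "\<forall>\<^sub>F n in sequentially. norm (I.res (enat n) \<beta> u - I.res \<infinity> \<beta> u) \<le> 2 * (\<beta> * C\<^sup>2 * norm u) + e"
    if u: "u \<in> C0" and \<beta>: "0 < \<beta>" and e: "0 < e" for u \<beta> e
    using pot_conv[OF u e] evC
  proof eventually_elim
    case (elim n)
    show ?case
    proof (rule norm_bcontfun_le)
      fix x
      have "\<bar>apply_bcontfun (I.res (enat n) \<beta> u) x - I.pot (enat n) x u\<bar> \<le> \<beta> * C\<^sup>2 * norm u"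
        by (rule I.abs_res_minus_pot_le[OF assms(16) fin _ \<beta> u]) (use elim(2) in blast)
      moreover have "\<bar>apply_bcontfun (I.res \<infinity> \<beta> u) x - I.pot \<infinity> x u\<bar> \<le> \<beta> * C\<^sup>2 * norm u"
        by (rule I.abs_res_minus_pot_le[OF assms(16) fin Cinf \<beta> u])
      moreover have "\<bar>I.pot (enat n) x u - I.pot \<infinity> x u\<bar> < e" using elim(1) by blast
      ultimately show "\<bar>apply_bcontfun (I.res (enat n) \<beta> u - I.res \<infinity> \<beta> u) x\<bar> \<le> 2 * (\<beta> * C\<^sup>2 * norm u) + e"
        unfolding minus_bcontfun.rep_eq by linarith
    qed
  qed
  \<comment> \<open>The resolvents at \<open>\<alpha>\<close> and at a small \<open>\<beta>\<close> are related by
    \<open>R\<^sup>n\<^sub>\<alpha> - R\<^sub>\<alpha> = (1 - (\<alpha> - \<beta>) R\<^sup>n\<^sub>\<alpha>) (R\<^sup>n\<^sub>\<beta> - R\<^sub>\<beta>) (1 - (\<alpha> - \<beta>) R\<^sub>\<alpha>)\<close>.\<close>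
  have res_conv: "\<forall>\<^sub>F n in sequentially. norm (I.res (enat n) \<alpha> u - I.res \<infinity> \<alpha> u) < e"
    if u: "u \<in> C0" and \<alpha>: "0 < \<alpha>" and e: "0 < e" for u \<alpha> e
  proof -
    \<comment> \<open>\<open>norm z\<close> will be at most \<open>2 * norm u\<close>, so
      \<open>M\<close> bounds \<open>norm z\<close> times the square of \<open>C\<close>. The final
      estimate is twice the bound \<open>2 * (\<beta> * M) + e / 8\<close> for the norm of
      \<open>q\<close>; since \<open>\<beta> * M\<close> is at most \<open>e / 16\<close>, this is
      at most \<open>e / 2\<close>.\<close>
    define M where "M = C\<^sup>2 * (2 * norm u) + 1"
    have M: "0 < M" by (simp add: M_def add_nonneg_pos)
    define \<beta> where "\<beta> = min (\<alpha> / 2) (e / (16 * M))"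
    have \<beta>: "0 < \<beta>" "\<beta> < \<alpha>" using \<alpha> e M by (auto simp: \<beta>_def min_def)
    have \<beta>M: "\<beta> * M \<le> e / 16"
    proof -
      have "\<beta> * M \<le> e / (16 * M) * M" by (rule mult_right_mono) (use M in \<open>auto simp: \<beta>_def\<close>)
      then show ?thesis using M by simp
    qed
    \<comment> \<open>This choice makes the limit resolvent at \<beta> applied to \<open>z\<close>
      equal to the limit resolvent at \<alpha> applied to \<open>u\<close>, as \<open>Rz\<close>
      shows.\<close>
    define z where "z = u - (\<alpha> - \<beta>) *\<^sub>R I.res \<infinity> \<alpha> u"
    have ri: "I.res \<infinity> \<alpha> u \<in> C0" by (rule I.res(1)[OF \<alpha> u])
    have z: "z \<in> C0" unfolding z_def by (intro subspace_diff[OF subspace_C0] subspace_scale[OF subspace_C0] u ri)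
    \<comment> \<open>\<alpha> times the resolvent at \<alpha> is a contraction and
      \<open>\<alpha> - \<beta>\<close> is smaller than \<alpha>. Hence each outer factor, the
      identity minus \<open>\<alpha> - \<beta>\<close> times a resolvent at \<alpha>, has norm at
      most 2, for every index.\<close>
    have contr: "(\<alpha> - \<beta>) * norm (I.res n \<alpha> w) \<le> norm w" if w: "w \<in> C0" for n w
    proof -
      have "(\<alpha> - \<beta>) * norm (I.res n \<alpha> w) \<le> \<alpha> * (norm w / \<alpha>)"
        by (rule mult_mono[OF _ I.norm_res_le[OF \<alpha> w]]) (use \<alpha> \<beta> in auto)
      then show ?thesis using \<alpha> by simp
    qed
    have nz: "norm z \<le> 2 * norm u"
    proof -
      have "norm z \<le> norm u + norm ((\<alpha> - \<beta>) *\<^sub>R I.res \<infinity> \<alpha> u)" unfolding z_def by (rule norm_triangle_ineq4)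
      then show ?thesis using contr[OF u, of \<infinity>] \<beta> by simp
    qed
    have Rz: "I.res \<infinity> \<beta> z = I.res \<infinity> \<alpha> u"
    proof -
      have "(\<beta> - \<alpha>) *\<^sub>R I.res \<infinity> \<beta> (I.res \<infinity> \<alpha> u) = I.res \<infinity> \<alpha> u - I.res \<infinity> \<beta> u"
        by (rule I.resolvent_equation[OF \<beta>(1) \<alpha> u])
      then show ?thesis
        unfolding z_def I.res_diff[OF \<beta>(1) u subspace_scale[OF subspace_C0 ri]] I.res_scale[OF \<beta>(1) ri]
        by (simp add: scaleR_left_diff_distrib algebra_simps)
    qed
    have "\<forall>\<^sub>F n in sequentially. norm (I.res (enat n) \<beta> z - I.res \<infinity> \<beta> z) \<le> 2 * (\<beta> * C\<^sup>2 * norm z) + e / 8"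
      by (rule res_conv0[OF z \<beta>(1)]) (use e in simp)
    then show ?thesis
    proof eventually_elim
      case (elim n)
      let ?R = "I.res (enat n)"
      \<comment> \<open>The middle factor applied to \<open>z\<close>. Applying the left factor
        telescopes by the resolvent equation, leaving the difference of the two resolvents at
        \<alpha>.\<close>
      define q where "q = ?R \<beta> z - I.res \<infinity> \<beta> z"
      have Rnz: "?R \<beta> z \<in> C0" by (rule I.res(1)[OF \<beta>(1) z])
      have q: "q \<in> C0" unfolding q_def Rz by (intro subspace_diff[OF subspace_C0] Rnz ri)
      have e1: "(\<alpha> - \<beta>) *\<^sub>R ?R \<alpha> (?R \<beta> z) = ?R \<beta> z - ?R \<alpha> z"
        by (rule I.resolvent_equation[OF \<alpha> \<beta>(1) z])
      have e2: "?R \<alpha> z = ?R \<alpha> u - (\<alpha> - \<beta>) *\<^sub>R ?R \<alpha> (I.res \<infinity> \<alpha> u)"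
        unfolding z_def I.res_diff[OF \<alpha> u subspace_scale[OF subspace_C0 ri]] I.res_scale[OF \<alpha> ri] ..
      have e3: "?R \<alpha> q = ?R \<alpha> (?R \<beta> z) - ?R \<alpha> (I.res \<infinity> \<alpha> u)"
        unfolding q_def Rz by (rule I.res_diff[OF \<alpha> Rnz ri])
      have "q - (\<alpha> - \<beta>) *\<^sub>R ?R \<alpha> q = ?R \<alpha> u - I.res \<infinity> \<alpha> u"
        unfolding e3 scaleR_right_diff_distrib e1 e2 by (simp add: q_def Rz)
      then have "norm (?R \<alpha> u - I.res \<infinity> \<alpha> u) \<le> norm q + norm ((\<alpha> - \<beta>) *\<^sub>R ?R \<alpha> q)"
        using norm_triangle_ineq4[of q "(\<alpha> - \<beta>) *\<^sub>R ?R \<alpha> q"] by simp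
      also have "norm ((\<alpha> - \<beta>) *\<^sub>R ?R \<alpha> q) \<le> norm q" using contr[OF q, of "enat n"] \<beta> by simp
      also have "norm q \<le> 2 * (\<beta> * C\<^sup>2 * norm z) + e / 8" using elim by (simp add: q_def)
      also have "\<beta> * C\<^sup>2 * norm z \<le> \<beta> * M"
      proof -
        have "C\<^sup>2 * norm z \<le> M" using mult_left_mono[OF nz, of "C\<^sup>2"] by (simp add: M_def)
        from mult_left_mono[OF this, of \<beta>] \<beta> show ?thesis by (simp add: mult.assoc)
      qed
      finally show "norm (?R \<alpha> u - I.res \<infinity> \<alpha> u) < e" using \<beta>M e by linarith
    qed
  qed
  have S_conv: "\<forall>\<^sub>F n in sequentially. norm (S (enat n) t u - S \<infinity> t u) < e"
    if u: "u \<in> C0" and t: "0 \<le> t" and e: "0 < e" for u t e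
  proof -
    \<comment> \<open>The error \<open>2 * d * norm u\<close> of the exponential approximation is
      then at most \<open>e / 4\<close>, for the index \<open>n\<close> and for the limit
      alike.\<close>
    define d where "d = e / (8 * (norm u + 1))"
    have d: "0 < d" using e by (simp add: d_def add_nonneg_pos)
    have du: "2 * d * norm u \<le> e / 4"
    proof -
      have pos: "0 < norm u + 1" by (simp add: add_nonneg_pos)
      have "2 * d * norm u \<le> 2 * d * (norm u + 1)" by (rule mult_left_mono) (use d in auto)
      also have "\<dots> = 2 * ((norm u + 1) * d)" by simp
      also have "\<dots> = e / 4" using cancel[OF pos, of e 8] by (simp only: d_def)
      finally show ?thesis .
    qed
    obtain a m where am: "\<And>s. 0 \<le> s \<Longrightarrow> \<bar>indicator {0..t} s - (\<Sum>i\<le>m. a i * exp (- real (Suc i) * s))\<bar> \<le> indicator {t..t + d} s + d * exp (- s)"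
      by (rule indicator_exp_approx[OF t d]) blast
    define Q where "Q n = (\<Sum>i\<le>m. a i *\<^sub>R I.res n (real (Suc i)) u)" for n
    have SQ: "norm (S n t u - Q n) \<le> e / 4" for n
      using I.norm_S_minus_exp_sum[OF u t d am, of n] du unfolding Q_def by linarith
    \<comment> \<open>Only the finitely many resolvents in the sum have to converge; weighted with
      the coefficients, an error of \<open>b\<close> in each adds up to at most
      \<open>e / 4\<close>.\<close>
    define b where "b = e / (4 * ((\<Sum>i\<le>m. \<bar>a i\<bar>) + 1))"
    have sa: "0 \<le> (\<Sum>i\<le>m. \<bar>a i\<bar>)" by (rule sum_nonneg) simp
    have sa1: "0 < (\<Sum>i\<le>m. \<bar>a i\<bar>) + 1" using sa by linarith
    have b: "0 < b" unfolding b_def by (intro divide_pos_pos mult_pos_pos e sa1) simp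
    have sb: "(\<Sum>i\<le>m. \<bar>a i\<bar>) * b \<le> e / 4"
    proof -
      have "(\<Sum>i\<le>m. \<bar>a i\<bar>) * b \<le> ((\<Sum>i\<le>m. \<bar>a i\<bar>) + 1) * b" by (rule mult_right_mono) (use b in auto)
      also have "\<dots> = e / 4" unfolding b_def by (rule cancel[OF sa1])
      finally show ?thesis .
    qed
    have "\<forall>\<^sub>F n in sequentially. \<forall>i\<in>{..m}. norm (I.res (enat n) (real (Suc i)) u - I.res \<infinity> (real (Suc i)) u) < b"
      by (intro eventually_ball_finite ballI res_conv[OF u _ b]) auto
    then show ?thesis
    proof eventually_elim
      case (elim n)
      have "Q (enat n) - Q \<infinity> = (\<Sum>i\<le>m. a i *\<^sub>R (I.res (enat n) (real (Suc i)) u - I.res \<infinity> (real (Suc i)) u))"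
        by (simp only: Q_def sum_subtractf[symmetric] scaleR_right_diff_distrib)
      also have "norm \<dots> \<le> (\<Sum>i\<le>m. \<bar>a i\<bar> * b)"
      proof (rule sum_norm_le)
        fix i assume "i \<in> {..m}"
        then have "norm (I.res (enat n) (real (Suc i)) u - I.res \<infinity> (real (Suc i)) u) \<le> b"
          using elim less_imp_le by blast
        from mult_left_mono[OF this, of "\<bar>a i\<bar>"]
        show "norm (a i *\<^sub>R (I.res (enat n) (real (Suc i)) u - I.res \<infinity> (real (Suc i)) u)) \<le> \<bar>a i\<bar> * b" by simp
      qed
      also have "\<dots> = (\<Sum>i\<le>m. \<bar>a i\<bar>) * b" by (rule sum_distrib_right[symmetric])
      finally have 1: "norm (Q (enat n) - Q \<infinity>) \<le> e / 4" using sb by linarith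
      have "norm (S (enat n) t u - S \<infinity> t u) = norm ((S (enat n) t u - Q (enat n)) + (Q (enat n) - Q \<infinity>) - (S \<infinity> t u - Q \<infinity>))" by simp
      then have "norm (S (enat n) t u - S \<infinity> t u) \<le> norm (S (enat n) t u - Q (enat n)) + norm (Q (enat n) - Q \<infinity>) + norm (S \<infinity> t u - Q \<infinity>)"
        using norm_triangle_ineq4[of "(S (enat n) t u - Q (enat n)) + (Q (enat n) - Q \<infinity>)" "S \<infinity> t u - Q \<infinity>"]
          norm_triangle_ineq[of "S (enat n) t u - Q (enat n)" "Q (enat n) - Q \<infinity>"] by linarith
      with 1 SQ[of "enat n"] SQ[of \<infinity>] e show "norm (S (enat n) t u - S \<infinity> t u) < e" by linarith
    qed
  qed
  show ?thesis
  proof (intro conjI allI impI)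
    fix n u and t :: real
    assume "classical_solution (lin_rel (tc_resolvent Y (A n))) (v n) u" "0 \<le> t"
    then show "u t = S n t (v n)" by (rule I.classical_solution_eq[OF assms(20)])
  next
    fix T :: real assume T: "0 \<le> T"
    show "uniform_limit {0..T} (\<lambda>n t. S (enat n) t (v (enat n))) (\<lambda>t. S \<infinity> t (v \<infinity>)) sequentially"
    proof (rule uniform_limitI)
      fix e :: real assume e: "0 < e"
      have "\<forall>\<^sub>F n in sequentially. \<forall>t\<in>{0..T}. norm (S (enat n) t (v \<infinity>) - S \<infinity> t (v \<infinity>)) < e / 2"
        by (rule uniform_limit_time[where L="norm (v \<infinity>)"])
          (use S_conv[OF assms(20)[of \<infinity>]] I.norm_S_diff_le[OF assms(20)[of \<infinity>]] e in auto)
      \<comment> \<open>Replacing the initial vectors costs at most \<open>t\<close> times their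
        distance, by \<open>norm_S_le\<close>, hence at most \<open>e / 2\<close> on the interval;
        the added 1 covers \<open>T = 0\<close>.\<close>
      moreover have "\<forall>\<^sub>F n in sequentially. norm (v (enat n) - v \<infinity>) < e / (2 * (T + 1))"
        by (rule order_tendstoD(2)[OF assms(21)]) (use e T in simp)
      ultimately show "\<forall>\<^sub>F n in sequentially. \<forall>t\<in>{0..T}. dist (S (enat n) t (v (enat n))) (S \<infinity> t (v \<infinity>)) < e"
      proof eventually_elim
        case (elim n)
        show ?case
        proof
          fix t assume t: "t \<in> {0..T}"
          have vC: "v (enat n) - v \<infinity> \<in> C0" by (intro subspace_diff[OF subspace_C0] assms(20))
          have "S (enat n) t (v (enat n)) - S (enat n) t (v \<infinity>) = S (enat n) t (v (enat n) - v \<infinity>)"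
            using t by (simp add: I.S_diff assms(20))
          also have "norm \<dots> \<le> t * norm (v (enat n) - v \<infinity>)" by (rule I.norm_S_le[OF vC]) (use t in simp)
          also have "\<dots> \<le> T * (e / (2 * (T + 1)))" by (rule mult_mono) (use t T elim(2) in auto)
          also have "\<dots> \<le> e / 2" using e T by (simp add: field_simps)
          finally have 1: "norm (S (enat n) t (v (enat n)) - S (enat n) t (v \<infinity>)) \<le> e / 2" .
          have "dist (S (enat n) t (v (enat n))) (S \<infinity> t (v \<infinity>)) \<le>
             dist (S (enat n) t (v (enat n))) (S (enat n) t (v \<infinity>)) + dist (S (enat n) t (v \<infinity>)) (S \<infinity> t (v \<infinity>))"
            by (rule dist_triangle)
          moreover have "norm (S (enat n) t (v \<infinity>) - S \<infinity> t (v \<infinity>)) < e / 2" using elim(1) t by blast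
          ultimately show "dist (S (enat n) t (v (enat n))) (S \<infinity> t (v \<infinity>)) < e"
            using 1 unfolding dist_norm by linarith
        qed
      qed
    qed
  qed
qed

end
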